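(* Let $0\le m<+\infty$. Then, for either choice of the sign $\pm$, $$\int_{\mathbb{R}^3}\frac{1}{|x|}|\psi|^2\,dx\le\int_{\mathbb{R}^3}|x|\,\bigl|(i\alpha\cdot\nabla-m\beta\pm\epsilon i)\psi\bigr|^2\,dx,\qquad \epsilon>0.$$ The inequality is sharp in the sense that the constant on the right-hand side cannot be improved.
   Context: Here $\psi:\mathbb{R}^3\to\mathbb{C}^4$. The Pauli matrices are $\sigma_1=\begin{pmatrix}0&1\\1&0\end{pmatrix}$, $\sigma_2=\begin{pmatrix}0&-i\\i&0\end{pmatrix}$, $\sigma_3=\begin{pmatrix}1&0\\0&-1\end{pmatrix}$; the Dirac matrices are the $4\times4$ matrices $\alpha_k=\begin{pmatrix}0&\sigma_k\\\sigma_k&0\end{pmatrix}$ ($k=1,2,3$) and $\beta=\begin{pmatrix}\mathbb{I}_2&0\\0&-\mathbb{I}_2\end{pmatrix}$, where $\mathbb{I}_n$ is the $n\times n$ identity matrix. $\alpha\cdot\nabla=\sum_{k=1}^3\alpha_k\partial_k$, and the scalar $\pm\epsilon i$ stands for $\pm\epsilon i\,\mathbb{I}_4$. *)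

theory Defs
  imports "HOL-Analysis.Analysis"
begin

section \<open>Pauli and Dirac matrices\<close>

definition pauli :: "3 \<Rightarrow> complex^2^2" where
  "pauli k =
     (if k = 1 then vector [vector [0, 1], vector [1, 0]]
      else if k = 2 then vector [vector [0, - \<i>], vector [\<i>, 0]]
      else vector [vector [1, 0], vector [0, - 1]])"

definition block_matrix ::
    "complex^2^2 \<Rightarrow> complex^2^2 \<Rightarrow> complex^2^2 \<Rightarrow> complex^2^2 \<Rightarrow> complex^4^4" where
  "block_matrix A B C D = vector
     [vector [A$1$1, A$1$2, B$1$1, B$1$2],
      vector [A$2$1, A$2$2, B$2$1, B$2$2],
      vector [C$1$1, C$1$2, D$1$1, D$1$2],
      vector [C$2$1, C$2$2, D$2$1, D$2$2]]"

definition dirac_alpha :: "3 \<Rightarrow> complex^4^4" where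
  "dirac_alpha k = block_matrix 0 (pauli k) (pauli k) 0"

definition dirac_beta :: "complex^4^4" where
  "dirac_beta = block_matrix (mat 1) 0 0 (- mat 1)"

lemma vector_4 [simp]:
  "(vector [a, b, c, d] :: 'a::zero^4) $ 1 = a"
  "(vector [a, b, c, d] :: 'a::zero^4) $ 2 = b"
  "(vector [a, b, c, d] :: 'a::zero^4) $ 3 = c"
  "(vector [a, b, c, d] :: 'a::zero^4) $ 4 = d"
  by (simp_all add: vector_def)

section \<open>Test functions and weak derivatives\<close>

definition partial :: "3 \<Rightarrow> (real^3 \<Rightarrow> 'b::real_normed_vector) \<Rightarrow> real^3 \<Rightarrow> 'b" where
  "partial k f x = frechet_derivative f (at x) (axis k 1)"

primrec cont_diff :: "nat \<Rightarrow> (real^3 \<Rightarrow> 'b::real_normed_vector) \<Rightarrow> bool" where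
  "cont_diff 0 f \<longleftrightarrow> continuous_on UNIV f"
| "cont_diff (Suc n) f \<longleftrightarrow>
     (\<forall>x. f differentiable (at x)) \<and> (\<forall>k. cont_diff n (partial k f))"

text \<open>The space \<open>C\<^sub>c\<^sup>\<infinity>\<close>.\<close>

definition test_function :: "(real^3 \<Rightarrow> 'b::real_normed_vector) \<Rightarrow> bool" where
  "test_function \<phi> \<longleftrightarrow> (\<forall>n. cont_diff n \<phi>) \<and> compact (closure {x. \<phi> x \<noteq> 0})"

definition locally_integrable :: "(real^3 \<Rightarrow> complex^4) \<Rightarrow> bool" where
  "locally_integrable f \<longleftrightarrow> (\<forall>K. compact K \<longrightarrow> set_integrable lebesgue K f)"

definition has_weak_partial ::
    "3 \<Rightarrow> (real^3 \<Rightarrow> complex^4) \<Rightarrow> (real^3 \<Rightarrow> complex^4) \<Rightarrow> bool" where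
  "has_weak_partial k f g \<longleftrightarrow>
     locally_integrable f \<and> locally_integrable g \<and>
     (\<forall>\<phi> :: real^3 \<Rightarrow> real. test_function \<phi> \<longrightarrow>
        (LINT x|lebesgue. partial k \<phi> x *\<^sub>R f x) = - (LINT x|lebesgue. \<phi> x *\<^sub>R g x))"

definition square_integrable :: "(real^3 \<Rightarrow> complex^4) \<Rightarrow> bool" where
  "square_integrable f \<longleftrightarrow>
     f \<in> borel_measurable lebesgue \<and> integrable lebesgue (\<lambda>x. (norm (f x))\<^sup>2)"

text \<open>
  The spinor fields for which the inequality is stated: \<open>\<psi> \<in> L\<^sup>2(\<real>\<^sup>3; \<complex>\<^sup>4)\<close> whose
  first-order weak partial derivatives are the locally integrable functions \<open>D k\<close>.  This
  contains \<open>C\<^sub>c\<^sup>\<infinity>\<close> and the Sobolev space \<open>H\<^sup>1\<close>.  Some integrability at infinity is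
  indispensable, since \<open>(i \<alpha>\<cdot>\<nabla> - m\<beta> \<plusminus> \<epsilon>i) \<psi> = 0\<close> has nonzero, exponentially growing solutions.
\<close>

definition spinor_field ::
    "(real^3 \<Rightarrow> complex^4) \<Rightarrow> (3 \<Rightarrow> real^3 \<Rightarrow> complex^4) \<Rightarrow> bool" where
  "spinor_field \<psi> D \<longleftrightarrow> square_integrable \<psi> \<and> (\<forall>k. has_weak_partial k \<psi> (D k))"

section \<open>The shifted Dirac operator\<close>

text \<open>
  \<open>(i \<alpha>\<cdot>\<nabla> - m\<beta> + c) \<psi>\<close> at \<open>x\<close>, where \<open>D k\<close> stands for \<open>\<partial>\<^sub>k \<psi>\<close>; the sign choice enters
  through \<open>c = \<plusminus>\<epsilon>i\<close>.
\<close>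

definition shifted_dirac ::
    "real \<Rightarrow> complex \<Rightarrow> (real^3 \<Rightarrow> complex^4) \<Rightarrow> (3 \<Rightarrow> real^3 \<Rightarrow> complex^4) \<Rightarrow>
     real^3 \<Rightarrow> complex^4" where
  "shifted_dirac m c \<psi> D x =
     \<i> *s (\<Sum>k\<in>UNIV. dirac_alpha k *v D k x)
     - complex_of_real m *s (dirac_beta *v \<psi> x)
     + c *s \<psi> x"

end

theory Submission
  imports Defs
begin

text \<open>
  Write \<open>r\<close> for \<open>norm x\<close>, \<open>\<partial>\<^sub>r\<close> for the radial derivative, and \<open>\<mu> = sqrt (m\<^sup>2 + \<epsilon>\<^sup>2)\<close>.

  For a test function that vanishes near the origin the inequality holds pointwise up to
  divergences.  Expand \<open>r\<close> times the square of \<open>\<Sum>\<^sub>k i\<alpha>\<^sub>k \<partial>\<^sub>k\<psi> + (c - m\<beta>)\<psi>\<close>.  The real bilinear form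
  \<open>Re \<langle>i\<alpha>\<^sub>k u, (c - m\<beta>) v\<rangle>\<close> is symmetric because \<open>c\<close> is imaginary, so the mixed term is a divergence
  plus a term bounded by \<open>\<mu> |\<psi>|\<^sup>2\<close>, and the last term is \<open>\<mu>\<^sup>2 r |\<psi>|\<^sup>2\<close>.  In the first term the Clifford
  relations show that \<open>|\<alpha>\<cdot>\<nabla>\<psi>|\<^sup>2 - |\<nabla>\<psi>|\<^sup>2\<close>, and likewise its analogue for the part of the gradient
  tangential to spheres, is a combination of \<open>2\<times>2\<close> minors of \<open>\<nabla>\<psi>\<close>.  The minors occur with the
  weights \<open>x\<^sub>l x\<^sub>m / r + r \<delta>\<^sub>l\<^sub>m\<close>, which are the derivatives \<open>\<partial>\<^sub>l (r x\<^sub>m)\<close>; since the minors form curls, a gradient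
  against a curl is a divergence.  What remains besides \<open>|\<psi>|\<^sup>2 / r\<close> is \<open>r |\<partial>\<^sub>r\<psi> + \<psi>/r + \<mu>\<psi>|\<^sup>2\<close> and the
  tangential form \<open>r (2 |\<nabla>\<^sub>t\<psi>|\<^sup>2 - |\<alpha>\<cdot>\<nabla>\<^sub>t\<psi>|\<^sup>2)\<close>, and both are nonnegative.  This is \<open>pointwise_hardy\<close> together
  with \<open>divergence_integral\<close>.  The tangential term plays the part of the spectral
  bound \<open>K\<^sup>2 \<ge> 1\<close> for the spin-orbit operator.

  A field with only weak derivatives is multiplied by a cutoff \<open>\<eta>\<close> that vanishes near the origin
  and near infinity, and is then mollified (\<open>cutoff_hardy\<close>).  Mollification commutes with the operator,
  Jensen's inequality controls the right-hand side, and convergence in \<open>L\<^sup>1\<close> with Fatou's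
  lemma controls the left-hand side.

  Removing the cutoff at the origin is delicate: the commutator \<open>r |\<nabla>\<eta>|\<^sup>2 |\<psi>|\<^sup>2\<close> is of the same size as
  the left-hand side, which is not yet known to be finite.  The cutoff is therefore made to behave like
  \<open>(r / \<delta>)\<^sup>1\<^sup>/\<^sup>2\<close> for \<open>r\<close> below \<open>\<delta>\<close>.  The exponent is large enough for \<open>\<eta>\<^sup>2 / r \<le> 1 / \<delta>\<close>, so that
  square integrability of \<open>\<psi>\<close> makes all terms finite, and small enough for the commutator to be
  absorbed into the left-hand side.  This bounds the left-hand side by four times the right-hand side;
  once it is finite, letting \<open>\<delta>\<close> tend to \<open>0\<close> removes the commutator altogether and gives
  the constant one (\<open>dirac_hardy_inequality\<close>).

  For the sharpness take a constant spinor times \<open>u = b(r) (r\<^sup>2 + \<rho>\<^sup>2)\<^sup>-\<^sup>1\<^sup>/\<^sup>2\<close> with a smooth bump \<open>b\<close>.  Then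
  \<open>r |\<nabla>u| \<le> u + 4r\<close>, so the right-hand side is at most the left-hand side times a factor arbitrarily close to one, plus
  a constant independent of \<open>\<rho>\<close>, while the left-hand side diverges logarithmically as \<open>\<rho>\<close> tends to \<open>0\<close>
  (\<open>hardy_constant_sharp\<close>).
\<close>

section \<open>Partial derivatives and smooth functions\<close>

definition smooth :: "(real^3 \<Rightarrow> 'b::real_normed_vector) \<Rightarrow> bool" where
  "smooth f \<longleftrightarrow> (\<forall>n. cont_diff n f)"

lemma partial_eq:
  "(f has_derivative f') (at x) \<Longrightarrow> partial k f x = f' (axis k 1)"
  unfolding partial_def using frechet_derivative_at by metis

text \<open>
  Partial derivatives are defined through the Frechet derivative, so they determine it.
\<close>

lemma has_derivative_partial:
  assumes "f differentiable (at x)"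
  shows "(f has_derivative (\<lambda>v. \<Sum>k\<in>UNIV. v $ k *\<^sub>R partial k f x)) (at x)"
proof -
  let ?D = "frechet_derivative f (at x)"
  have D: "(f has_derivative ?D) (at x)"
    using assms frechet_derivative_works by blast
  then interpret linear ?D using has_derivative_linear by blast
  have "?D v = (\<Sum>k\<in>UNIV. v $ k *\<^sub>R partial k f x)" for v
  proof -
    have "v = (\<Sum>k\<in>UNIV. v $ k *\<^sub>R axis k 1)"
      using basis_expansion[of v] by (simp add: scalar_mult_eq_scaleR)
    then have "?D v = ?D (\<Sum>k\<in>UNIV. v $ k *\<^sub>R axis k 1)" by simp
    then show ?thesis unfolding sum scale partial_def .
  qed
  then have "?D = (\<lambda>v. \<Sum>k\<in>UNIV. v $ k *\<^sub>R partial k f x)" by (rule ext)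
  with D show ?thesis by simp
qed

lemma cont_diff_SucI:
  assumes "\<And>x. (f has_derivative f' x) (at x)" and "\<And>k. cont_diff n (\<lambda>x. f' x (axis k 1))"
  shows "cont_diff (Suc n) f"
proof -
  have "partial k f = (\<lambda>x. f' x (axis k 1))" for k
    using partial_eq[OF assms(1)] by blast
  then show ?thesis
    using assms by (auto simp: differentiable_def)
qed

lemma cont_diff_Suc_D: "cont_diff (Suc n) f \<Longrightarrow> cont_diff n f"
proof (induction n arbitrary: f)
  case 0
  then show ?case
    by (simp add: continuous_at_imp_continuous_on differentiable_imp_continuous_within)
next
  case (Suc n)
  from Suc.prems show ?case
    unfolding cont_diff.simps(2)[of "Suc n" f] cont_diff.simps(2)[of n f] using Suc.IH by blast
qed

lemma cont_diff_Suc_derivative: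
  assumes "cont_diff (Suc n) f"
  shows "(f has_derivative (\<lambda>v. \<Sum>k\<in>UNIV. v $ k *\<^sub>R partial k f x)) (at x)"
  using assms by (intro has_derivative_partial) simp

lemma cont_diff_const: "cont_diff n (\<lambda>x. c)"
proof (induction n arbitrary: c)
  case (Suc n)
  show ?case by (rule cont_diff_SucI[where f' = "\<lambda>x v. 0"]) (auto simp: Suc)
qed simp

lemma cont_diff_bounded_linear:
  assumes "bounded_linear f"
  shows "cont_diff n f"
proof (cases n)
  case 0
  then show ?thesis using assms by (simp add: linear_continuous_on)
next
  case (Suc m)
  show ?thesis unfolding Suc
    by (rule cont_diff_SucI[where f' = "\<lambda>x. f"])
       (auto simp: cont_diff_const assms bounded_linear_imp_has_derivative)
qed

lemma axis_sum [simp]: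
  fixes f :: "3 \<Rightarrow> 'b::real_vector"
  shows "(\<Sum>k\<in>UNIV. axis j (1::real) $ k *\<^sub>R f k) = f j"
proof -
  have "(\<Sum>k\<in>UNIV. axis j (1::real) $ k *\<^sub>R f k) = (\<Sum>k\<in>UNIV. if k = j then f k else 0)"
    by (intro sum.cong) (auto simp: axis_def)
  then show ?thesis by simp
qed

lemma axis_sum_mult [simp]: "(\<Sum>k\<in>UNIV. axis j (1::real) $ k * f k) = f (j::3)"
  using axis_sum[of j f] by (simp del: axis_sum)

lemma cont_diff_add: "cont_diff n f \<Longrightarrow> cont_diff n g \<Longrightarrow> cont_diff n (\<lambda>x. f x + g x)"
proof (induction n arbitrary: f g)
  case (Suc n)
  show ?case
    by (rule cont_diff_SucI[OF has_derivative_add[OF cont_diff_Suc_derivative[OF Suc.prems(1)]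
          cont_diff_Suc_derivative[OF Suc.prems(2)]]])
       (use Suc in simp)
qed (simp add: continuous_on_add)

text \<open>
  All the products needed later (scalar, inner, scalar times spinor) are bounded bilinear, and one
  Leibniz rule serves them all.
\<close>

lemma (in bounded_bilinear) cont_diff_prod:
  fixes f :: "real^3 \<Rightarrow> 'a" and g :: "real^3 \<Rightarrow> 'b"
  shows "cont_diff n f \<Longrightarrow> cont_diff n g \<Longrightarrow> cont_diff n (\<lambda>x. prod (f x) (g x))"
proof (induction n arbitrary: f g)
  case 0
  then show ?case by (simp add: continuous_on)
next
  case (Suc n)
  have "cont_diff n f" "cont_diff n g" using Suc.prems cont_diff_Suc_D by blast+
  then show ?case
    by (intro cont_diff_SucI[OF FDERIV[OF cont_diff_Suc_derivative[OF Suc.prems(1)]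
          cont_diff_Suc_derivative[OF Suc.prems(2)]]])
       (use Suc in \<open>simp add: cont_diff_add\<close>)
qed

lemma (in bounded_bilinear) smooth_prod:
  "smooth f \<Longrightarrow> smooth g \<Longrightarrow> smooth (\<lambda>x. prod (f x) (g x))"
  by (simp add: smooth_def cont_diff_prod)

lemmas smooth_mult = bounded_bilinear.smooth_prod[OF bounded_bilinear_mult]
  and smooth_scaleR = bounded_bilinear.smooth_prod[OF bounded_bilinear_scaleR]
  and smooth_inner = bounded_bilinear.smooth_prod[OF bounded_bilinear_inner]

lemma smooth_const [simp]: "smooth (\<lambda>x. c)"
  by (simp add: smooth_def cont_diff_const)

lemma smooth_add: "smooth f \<Longrightarrow> smooth g \<Longrightarrow> smooth (\<lambda>x. f x + g x)"
  by (simp add: smooth_def cont_diff_add)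

lemma smooth_bounded_linear: "bounded_linear f \<Longrightarrow> smooth f"
  by (simp add: smooth_def cont_diff_bounded_linear)

lemma smooth_partial: "smooth f \<Longrightarrow> smooth (partial k f)"
  unfolding smooth_def using cont_diff.simps(2) by blast

lemma smooth_differentiable: "smooth f \<Longrightarrow> f differentiable (at x)"
  unfolding smooth_def using cont_diff.simps(2) by blast

lemma smooth_continuous: "smooth f \<Longrightarrow> continuous_on S f"
  unfolding smooth_def using cont_diff.simps(1) continuous_on_subset by blast

lemma smooth_derivative:
  "smooth f \<Longrightarrow> (f has_derivative (\<lambda>v. \<Sum>k\<in>UNIV. v $ k *\<^sub>R partial k f x)) (at x)"
  by (simp add: has_derivative_partial smooth_differentiable)

lemma smooth_dist_square: "smooth (\<lambda>x. (norm (x - a))\<^sup>2)"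
proof -
  have "smooth (\<lambda>x. x + (- a))"
    by (intro smooth_add smooth_const smooth_bounded_linear bounded_linear_ident)
  then show ?thesis
    unfolding power2_norm_eq_inner using smooth_inner by fastforce
qed

lemma smooth_affine_norm_square: "smooth (\<lambda>x. p + s * (norm (x - 0))\<^sup>2)"
  by (rule smooth_add[OF smooth_const smooth_mult[OF smooth_const smooth_dist_square]])

text \<open>
  A function of one real variable is smooth on a set if it heads a sequence in which each member is the
  derivative of the one before; naming the whole sequence makes the induction in the chain rule
  immediate.
\<close>

definition smooth_real_on :: "real set \<Rightarrow> (real \<Rightarrow> real) \<Rightarrow> bool" where
  "smooth_real_on T h \<longleftrightarrow>
     (\<exists>d. d 0 = h \<and> (\<forall>n. \<forall>t\<in>T. (d n has_real_derivative d (Suc n) t) (at t)))"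

lemma smooth_compose:
  assumes h: "smooth_real_on T h" and q: "smooth q" and T: "\<And>x. q x \<in> T"
  shows "smooth (\<lambda>x. h (q x))"
proof -
  obtain d where d0: "d 0 = h" and d: "\<And>n t. t \<in> T \<Longrightarrow> (d n has_real_derivative d (Suc n) t) (at t)"
    using h unfolding smooth_real_on_def by blast
  have der: "((\<lambda>x. d m (q x)) has_derivative
      (\<lambda>v. (\<Sum>k\<in>UNIV. v $ k *\<^sub>R partial k q x) * d (Suc m) (q x))) (at x)" for m x
    using has_derivative_compose[OF smooth_derivative[OF q] d[OF T, unfolded has_field_derivative_def]]
    by (simp add: mult.commute)
  have "cont_diff n (\<lambda>x. d m (q x))" for n m
  proof (induction n arbitrary: m)
    case 0
    show ?case by (auto intro!: continuous_at_imp_continuous_on has_derivative_continuous[OF der])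
  next
    case (Suc n)
    have "cont_diff n (\<lambda>x. partial k q x * d (Suc m) (q x))" for k
      using smooth_partial[OF q] Suc by (intro bounded_bilinear.cont_diff_prod[OF bounded_bilinear_mult]) (auto simp: smooth_def)
    then show ?case by (intro cont_diff_SucI[OF der]) simp
  qed
  then show ?thesis unfolding smooth_def d0[symmetric] by blast
qed

lemma smooth_real_on_powr: "smooth_real_on {0<..} (\<lambda>t. t powr a)"
  unfolding smooth_real_on_def
proof (intro exI conjI allI ballI)
  define d where "d = (\<lambda>n t. (\<Prod>i<n. a - real i) * t powr (a - real n))"
  show "d 0 = (\<lambda>t. t powr a)" by (simp add: d_def fun_eq_iff)
  show "(d n has_real_derivative d (Suc n) t) (at t)" if "t \<in> {0<..}" for n t
  proof -
    have "((\<lambda>t. t powr (a - real n)) has_real_derivative (a - real n) * t powr (a - real n - 1)) (at t)"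
      using that by (intro has_real_derivative_powr) simp
    from DERIV_cmult[OF this, of "\<Prod>i<n. a - real i"] show ?thesis
      by (simp add: d_def[abs_def] mult.assoc diff_diff_eq add.commute)
  qed
qed

text \<open>
  The standard smooth function that vanishes to infinite order at the origin.
\<close>

definition flat_exp :: "real \<Rightarrow> real" where
  "flat_exp t = (if t \<le> 0 then 0 else exp (- (1 / t)))"

lemma poly_times_exp_neg_tendsto_0: "((\<lambda>s. poly p s * exp (- s)) \<longlongrightarrow> (0::real)) at_top"
proof -
  have "((\<lambda>s. \<Sum>i\<le>degree p. coeff p i * (s ^ i / exp s)) \<longlongrightarrow> (\<Sum>i\<le>degree p. coeff p i * 0)) at_top"
    by (intro tendsto_sum tendsto_mult tendsto_const tendsto_power_div_exp_0)
  then show ?thesis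
    by (simp add: poly_altdef sum_distrib_right exp_minus divide_inverse mult.assoc)
qed

text \<open>
  Away from the origin the \<open>n\<close>-th derivative is \<open>p\<^sub>n (1 / t) exp (- 1 / t)\<close> for a polynomial \<open>p\<^sub>n\<close>, with
  \<open>p\<^sub>n\<^sub>+\<^sub>1 (s) = s\<^sup>2 (p\<^sub>n (s) - p\<^sub>n' (s))\<close>.  At the origin every difference quotient tends to \<open>0\<close> because the exponential beats
  every polynomial.
\<close>

lemma smooth_real_on_flat_exp: "smooth_real_on UNIV flat_exp"
proof -
  define p where "p = rec_nat [:1:] (\<lambda>n q. [:0, 0, 1:] * (q - pderiv q) :: real poly)"
  have p: "p 0 = 1" "p (Suc n) = [:0, 0, 1:] * (p n - pderiv (p n))" for n
    by (simp_all add: p_def)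
  define d where "d n t = (if t \<le> 0 then 0 else poly (p n) (1 / t) * exp (- (1 / t)))" for n and t :: real
  have d0: "d 0 = flat_exp" by (simp add: d_def flat_exp_def p fun_eq_iff)
  have der: "(d n has_real_derivative d (Suc n) t) (at t)" for n t
  proof (cases t "0::real" rule: linorder_cases)
    case less
    have "((\<lambda>_. 0) has_real_derivative 0) (at t)" by simp
    then have "(d n has_real_derivative 0) (at t)"
      by (rule has_field_derivative_transform_within_open[where S = "{..<0}"]) (use less in \<open>auto simp: d_def\<close>)
    then show ?thesis using less by (simp add: d_def)
  next
    case greater
    have inv: "((\<lambda>t. 1 / t) has_real_derivative - (1 / t\<^sup>2)) (at t)"
      using greater by (auto intro!: derivative_eq_intros simp: power2_eq_square)
    have "((\<lambda>t. poly (p n) (1 / t) * exp (- (1 / t))) has_real_derivative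
        poly (p n) (1 / t) * (exp (- (1 / t)) * - (- (1 / t\<^sup>2)))
        + poly (pderiv (p n)) (1 / t) * - (1 / t\<^sup>2) * exp (- (1 / t))) (at t)"
      by (rule DERIV_mult'[OF DERIV_chain2[OF poly_DERIV inv] DERIV_chain2[OF DERIV_exp DERIV_minus[OF inv]]])
    moreover have "poly (p n) (1 / t) * (exp (- (1 / t)) * - (- (1 / t\<^sup>2)))
        + poly (pderiv (p n)) (1 / t) * - (1 / t\<^sup>2) * exp (- (1 / t)) = d (Suc n) t"
    proof -
      have "a * (e * - (- q)) + b * - q * e = q * (a - b) * e" for a b e q :: real
        by (simp add: algebra_simps)
      then show ?thesis
        using greater by (simp add: d_def p power2_eq_square left_diff_distrib diff_divide_distrib)
    qed
    ultimately have "((\<lambda>t. poly (p n) (1 / t) * exp (- (1 / t))) has_real_derivative d (Suc n) t) (at t)"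
      by simp
    then show ?thesis
      by (rule has_field_derivative_transform_within_open[where S = "{0<..}"]) (use greater in \<open>auto simp: d_def\<close>)
  next
    case equal
    have "((\<lambda>h. d n h / h) \<longlongrightarrow> 0) (at 0)"
    proof (rule filterlim_split_at)
      show "((\<lambda>h. d n h / h) \<longlongrightarrow> 0) (at_left 0)"
        by (rule Lim_transform_eventually[OF tendsto_const]) (simp add: eventually_at_filter d_def)
      have "((\<lambda>h. poly ([:0, 1:] * p n) (inverse h) * exp (- inverse h)) \<longlongrightarrow> 0) (at_right 0)"
        by (rule filterlim_compose[OF poly_times_exp_neg_tendsto_0 filterlim_inverse_at_top_right])
      then show "((\<lambda>h. d n h / h) \<longlongrightarrow> 0) (at_right 0)"
        by (rule Lim_transform_eventually) (simp add: eventually_at_filter d_def inverse_eq_divide)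
    qed
    moreover have "d m 0 = 0" for m by (simp add: d_def)
    ultimately show ?thesis
      unfolding equal DERIV_def by simp
  qed
  show ?thesis unfolding smooth_real_on_def using d0 der by blast
qed

text \<open>
  Two applications of the mean value theorem to the second difference, which is symmetric in the two
  directions; hence the order of the derivatives cannot matter in the limit.
\<close>

lemma mixed_difference_quotient:
  fixes f :: "real^3 \<Rightarrow> real"
  assumes f: "smooth f" and s: "s > 0"
  shows "\<exists>p. norm (p - x) \<le> 2 * s \<and>
    f (x + s *\<^sub>R axis j 1 + s *\<^sub>R axis k 1) - f (x + s *\<^sub>R axis j 1) - f (x + s *\<^sub>R axis k 1) + f x
      = s\<^sup>2 * partial k (partial j f) p"
proof -
  let ?e = "axis j 1 :: real^3" and ?g = "axis k 1 :: real^3"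
  have line: "((\<lambda>t. F (y + t *\<^sub>R axis i 1)) has_real_derivative partial i F (y + t *\<^sub>R axis i 1)) (at t)"
    if "smooth F" for F :: "real^3 \<Rightarrow> real" and y i t
  proof -
    have "((\<lambda>t. y + t *\<^sub>R axis i 1) has_derivative (\<lambda>t. t *\<^sub>R axis i 1)) (at t)"
      by (auto intro!: derivative_eq_intros)
    from has_derivative_compose[OF this smooth_derivative[OF that]]
    have "((\<lambda>t. F (y + t *\<^sub>R axis i 1)) has_derivative
        (\<lambda>h. \<Sum>k\<in>UNIV. (h *\<^sub>R axis i 1) $ k *\<^sub>R partial k F (y + t *\<^sub>R axis i 1))) (at t)" .
    moreover have "(\<Sum>k\<in>UNIV. (h *\<^sub>R axis i 1) $ k *\<^sub>R partial k F z) = partial i F z * h" for h z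
      by (simp add: mult.assoc flip: sum_distrib_left)
    ultimately show ?thesis by (simp add: has_field_derivative_def)
  qed
  define \<phi> where "\<phi> t = f (x + s *\<^sub>R ?g + t *\<^sub>R ?e) - f (x + t *\<^sub>R ?e)" for t
  have "(\<phi> has_real_derivative (partial j f (x + s *\<^sub>R ?g + t *\<^sub>R ?e) - partial j f (x + t *\<^sub>R ?e))) (at t)" for t
    unfolding \<phi>_def by (intro DERIV_diff line f)
  from MVT2[OF s this] obtain \<xi> where xi: "0 < \<xi>" "\<xi> < s"
    and 1: "\<phi> s - \<phi> 0 = s * (partial j f (x + s *\<^sub>R ?g + \<xi> *\<^sub>R ?e) - partial j f (x + \<xi> *\<^sub>R ?e))" by auto
  from MVT2[OF s line[OF smooth_partial[OF f, of j], of "x + \<xi> *\<^sub>R ?e" k]]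
  obtain \<eta> where eta: "0 < \<eta>" "\<eta> < s"
    and 2: "partial j f (x + \<xi> *\<^sub>R ?e + s *\<^sub>R ?g) - partial j f (x + \<xi> *\<^sub>R ?e + 0 *\<^sub>R ?g)
      = s * partial k (partial j f) (x + \<xi> *\<^sub>R ?e + \<eta> *\<^sub>R ?g)" by auto
  let ?p = "x + \<xi> *\<^sub>R ?e + \<eta> *\<^sub>R ?g"
  have "norm (?p - x) \<le> norm (\<xi> *\<^sub>R ?e) + norm (\<eta> *\<^sub>R ?g)"
    by (metis add.assoc add_diff_cancel_left' norm_triangle_ineq)
  also have "\<dots> \<le> 2 * s" using xi eta by (simp add: norm_axis_1)
  finally have "norm (?p - x) \<le> 2 * s" .
  moreover have "\<phi> s - \<phi> 0 = s\<^sup>2 * partial k (partial j f) ?p"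
    using 1 2 by (simp add: algebra_simps power2_eq_square)
  ultimately show ?thesis
    by (intro exI[of _ ?p]) (simp add: \<phi>_def algebra_simps)
qed

lemma partial_commute_real:
  fixes f :: "real^3 \<Rightarrow> real"
  assumes f: "smooth f"
  shows "partial j (partial k f) x = partial k (partial j f) x"
proof (rule ccontr)
  define u v where "u = partial j (partial k f)" and "v = partial k (partial j f)"
  assume "\<not> ?thesis"
  then have e: "\<bar>u x - v x\<bar> / 2 > 0" (is "?e > 0") by (simp add: u_def v_def)
  have "continuous_on UNIV u" "continuous_on UNIV v"
    unfolding u_def v_def by (intro smooth_continuous smooth_partial f)+
  note cont = this[unfolded continuous_on_iff, rule_format, OF UNIV_I e]
  from cont(1)[of x] obtain a where a: "a > 0" "\<And>y. dist y x < a \<Longrightarrow> dist (u y) (u x) < ?e"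
    by auto
  from cont(2)[of x] obtain b where b: "b > 0" "\<And>y. dist y x < b \<Longrightarrow> dist (v y) (v x) < ?e"
    by auto
  define s where "s = min a b / 4"
  have s: "s > 0" "2 * s < a" "2 * s < b" using a b by (auto simp: s_def)
  obtain p where p: "norm (p - x) \<le> 2 * s" and
    1: "f (x + s *\<^sub>R axis j 1 + s *\<^sub>R axis k 1) - f (x + s *\<^sub>R axis j 1) - f (x + s *\<^sub>R axis k 1) + f x
      = s\<^sup>2 * v p" unfolding v_def using mixed_difference_quotient[OF f s(1)] by blast
  obtain q where q: "norm (q - x) \<le> 2 * s" and
    2: "f (x + s *\<^sub>R axis k 1 + s *\<^sub>R axis j 1) - f (x + s *\<^sub>R axis k 1) - f (x + s *\<^sub>R axis j 1) + f x
      = s\<^sup>2 * u q" unfolding u_def using mixed_difference_quotient[OF f s(1)] by blast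
  have swap: "x + s *\<^sub>R axis j 1 + s *\<^sub>R axis k 1 = x + s *\<^sub>R axis k 1 + s *\<^sub>R axis j 1"
    by (simp add: add_ac)
  from 1[unfolded swap] 2 have "s\<^sup>2 * v p = s\<^sup>2 * u q" by linarith
  then have "v p = u q" using s(1) by simp
  moreover have "dist (u q) (u x) < ?e"
    using a(2)[of q] q s(2) by (simp add: dist_norm)
  moreover have "dist (v p) (v x) < ?e"
    using b(2)[of p] p s(3) by (simp add: dist_norm)
  ultimately have "dist (u x) (v x) < \<bar>u x - v x\<bar>"
    using dist_triangle_half_r[of "u q" "u x" "\<bar>u x - v x\<bar>" "v x"] by simp
  then show False by (simp add: dist_real_def)
qed

lemma partial_bounded_linear:
  assumes "bounded_linear L" "f differentiable (at x)"
  shows "partial k (\<lambda>x. L (f x)) x = L (partial k f x)"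
  using partial_eq[OF bounded_linear.has_derivative[OF assms(1) has_derivative_partial[OF assms(2)]], of k]
  by simp

lemma smooth_linear_compose:
  assumes L: "bounded_linear L" and f: "smooth f"
  shows "smooth (\<lambda>x. L (f x))"
proof -
  have "cont_diff n f \<Longrightarrow> cont_diff n (\<lambda>x. L (f x))" for n f
  proof (induction n arbitrary: f)
    case 0
    then show ?case by (auto intro: bounded_linear.continuous_on[OF L])
  next
    case (Suc n)
    show ?case
      by (rule cont_diff_SucI[OF bounded_linear.has_derivative[OF L cont_diff_Suc_derivative[OF Suc.prems]]])
         (use Suc in simp)
  qed
  with f show ?thesis unfolding smooth_def by blast
qed

lemma partial_commute:
  fixes f :: "real^3 \<Rightarrow> 'b::euclidean_space"
  assumes f: "smooth f"
  shows "partial j (partial k f) x = partial k (partial j f) x"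
proof (rule euclidean_eqI)
  fix b :: 'b assume "b \<in> Basis"
  have 1: "partial k (\<lambda>x. g x \<bullet> b) = (\<lambda>x. partial k g x \<bullet> b)" if g: "smooth g" for k and g :: "real^3 \<Rightarrow> 'b"
    by (rule ext, rule partial_bounded_linear[OF bounded_linear_inner_left smooth_differentiable[OF g]])
  have "smooth (\<lambda>x. f x \<bullet> b)"
    by (rule smooth_linear_compose[OF bounded_linear_inner_left f])
  from partial_commute_real[OF this, of j k x]
  show "partial j (partial k f) x \<bullet> b = partial k (partial j f) x \<bullet> b"
    by (simp only: 1[OF f] 1[OF smooth_partial[OF f]])
qed

section \<open>Integration by parts\<close>

lemma test_function_iff: "test_function f \<longleftrightarrow> smooth f \<and> bounded {x. f x \<noteq> 0}"
  by (simp add: test_function_def smooth_def compact_closure)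

text \<open>
  Partial derivatives are local.
\<close>

lemma partial_cong_open:
  assumes "open S" "x \<in> S" "\<And>y. y \<in> S \<Longrightarrow> f y = g y"
  shows "partial k f x = partial k g x"
proof -
  have "(f has_derivative D) (at x) \<longleftrightarrow> (g has_derivative D) (at x)" for D
    using has_derivative_transform_within_open[OF _ assms(1,2), of f D UNIV g]
      has_derivative_transform_within_open[OF _ assms(1,2), of g D UNIV f] assms(3) by auto
  then show ?thesis by (simp add: partial_def frechet_derivative_def)
qed

lemma partial_const [simp]: "partial k (\<lambda>x. c) x = 0"
  using partial_eq[of "\<lambda>x. c" "\<lambda>_. 0"] by simp

lemma partial_outside_support:
  assumes "x \<notin> closure {x. f x \<noteq> 0}"
  shows "partial k f x = 0"
proof -
  define S where "S = - closure {x. f x \<noteq> 0}"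
  have "open S" "x \<in> S" using assms by (auto simp: S_def open_Compl)
  moreover have "f y = 0" if "y \<in> S" for y
    using that closure_subset[of "{x. f x \<noteq> 0}"] unfolding S_def by blast
  ultimately have "partial k f x = partial k (\<lambda>x. 0) x"
    by (rule partial_cong_open)
  then show ?thesis by simp
qed

lemma bounded_support_partial:
  assumes "bounded {x. f x \<noteq> 0}"
  shows "bounded {x. partial k f x \<noteq> 0}"
proof (rule bounded_subset)
  show "bounded (closure {x. f x \<noteq> 0})" using assms by (rule bounded_closure)
  show "{x. partial k f x \<noteq> 0} \<subseteq> closure {x. f x \<noteq> 0}" using partial_outside_support by blast
qed

lemma test_function_partial: "test_function f \<Longrightarrow> test_function (partial k f)"
  by (simp add: test_function_iff smooth_partial bounded_support_partial)

lemma integrable_bounded_support: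
  fixes f :: "real^3 \<Rightarrow> 'b::euclidean_space"
  assumes "continuous_on UNIV f" "bounded {x. f x \<noteq> 0}"
  shows "integrable lebesgue f"
proof -
  obtain R where R: "\<And>x. f x \<noteq> 0 \<Longrightarrow> norm x \<le> R"
    using assms(2) unfolding bounded_iff by blast
  have "integrable lborel (\<lambda>x. indicator (cball 0 R) x *\<^sub>R f x)"
    by (intro borel_integrable_compact continuous_on_subset[OF assms(1)]) auto
  moreover have "(\<lambda>x. indicator (cball 0 R) x *\<^sub>R f x) = f"
    using R by (auto simp: fun_eq_iff indicator_def)
  ultimately have "integrable lborel f" by simp
  then show ?thesis
    by (simp add: integrable_completion borel_measurable_integrable)
qed

lemma bounded_continuous_support:
  fixes f :: "real^3 \<Rightarrow> 'b::euclidean_space"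
  assumes "continuous_on UNIV f" "bounded {x. f x \<noteq> 0}"
  shows "\<exists>M>0. \<forall>x. norm (f x) \<le> M"
proof -
  have "compact (f ` closure {x. f x \<noteq> 0})"
    using assms(2) by (intro compact_continuous_image continuous_on_subset[OF assms(1)]) (simp_all add: compact_closure)
  then have "bounded (f ` closure {x. f x \<noteq> 0})" by (rule compact_imp_bounded)
  then obtain M where "\<forall>y\<in>f ` closure {x. f x \<noteq> 0}. norm y \<le> M"
    unfolding bounded_iff by blast
  then have M: "norm (f x) \<le> M" if "x \<in> closure {x. f x \<noteq> 0}" for x
    using that by blast
  have "norm (f x) \<le> max M 1" for x
    using M[of x] closure_subset[of "{x. f x \<noteq> 0}"] by (cases "f x = 0") auto
  then show ?thesis by (intro exI[of _ "max M 1"]) simp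
qed

lemma lebesgue_integral_translate:
  fixes f :: "real^3 \<Rightarrow> 'b::euclidean_space"
  assumes "f \<in> borel_measurable borel"
  shows "(LINT x|lebesgue. f (x + a)) = (LINT x|lebesgue. f x)"
proof -
  have "(LINT x|lebesgue. f x) = (LINT x|distr lborel borel ((+) a). f x)"
    using assms by (simp add: integral_completion lborel_distr_plus)
  also have "\<dots> = (LINT x|lborel. f (a + x))"
    using assms by (subst integral_distr) auto
  also have "\<dots> = (LINT x|lebesgue. f (x + a))"
    using assms by (subst integral_completion) (auto simp: add.commute)
  finally show ?thesis by simp
qed

lemma nn_integral_translate:
  assumes "f \<in> borel_measurable borel"
  shows "(\<integral>\<^sup>+x. f (x + a) \<partial>lebesgue) = (\<integral>\<^sup>+x. f x \<partial>(lebesgue :: (real^3) measure))"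
proof -
  have "(\<integral>\<^sup>+x. f x \<partial>lebesgue) = (\<integral>\<^sup>+x. f x \<partial>distr lborel borel ((+) a))"
    using assms by (simp add: nn_integral_completion lborel_distr_plus)
  also have "\<dots> = (\<integral>\<^sup>+x. f (a + x) \<partial>lborel)"
    using assms by (subst nn_integral_distr) auto
  also have "\<dots> = (\<integral>\<^sup>+x. f (x + a) \<partial>lebesgue)"
    using assms by (subst nn_integral_completion) (auto simp: add.commute)
  finally show ?thesis by simp
qed

text \<open>
  The bound that dominates the difference quotients below.
\<close>

lemma norm_difference_le_partial:
  fixes f :: "real^3 \<Rightarrow> 'b::euclidean_space"
  assumes f: "\<And>x. f differentiable (at x)" and M: "\<And>x. norm (partial k f x) \<le> M" and h: "h > 0"
  shows "norm (f (x + h *\<^sub>R axis k 1) - f x) \<le> M * h"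
proof -
  have d: "((\<lambda>t. f (x + t *\<^sub>R axis k 1)) has_derivative (\<lambda>s. s *\<^sub>R partial k f (x + t *\<^sub>R axis k 1))) (at t)" for t
  proof -
    have "((\<lambda>t. x + t *\<^sub>R axis k 1) has_derivative (\<lambda>t. t *\<^sub>R axis k 1)) (at t)"
      by (auto intro!: derivative_eq_intros)
    from has_derivative_compose[OF this has_derivative_partial[OF f]]
    have "((\<lambda>t. f (x + t *\<^sub>R axis k 1)) has_derivative
        (\<lambda>h. \<Sum>j\<in>UNIV. (h *\<^sub>R axis k 1) $ j *\<^sub>R partial j f (x + t *\<^sub>R axis k 1))) (at t)" .
    moreover have "(\<Sum>j\<in>UNIV. (s *\<^sub>R axis k 1) $ j *\<^sub>R partial j f z) = s *\<^sub>R partial k f z" for s z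
      by (simp flip: scaleR_scaleR scaleR_sum_right)
    ultimately show ?thesis by simp
  qed
  have "continuous_on {0..h} (\<lambda>t. f (x + t *\<^sub>R axis k 1))"
    by (intro continuous_at_imp_continuous_on ballI has_derivative_continuous[OF d])
  from mvt_general[OF h this d] obtain t
    where "norm (f (x + h *\<^sub>R axis k 1) - f (x + 0 *\<^sub>R axis k 1)) \<le> norm ((h - 0) *\<^sub>R partial k f (x + t *\<^sub>R axis k 1))"
    by auto
  also have "\<dots> \<le> M * h" using h M[of "x + t *\<^sub>R axis k 1"] by (simp add: mult.commute)
  finally show ?thesis by simp
qed

text \<open>
  By translation invariance the difference quotients of \<open>f\<close> integrate to zero; they converge to the
  partial derivative, dominated by its maximum on a ball.
\<close>

lemma integral_partial_eq_0:
  fixes f :: "real^3 \<Rightarrow> 'b::euclidean_space"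
  assumes f: "\<And>x. f differentiable (at x)" and c: "continuous_on UNIV (partial k f)"
    and b: "bounded {x. f x \<noteq> 0}"
  shows "(LINT x|lebesgue. partial k f x) = 0"
proof -
  let ?e = "axis k 1 :: real^3"
  define h where "h n = inverse (real (Suc n))" for n
  define q where "q n x = inverse (h n) *\<^sub>R (f (x + h n *\<^sub>R ?e) - f x)" for n x
  have h0: "h n > 0" "h n \<le> 1" for n by (simp_all add: h_def inverse_le_1_iff)
  have hlim: "h \<longlonglongrightarrow> 0" unfolding h_def by (rule LIMSEQ_inverse_real_of_nat)
  have cf: "continuous_on UNIV f"
    using f by (simp add: continuous_at_imp_continuous_on differentiable_imp_continuous_within)
  then have mf: "f \<in> borel_measurable borel" by (rule borel_measurable_continuous_onI)
  have intf: "integrable lebesgue f" by (rule integrable_bounded_support[OF cf b])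
  obtain R where R: "\<And>x. f x \<noteq> 0 \<Longrightarrow> norm x \<le> R" using b unfolding bounded_iff by blast
  obtain M where M: "M > 0" "\<And>x. norm (partial k f x) \<le> M"
    using bounded_continuous_support[OF c bounded_support_partial[OF b]] by blast
  have cfa: "continuous_on UNIV (\<lambda>x. f (x + a))" for a
    by (rule continuous_on_compose2[OF cf]) (auto intro!: continuous_intros)
  have cq: "continuous_on UNIV (q n)" for n
    unfolding q_def by (intro continuous_on_scaleR continuous_on_const continuous_on_diff cfa cf)
  have iq: "(LINT x|lebesgue. q n x) = 0" for n
  proof -
    have "integrable lebesgue (\<lambda>x. f (x + h n *\<^sub>R ?e))"
    proof (rule integrable_bounded_support)
      show "continuous_on UNIV (\<lambda>x. f (x + h n *\<^sub>R ?e))"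
        by (rule cfa)
      have "norm x \<le> R + 1" if "f (x + h n *\<^sub>R ?e) \<noteq> 0" for x
      proof -
        have "norm x \<le> norm (x + h n *\<^sub>R ?e) + norm (h n *\<^sub>R ?e)"
          using norm_triangle_ineq4[of "x + h n *\<^sub>R ?e" "h n *\<^sub>R ?e"] by simp
        also have "norm (h n *\<^sub>R ?e) \<le> 1" using h0[of n] by simp
        finally show ?thesis using R[OF that] by simp
      qed
      then show "bounded {x. f (x + h n *\<^sub>R ?e) \<noteq> 0}" unfolding bounded_iff by blast
    qed
    then show ?thesis
      by (simp add: q_def Bochner_Integration.integral_diff intf lebesgue_integral_translate[OF mf])
  qed
  have qb: "norm (q n x) \<le> M * indicator (cball 0 (R + 1)) x" for n x
  proof (cases "norm x \<le> R + 1")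
    case True
    have "norm (q n x) = norm (f (x + h n *\<^sub>R ?e) - f x) / h n"
      using h0[of n] by (simp add: q_def divide_inverse mult.commute)
    also have "\<dots> \<le> M"
      using norm_difference_le_partial[OF f M(2) h0(1)[of n]] h0(1)[of n] by (simp add: pos_divide_le_eq)
    finally show ?thesis using True by simp
  next
    case False
    have "norm x \<le> norm (x + h n *\<^sub>R ?e) + norm (h n *\<^sub>R ?e)"
      using norm_triangle_ineq4[of "x + h n *\<^sub>R ?e" "h n *\<^sub>R ?e"] by simp
    also have "norm (h n *\<^sub>R ?e) \<le> 1" using h0[of n] by simp
    finally have "norm (x + h n *\<^sub>R ?e) > R" using False by linarith
    then have "f (x + h n *\<^sub>R ?e) = 0" "f x = 0" using R[of x] R[of "x + h n *\<^sub>R ?e"] False by (force)+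
    then show ?thesis using M(1) by (simp add: q_def indicator_def)
  qed
  have ql: "(\<lambda>n. q n x) \<longlonglongrightarrow> partial k f x" for x
  proof -
    let ?D = "\<lambda>v. \<Sum>k\<in>UNIV. v $ k *\<^sub>R partial k f x"
    have "((\<lambda>v. norm (f (x + v) - f x - ?D v) / norm v) \<longlongrightarrow> 0) (at 0)"
      using has_derivative_partial[OF f] unfolding has_derivative_at by blast
    moreover have "filterlim (\<lambda>n. h n *\<^sub>R ?e) (at 0) sequentially"
    proof (rule filterlim_atI)
      show "(\<lambda>n. h n *\<^sub>R ?e) \<longlonglongrightarrow> 0" using tendsto_scaleR[OF hlim tendsto_const] by simp
      have "h n \<noteq> 0" for n by (simp add: h_def)
      then show "\<forall>\<^sub>F n in sequentially. h n *\<^sub>R ?e \<noteq> 0" by simp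
    qed
    ultimately have "(\<lambda>n. norm (f (x + h n *\<^sub>R ?e) - f x - ?D (h n *\<^sub>R ?e)) / norm (h n *\<^sub>R ?e)) \<longlonglongrightarrow> 0"
      by (rule filterlim_compose)
    moreover have "norm (f (x + h n *\<^sub>R ?e) - f x - ?D (h n *\<^sub>R ?e)) / norm (h n *\<^sub>R ?e) = norm (q n x - partial k f x)" for n
    proof -
      have "?D (h n *\<^sub>R ?e) = h n *\<^sub>R partial k f x"
        by (simp flip: scaleR_scaleR scaleR_sum_right)
      moreover have "q n x - partial k f x = inverse (h n) *\<^sub>R (f (x + h n *\<^sub>R ?e) - f x - h n *\<^sub>R partial k f x)"
        using h0(1)[of n] by (simp add: q_def scaleR_diff_right)
      ultimately show ?thesis using h0(1)[of n] by (simp add: divide_inverse mult.commute)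
    qed
    ultimately have "(\<lambda>n. norm (q n x - partial k f x)) \<longlonglongrightarrow> 0" by simp
    then show ?thesis by (rule tendsto_norm_zero_cancel[THEN LIM_zero_cancel])
  qed
  have "(\<lambda>n. LINT x|lebesgue. q n x) \<longlonglongrightarrow> (LINT x|lebesgue. partial k f x)"
  proof (rule integral_dominated_convergence)
    show "partial k f \<in> borel_measurable lebesgue"
      using c by (simp add: borel_measurable_continuous_onI measurable_completion)
    show "q n \<in> borel_measurable lebesgue" for n
      using cq by (simp add: borel_measurable_continuous_onI measurable_completion)
    show "integrable lebesgue (\<lambda>x :: real^3. M * indicator (cball 0 (R + 1)) x :: real)"
      using emeasure_bounded_finite[OF bounded_cball, of "0 :: real^3" "R + 1"]
      by (intro integrable_mult_right integrable_real_indicator) (simp_all add: infinity_ennreal_def)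
  qed (use ql qb in auto)
  then show ?thesis by (simp add: iq LIMSEQ_const_iff)
qed

lemma integral_by_parts_scaleR:
  fixes f :: "real^3 \<Rightarrow> 'b::euclidean_space" and \<phi> :: "real^3 \<Rightarrow> real"
  assumes \<phi>: "test_function \<phi>" and f: "smooth f"
  shows "(LINT x|lebesgue. partial k \<phi> x *\<^sub>R f x) = - (LINT x|lebesgue. \<phi> x *\<^sub>R partial k f x)"
proof -
  have s: "smooth \<phi>" and b: "bounded {x. \<phi> x \<noteq> 0}" using \<phi> by (auto simp: test_function_iff)
  have p: "partial k (\<lambda>x. \<phi> x *\<^sub>R f x) x = partial k \<phi> x *\<^sub>R f x + \<phi> x *\<^sub>R partial k f x" for x k
    using partial_eq[OF has_derivative_scaleR[OF smooth_derivative[OF s] smooth_derivative[OF f]], of k x]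
    by (simp add: add.commute)
  have int: "integrable lebesgue (\<lambda>x. partial k \<phi> x *\<^sub>R f x)" "integrable lebesgue (\<lambda>x. \<phi> x *\<^sub>R partial k f x)"
    by (rule integrable_bounded_support[OF smooth_continuous[OF smooth_scaleR[OF smooth_partial[OF s] f]]
          bounded_subset[OF bounded_support_partial[OF b, of k]]], simp add: Collect_mono)
       (rule integrable_bounded_support[OF smooth_continuous[OF smooth_scaleR[OF s smooth_partial[OF f]]]
          bounded_subset[OF b]], simp add: Collect_mono)
  have sp: "smooth (\<lambda>x. \<phi> x *\<^sub>R f x)" by (rule smooth_scaleR[OF s f])
  have "(LINT x|lebesgue. partial k (\<lambda>x. \<phi> x *\<^sub>R f x) x) = 0"
    by (rule integral_partial_eq_0)
      (auto intro!: smooth_differentiable[OF sp] smooth_continuous[OF smooth_partial[OF sp]] bounded_subset[OF b])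
  then show ?thesis
    using int by (simp add: p Bochner_Integration.integral_add add_eq_0_iff)
qed

lemma test_function_spinor_field:
  fixes \<psi> :: "real^3 \<Rightarrow> complex^4"
  assumes "test_function \<psi>"
  shows "spinor_field \<psi> (\<lambda>k. partial k \<psi>)"
proof -
  have s: "smooth \<psi>" and b: "bounded {x. \<psi> x \<noteq> 0}" using assms by (auto simp: test_function_iff)
  have loc: "locally_integrable f" if "test_function f" for f
  proof -
    have "integrable lebesgue f"
      using that by (intro integrable_bounded_support) (auto simp: test_function_iff smooth_continuous)
    then show ?thesis
      unfolding locally_integrable_def set_integrable_def
      by (auto intro!: integrable_mult_indicator lmeasurable_compact fmeasurableD)
  qed
  have "has_weak_partial k \<psi> (partial k \<psi>)" for k
    unfolding has_weak_partial_def
    using loc[OF assms] loc[OF test_function_partial[OF assms]] integral_by_parts_scaleR[OF _ s] by blast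
  moreover have "square_integrable \<psi>"
    unfolding square_integrable_def
  proof
    show "\<psi> \<in> borel_measurable lebesgue"
      using smooth_continuous[OF s] by (simp add: borel_measurable_continuous_onI measurable_completion)
    show "integrable lebesgue (\<lambda>x. (norm (\<psi> x))\<^sup>2)"
      by (rule integrable_bounded_support) (auto intro!: continuous_on_power continuous_on_norm smooth_continuous[OF s] bounded_subset[OF b])
  qed
  ultimately show ?thesis by (simp add: spinor_field_def)
qed

text \<open>
  The divergence theorem in the form used for the weights \<open>r\<close>, \<open>x\<^sub>k / r\<close>, \<open>x\<^sub>k\<close> and \<open>r x\<^sub>k\<close>, which are
  smooth away from the origin; near the origin \<open>h\<close> vanishes identically.
\<close>

lemma weighted_partial:
  fixes w h :: "real^3 \<Rightarrow> real"
  assumes w: "\<And>x. x \<noteq> 0 \<Longrightarrow> (w has_derivative w' x) (at x)"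
    and cw: "continuous_on (- {0}) (\<lambda>x. w' x (axis k 1))"
    and h: "smooth h" and b: "bounded {x. h x \<noteq> 0}"
    and \<rho>: "\<rho> > 0" "\<And>x. norm x < \<rho> \<Longrightarrow> h x = 0"
  shows "has_bochner_integral lebesgue (\<lambda>x. w' x (axis k 1) * h x + w x * partial k h x) 0" (is "has_bochner_integral _ ?g _")
proof -
  let ?f = "\<lambda>x. w x * h x"
  have near: "partial k h x = 0" if "norm x < \<rho>" for x k
    using partial_cong_open[of "ball 0 \<rho>" x h "\<lambda>_. 0" k] \<rho> that by (simp add: dist_norm)
  have df: "(?f has_derivative (if norm x < \<rho> then (\<lambda>_. 0) else
      (\<lambda>v. w x * (\<Sum>k\<in>UNIV. v $ k *\<^sub>R partial k h x) + w' x v * h x))) (at x)" for x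
  proof (cases "norm x < \<rho>")
    case True
    have "((\<lambda>_. 0) has_derivative (\<lambda>_. 0)) (at x)" by simp
    then have "(?f has_derivative (\<lambda>_. 0)) (at x)"
      by (rule has_derivative_transform_within_open[OF _ open_ball[of 0 \<rho>]]) (use True \<rho> in auto)
    then show ?thesis using True by simp
  next
    case False
    then have "x \<noteq> 0" using \<rho> by auto
    from has_derivative_mult[OF w[OF this] smooth_derivative[OF h]] False show ?thesis by simp
  qed
  have pf: "partial k ?f x = ?g x" for x
    using partial_eq[OF df, of k x] near[of x k] \<rho>(2)[of x] by (auto simp: add.commute)
  have cf: "continuous_on UNIV ?g"
  proof -
    have "continuous_on (- {0}) w"
      by (intro continuous_at_imp_continuous_on ballI has_derivative_continuous[OF w]) simp
    then have "continuous_on (- {0}) ?g"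
      by (intro continuous_on_add continuous_on_mult cw smooth_continuous[OF h] smooth_continuous[OF smooth_partial[OF h]])
    moreover have "continuous_on (ball 0 \<rho>) ?g"
      by (rule continuous_on_eq[of _ "\<lambda>_. 0"]) (auto simp: near \<rho>)
    ultimately have "continuous_on (- {0} \<union> ball 0 \<rho>) ?g"
      by (intro continuous_on_open_Un) auto
    moreover have "- {0} \<union> ball 0 \<rho> = (UNIV :: (real^3) set)" using \<rho> by auto
    ultimately show ?thesis by simp
  qed
  have sub: "{x. ?g x \<noteq> 0} \<subseteq> {x. h x \<noteq> 0} \<union> {x. partial k h x \<noteq> 0}" by auto
  have int: "integrable lebesgue ?g"
    by (rule integrable_bounded_support[OF cf])
       (rule bounded_subset[OF _ sub], auto simp: b bounded_support_partial)
  have "(LINT x|lebesgue. partial k ?f x) = 0"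
  proof (rule integral_partial_eq_0)
    show "?f differentiable (at x)" for x using df differentiable_def by blast
    show "continuous_on UNIV (partial k ?f)"
    proof -
      have "partial k ?f = ?g" using pf by (rule ext)
      with cf show ?thesis by (simp only:)
    qed
    show "bounded {x. ?f x \<noteq> 0}" by (rule bounded_subset[OF b]) auto
  qed
  with int show ?thesis by (simp add: pf has_bochner_integral_iff)
qed

section \<open>The Clifford algebra of the Dirac matrices\<close>

text \<open>
  Three anticommuting symmetric involutions of a real inner product space.  The estimates of this
  section use nothing else about the Dirac matrices.
\<close>

locale clifford_triple =
  fixes A :: "3 \<Rightarrow> 'v::real_inner \<Rightarrow> 'v"
  assumes lin: "linear (A k)"
    and sym: "A k u \<bullet> v = u \<bullet> A k v"
    and anticommute: "A j (A k u) + A k (A j u) = (if j = k then 2 else 0) *\<^sub>R u"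
begin

lemma A_simps: "A k (u + v) = A k u + A k v" "A k (u - v) = A k u - A k v" "A k (r *\<^sub>R u) = r *\<^sub>R A k u"
   "A k 0 = 0" "A k (- u) = - A k u" "A k (sum f S) = (\<Sum>i\<in>S. A k (f i))"
  using lin[of k] by (simp_all add: linear_add linear_diff linear_scale linear_0 linear_neg linear_sum)

lemma A_square [simp]: "A k (A k u) = u"
  using anticommute[of k k u] by (simp flip: scaleR_2)

lemma A_swap: "j \<noteq> k \<Longrightarrow> A j (A k u) = - A k (A j u)"
  using anticommute[of j k u] by (simp add: eq_neg_iff_add_eq_0)

lemma inner_swap:
  assumes "j \<noteq> k"
  shows "v \<bullet> A j (A k u) = - (u \<bullet> A j (A k v))"
proof -
  have "v \<bullet> A j (A k u) = A k (A j v) \<bullet> u"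
    by (simp add: sym)
  also have "A k (A j v) = - A j (A k v)"
    using A_swap[of k j v] assms by simp
  finally show ?thesis by (simp add: inner_commute)
qed

lemma norm_A [simp]: "norm (A k u) = norm u"
  by (simp add: norm_eq_sqrt_inner sym)

text \<open>
  Clifford multiplication by the vector \<open>x\<close>.
\<close>

definition slash :: "real^3 \<Rightarrow> 'v \<Rightarrow> 'v" where
  "slash x u = (\<Sum>k\<in>UNIV. x $ k *\<^sub>R A k u)"

lemma slash_sym: "slash x u \<bullet> v = u \<bullet> slash x v"
  by (simp add: slash_def inner_sum_left inner_sum_right sym)

lemma slash_slash: "slash x (slash x u) = (norm x)\<^sup>2 *\<^sub>R u"
proof -
  have r: "(norm x)\<^sup>2 = x$1 * x$1 + x$2 * x$2 + x$3 * x$3"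
    unfolding power2_norm_eq_inner by (simp add: inner_vec_def sum_3)
  have sw: "A 2 (A 1 v) = - A 1 (A 2 v)" "A 3 (A 1 v) = - A 1 (A 3 v)" "A 3 (A 2 v) = - A 2 (A 3 v)" for v
    by (rule A_swap; simp)+
  show ?thesis
    unfolding slash_def r by (simp add: sum_3 A_simps sw algebra_simps)
qed

lemma norm_slash: "norm (slash x u) = norm x * norm u"
proof -
  have "(norm (slash x u))\<^sup>2 = (norm x * norm u)\<^sup>2"
    unfolding power2_norm_eq_inner slash_sym slash_slash
    by (simp add: power_mult_distrib power2_norm_eq_inner)
  then show ?thesis by (simp add: power2_eq_iff_nonneg)
qed

text \<open>
  The vectors \<open>t\<^sub>k\<close> form a spinor-valued covector tangential to the sphere through \<open>x\<close>, where only two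
  of the three Clifford generators act; this is why the constant is \<open>2\<close>.  With \<open>p\<close> the contraction
  and \<open>s\<^sub>k\<close> the tangential part of \<open>A\<^sub>k p\<close>, one has \<open>\<Sum>\<^sub>k |s\<^sub>k|\<^sup>2 = 2 |p|\<^sup>2\<close> and \<open>\<Sum>\<^sub>k \<langle>s\<^sub>k, t\<^sub>k\<rangle> = |p|\<^sup>2\<close>, and the claim is
  the nonnegativity of \<open>\<Sum>\<^sub>k |2 t\<^sub>k - s\<^sub>k|\<^sup>2\<close>.
\<close>

lemma norm_contraction_tangential:
  fixes t :: "3 \<Rightarrow> 'v"
  assumes x: "x \<noteq> 0" and t: "(\<Sum>k\<in>UNIV. x $ k *\<^sub>R t k) = 0"
  shows "(norm (\<Sum>k\<in>UNIV. A k (t k)))\<^sup>2 \<le> 2 * (\<Sum>k\<in>UNIV. (norm (t k))\<^sup>2)"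
proof -
  define p where "p = (\<Sum>k\<in>UNIV. A k (t k))"
  define r where "r = (norm x)\<^sup>2"
  define s where "s k = A k p - (x $ k / r) *\<^sub>R slash x p" for k
  have r0: "r > 0" using x by (simp add: r_def)
  have rx: "(\<Sum>k\<in>UNIV. x $ k * x $ k) = r"
    unfolding r_def power2_norm_eq_inner by (simp add: inner_vec_def)
  have "(\<Sum>k\<in>UNIV. s k \<bullet> t k) = (\<Sum>k\<in>UNIV. p \<bullet> A k (t k)) - (1 / r) * (slash x p \<bullet> (\<Sum>k\<in>UNIV. x $ k *\<^sub>R t k))"
    by (simp add: s_def inner_diff_left sum_subtractf inner_sum_right sum_distrib_left sym)
  also have "\<dots> = (norm p)\<^sup>2"
    unfolding t by (simp add: power2_norm_eq_inner p_def inner_sum_right)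
  finally have st: "(\<Sum>k\<in>UNIV. s k \<bullet> t k) = (norm p)\<^sup>2" .
  have "(\<Sum>k\<in>UNIV. s k \<bullet> s k) = (\<Sum>k\<in>(UNIV::3 set). A k p \<bullet> A k p)
      - (2 / r) * (slash x p \<bullet> (\<Sum>k\<in>UNIV. x $ k *\<^sub>R A k p))
      + (\<Sum>k\<in>UNIV. x $ k * x $ k) / r\<^sup>2 * (slash x p \<bullet> slash x p)"
    by (simp add: s_def inner_diff_left inner_diff_right sum_subtractf sum.distrib inner_sum_right sum_distrib_left sum_distrib_right
        algebra_simps inner_commute sum_divide_distrib power2_eq_square)
  also have "\<dots> = 2 * (norm p)\<^sup>2"
    using r0 unfolding slash_def[symmetric] rx
    by (simp add: sym slash_sym slash_slash flip: r_def) (simp add: dot_square_norm power2_eq_square)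
  finally have ss: "(\<Sum>k\<in>UNIV. s k \<bullet> s k) = 2 * (norm p)\<^sup>2" .
  have "0 \<le> (\<Sum>k\<in>UNIV. (norm (2 *\<^sub>R t k - s k))\<^sup>2)"
    by (simp add: sum_nonneg)
  also have "\<dots> = 4 * (\<Sum>k\<in>UNIV. (norm (t k))\<^sup>2) - 4 * (\<Sum>k\<in>UNIV. s k \<bullet> t k) + (\<Sum>k\<in>UNIV. s k \<bullet> s k)"
    by (simp add: power2_norm_eq_inner inner_diff_left inner_diff_right sum_subtractf sum.distrib sum_distrib_left algebra_simps inner_commute)
  finally show ?thesis unfolding st ss p_def by simp
qed

text \<open>
  The \<open>l\<close>-th component of a curl: for an antisymmetric operator \<open>M\<close> and \<open>d\<^sub>k = \<partial>\<^sub>k\<psi>\<close>, the expression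
  \<open>2 \<langle>d\<^sub>l\<^sub>+\<^sub>1, M d\<^sub>l\<^sub>+\<^sub>2\<rangle>\<close> is the \<open>l\<close>-th component of the curl of the field with components \<open>\<langle>\<psi>, M d\<^sub>k\<rangle>\<close>.  Here \<open>M\<close> is the bivector
  \<open>A\<^sub>m\<^sub>+\<^sub>1 A\<^sub>m\<^sub>+\<^sub>2\<close>; addition in the index type is modulo three, so the indices run cyclically.
\<close>

definition twist :: "(3 \<Rightarrow> 'v) \<Rightarrow> 3 \<Rightarrow> 3 \<Rightarrow> real" where
  "twist d l m = 2 * (d (l + 1) \<bullet> A (m + 1) (A (m + 2) (d (l + 2))))"

lemma cyclic_index: "(4::3) = 1" "(5::3) = 2"
  by simp_all

text \<open>
  The squares of \<open>D\<close> and of its tangential part differ from the sums of squares of the gradient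
  components by the off-diagonal products \<open>\<langle>A\<^sub>j d\<^sub>j, A\<^sub>k d\<^sub>k\<rangle>\<close>, and these are curls.
\<close>

lemma sum_twist:
  fixes x :: "real^3" and d :: "3 \<Rightarrow> 'v"
  defines "y \<equiv> \<Sum>k\<in>UNIV. x $ k *\<^sub>R d k" and "D \<equiv> \<Sum>k\<in>UNIV. A k (d k)"
  shows "(\<Sum>l\<in>UNIV. \<Sum>m\<in>UNIV. x $ l * x $ m * twist d l m) =
     (norm x)\<^sup>2 * (norm D)\<^sup>2 - (norm x)\<^sup>2 * (\<Sum>k\<in>UNIV. (norm (d k))\<^sup>2) + 2 * (norm y)\<^sup>2 - 2 * (D \<bullet> slash x y)"
    and "(\<Sum>l\<in>UNIV. twist d l l) = (norm D)\<^sup>2 - (\<Sum>k\<in>UNIV. (norm (d k))\<^sup>2)"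
proof -
  have r: "(norm x)\<^sup>2 = x$1 * x$1 + x$2 * x$2 + x$3 * x$3"
    unfolding power2_norm_eq_inner by (simp add: inner_vec_def sum_3)
  have sw: "A 2 (A 1 v) = - A 1 (A 2 v)" "A 3 (A 1 v) = - A 1 (A 3 v)" "A 3 (A 2 v) = - A 2 (A 3 v)" for v
    by (rule A_swap; simp)+
  note anti = inner_swap
  have a0: "v \<bullet> A j (A k v) = 0" if "j \<noteq> k" for v j k
    using anti[OF that, of v v] by simp
  have an: "d 2 \<bullet> A j (A k (d 1)) = - (d 1 \<bullet> A j (A k (d 2)))"
           "d 3 \<bullet> A j (A k (d 1)) = - (d 1 \<bullet> A j (A k (d 3)))"
           "d 3 \<bullet> A j (A k (d 2)) = - (d 2 \<bullet> A j (A k (d 3)))" if "j \<noteq> k" for j k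
    by (rule anti[OF that])+
  show "(\<Sum>l\<in>UNIV. twist d l l) = (norm D)\<^sup>2 - (\<Sum>k\<in>UNIV. (norm (d k))\<^sup>2)"
    unfolding power2_norm_eq_inner D_def twist_def sum_3
    by (simp add: inner_add_left inner_add_right sym sw a0 an cyclic_index algebra_simps)
  show "(\<Sum>l\<in>UNIV. \<Sum>m\<in>UNIV. x $ l * x $ m * twist d l m) =
     (norm x)\<^sup>2 * (norm D)\<^sup>2 - (norm x)\<^sup>2 * (\<Sum>k\<in>UNIV. (norm (d k))\<^sup>2) + 2 * (norm y)\<^sup>2 - 2 * (D \<bullet> slash x y)"
    unfolding r
    unfolding power2_norm_eq_inner D_def y_def twist_def sum_3 slash_def
    by (simp add: inner_add_left inner_add_right sym sw a0 an cyclic_index algebra_simps A_simps inner_commute)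
qed

text \<open>
  Split \<open>d\<close> into its radial part and a tangential part \<open>t\<close>.  The curls with the weights of the statement
  account for everything in \<open>r |D|\<^sup>2\<close> except \<open>|y|\<^sup>2 / r\<close> and \<open>r\<close> times \<open>2 \<Sum>\<^sub>k |t\<^sub>k|\<^sup>2 - |\<Sum>\<^sub>k A\<^sub>k t\<^sub>k|\<^sup>2\<close>,
  which is nonnegative.
\<close>

lemma twist_radial_bound:
  fixes x :: "real^3" and d :: "3 \<Rightarrow> 'v"
  assumes x: "x \<noteq> 0"
  shows "(norm (\<Sum>k\<in>UNIV. x $ k *\<^sub>R d k))\<^sup>2 / norm x
      + (\<Sum>l\<in>UNIV. \<Sum>m\<in>UNIV. (x $ l * x $ m / norm x + (if l = m then norm x else 0)) * twist d l m)
    \<le> norm x * (norm (\<Sum>k\<in>UNIV. A k (d k)))\<^sup>2"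
proof -
  define y where "y = (\<Sum>k\<in>UNIV. x $ k *\<^sub>R d k)"
  define D where "D = (\<Sum>k\<in>UNIV. A k (d k))"
  define r where "r = norm x"
  define t where "t k = d k - (x $ k / r\<^sup>2) *\<^sub>R y" for k
  define S where "S = (\<Sum>k\<in>UNIV. (norm (d k))\<^sup>2)"
  have r0: "r > 0" using x by (simp add: r_def)
  have rx: "(\<Sum>k\<in>UNIV. x $ k * x $ k) = r\<^sup>2"
    unfolding r_def power2_norm_eq_inner by (simp add: inner_vec_def)
  have "(\<Sum>k\<in>UNIV. x $ k *\<^sub>R t k) = y - ((\<Sum>k\<in>UNIV. x $ k * x $ k) / r\<^sup>2) *\<^sub>R y"
    unfolding t_def y_def
    by (simp add: scaleR_diff_right sum_subtractf scaleR_left.sum sum_divide_distrib)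
  also have "\<dots> = 0" using r0 by (simp add: rx)
  finally have tang: "(\<Sum>k\<in>UNIV. x $ k *\<^sub>R t k) = 0" .
  have "(\<Sum>k\<in>UNIV. A k (t k)) = D - (1 / r\<^sup>2) *\<^sub>R slash x y"
    by (simp add: t_def A_simps sum_subtractf D_def slash_def scaleR_sum_right)
  then have "(norm (\<Sum>k\<in>UNIV. A k (t k)))\<^sup>2 = (norm D)\<^sup>2 - 2 / r\<^sup>2 * (D \<bullet> slash x y) + (norm (slash x y))\<^sup>2 / r^4"
    by (simp add: power2_norm_eq_inner inner_diff_left inner_diff_right inner_commute power_divide flip: power_mult)
  also have "(norm (slash x y))\<^sup>2 / r^4 = (norm y)\<^sup>2 / r\<^sup>2"
    using r0 by (simp add: norm_slash power_mult_distrib r_def[symmetric] field_simps flip: power_add)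
  finally have P: "(norm (\<Sum>k\<in>UNIV. A k (t k)))\<^sup>2 = (norm D)\<^sup>2 - 2 / r\<^sup>2 * (D \<bullet> slash x y) + (norm y)\<^sup>2 / r\<^sup>2" .
  have "(\<Sum>k\<in>UNIV. (norm (t k))\<^sup>2) = S - 2 / r\<^sup>2 * (y \<bullet> y) + (\<Sum>k\<in>UNIV. x $ k * x $ k) / r^4 * (y \<bullet> y)"
  proof -
    have yd: "(\<Sum>k\<in>UNIV. x $ k * (y \<bullet> d k)) = y \<bullet> y"
      by (subst (3) y_def) (simp add: inner_sum_right)
    have "(norm (t k))\<^sup>2 = (norm (d k))\<^sup>2 - 2 / r\<^sup>2 * (x $ k * (y \<bullet> d k)) + x $ k * x $ k / r^4 * (y \<bullet> y)" for k
      unfolding t_def power2_norm_eq_inner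
      by (simp add: inner_diff_left inner_diff_right inner_commute power4_eq_xxxx power2_eq_square)
    then have "(\<Sum>k\<in>UNIV. (norm (t k))\<^sup>2) = S - 2 / r\<^sup>2 * (\<Sum>k\<in>UNIV. x $ k * (y \<bullet> d k))
        + (\<Sum>k\<in>UNIV. x $ k * x $ k) / r^4 * (y \<bullet> y)"
      by (simp add: S_def sum.distrib sum_subtractf sum_distrib_left sum_distrib_right sum_divide_distrib)
    then show ?thesis unfolding yd .
  qed
  also have "\<dots> = S - (norm y)\<^sup>2 / r\<^sup>2"
    using r0 by (simp add: rx dot_square_norm field_simps power4_eq_xxxx power2_eq_square)
  finally have T: "(\<Sum>k\<in>UNIV. (norm (t k))\<^sup>2) = S - (norm y)\<^sup>2 / r\<^sup>2" .
  have "(norm D)\<^sup>2 - 2 / r\<^sup>2 * (D \<bullet> slash x y) + (norm y)\<^sup>2 / r\<^sup>2 \<le> 2 * (S - (norm y)\<^sup>2 / r\<^sup>2)"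
    using norm_contraction_tangential[OF x tang] unfolding P T .
  then have "r\<^sup>2 * ((norm D)\<^sup>2 - 2 / r\<^sup>2 * (D \<bullet> slash x y) + (norm y)\<^sup>2 / r\<^sup>2) \<le> r\<^sup>2 * (2 * (S - (norm y)\<^sup>2 / r\<^sup>2))"
    using r0 by (intro mult_left_mono) auto
  then have key: "r\<^sup>2 * (norm D)\<^sup>2 - 2 * (D \<bullet> slash x y) + 3 * (norm y)\<^sup>2 \<le> 2 * r\<^sup>2 * S"
    using r0 by (simp add: algebra_simps)
  have "(\<Sum>l\<in>UNIV. \<Sum>m\<in>UNIV. (x $ l * x $ m / r + (if l = m then r else 0)) * twist d l m)
      = (\<Sum>l\<in>UNIV. \<Sum>m\<in>UNIV. x $ l * x $ m * twist d l m) / r + r * (\<Sum>l\<in>UNIV. twist d l l)"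
    by (simp add: distrib_right sum.distrib sum_divide_distrib sum_distrib_left if_distrib[where f = "\<lambda>z. z * _"] cong: if_cong)
  also have "\<dots> = (r\<^sup>2 * (norm D)\<^sup>2 - r\<^sup>2 * S + 2 * (norm y)\<^sup>2 - 2 * (D \<bullet> slash x y)) / r + r * ((norm D)\<^sup>2 - S)"
    unfolding sum_twist r_def[symmetric] D_def[symmetric] y_def[symmetric] S_def[symmetric] ..
  finally have tw: "(\<Sum>l\<in>UNIV. \<Sum>m\<in>UNIV. (x $ l * x $ m / r + (if l = m then r else 0)) * twist d l m) = \<dots>" .
  have "(norm y)\<^sup>2 / r + ((r\<^sup>2 * (norm D)\<^sup>2 - r\<^sup>2 * S + 2 * (norm y)\<^sup>2 - 2 * (D \<bullet> slash x y)) / r + r * ((norm D)\<^sup>2 - S))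
     = r * (norm D)\<^sup>2 + (r\<^sup>2 * (norm D)\<^sup>2 - 2 * (D \<bullet> slash x y) + 3 * (norm y)\<^sup>2 - 2 * r\<^sup>2 * S) / r"
    using r0 by (simp add: field_simps power2_eq_square)
  also have "\<dots> \<le> r * (norm D)\<^sup>2"
    using key r0 by (simp add: divide_le_0_iff)
  finally show ?thesis
    unfolding y_def[symmetric] D_def[symmetric] r_def[symmetric] tw .
qed

text \<open>
  The radial part of the argument: the terms of first order in \<open>\<mu>\<close> and the Coulomb term complete the
  square \<open>|y + u + \<mu> r u|\<^sup>2 / r\<close>, where \<open>y\<close> is \<open>r\<close> times the radial derivative.
\<close>

lemma massive_radial_bound:
  fixes x :: "real^3" and d :: "3 \<Rightarrow> 'v" and u w G :: 'v
  assumes x: "x \<noteq> 0" and \<mu>: "\<mu> \<ge> 0" and w: "norm w = \<mu> * norm u"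
    and G: "norm G = norm (\<Sum>k\<in>UNIV. A k (d k))" and b: "b \<le> norm x * (\<mu> * (norm u)\<^sup>2)"
  shows "(norm u)\<^sup>2 / norm x
      + (b / norm x + norm x * (2 * (G \<bullet> w)))
      - (\<Sum>k\<in>UNIV. (1 / norm x - (x $ k)\<^sup>2 / norm x ^ 3) * (norm u)\<^sup>2 + x $ k / norm x * (2 * (u \<bullet> d k)))
      - \<mu> * (\<Sum>k\<in>UNIV. (norm u)\<^sup>2 + x $ k * (2 * (u \<bullet> d k)))
      + (\<Sum>l\<in>UNIV. \<Sum>m\<in>UNIV. (x $ l * x $ m / norm x + (if l = m then norm x else 0)) * twist d l m)
    \<le> norm x * (norm (G + w))\<^sup>2"
proof -
  define y where "y = (\<Sum>k\<in>UNIV. x $ k *\<^sub>R d k)"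
  define D where "D = (\<Sum>k\<in>UNIV. A k (d k))"
  define r where "r = norm x"
  define N where "N = (norm u)\<^sup>2"
  define W where "W = (\<Sum>l\<in>UNIV. \<Sum>m\<in>UNIV. (x $ l * x $ m / norm x + (if l = m then norm x else 0)) * twist d l m)"
  have r0: "r > 0" using x by (simp add: r_def)
  have rx: "(\<Sum>k\<in>UNIV. (x $ k)\<^sup>2) = r\<^sup>2"
    unfolding r_def power2_norm_eq_inner by (simp add: inner_vec_def power2_eq_square)
  have uy: "(\<Sum>k\<in>UNIV. x $ k * (2 * (u \<bullet> d k))) = 2 * (u \<bullet> y)"
    by (simp add: y_def inner_sum_right sum_distrib_left algebra_simps)
  have 1: "(\<Sum>k\<in>UNIV. (1 / r - (x $ k)\<^sup>2 / r ^ 3) * N + x $ k / r * (2 * (u \<bullet> d k)))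
      = 2 / r * N + 2 / r * (u \<bullet> y)"
  proof -
    have "(\<Sum>k\<in>UNIV. (1 / r - (x $ k)\<^sup>2 / r ^ 3) * N + x $ k / r * (2 * (u \<bullet> d k)))
      = 3 / r * N - (\<Sum>k\<in>UNIV. (x $ k)\<^sup>2) / r ^ 3 * N + (\<Sum>k\<in>UNIV. x $ k * (2 * (u \<bullet> d k))) / r"
      by (simp add: sum.distrib sum_subtractf left_diff_distrib sum_distrib_right sum_divide_distrib)
    also have "\<dots> = 2 / r * N + 2 / r * (u \<bullet> y)"
      unfolding rx uy using r0 by (simp add: field_simps power2_eq_square power3_eq_cube)
    finally show ?thesis .
  qed
  have 2: "(\<Sum>k\<in>UNIV. N + x $ k * (2 * (u \<bullet> d k))) = 3 * N + 2 * (u \<bullet> y)"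
    by (simp add: sum.distrib uy)
  have 3: "(norm (G + w))\<^sup>2 = (norm D)\<^sup>2 + 2 * (G \<bullet> w) + \<mu>\<^sup>2 * N"
  proof -
    have "(norm (G + w))\<^sup>2 = (norm G)\<^sup>2 + 2 * (G \<bullet> w) + (norm w)\<^sup>2"
      by (simp add: power2_norm_eq_inner inner_add_left inner_add_right inner_commute)
    then show ?thesis
      by (simp add: G w D_def N_def power_mult_distrib)
  qed
  have "0 \<le> (norm (y + (1 + \<mu> * r) *\<^sub>R u))\<^sup>2 / r"
    using r0 by simp
  also have "(norm (y + (1 + \<mu> * r) *\<^sub>R u))\<^sup>2 = (norm y)\<^sup>2 + 2 * (1 + \<mu> * r) * (u \<bullet> y) + (1 + \<mu> * r)\<^sup>2 * N"
    unfolding N_def power2_norm_eq_inner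
    by (simp add: inner_add_left inner_add_right inner_commute algebra_simps power2_eq_square)
  also have "((norm y)\<^sup>2 + 2 * (1 + \<mu> * r) * (u \<bullet> y) + (1 + \<mu> * r)\<^sup>2 * N) / r
     = (norm y)\<^sup>2 / r + 2 / r * (u \<bullet> y) + 2 * \<mu> * (u \<bullet> y) + N / r + 2 * \<mu> * N + \<mu>\<^sup>2 * r * N"
    using r0 by (simp add: field_simps power2_eq_square)
  finally have sq: "0 \<le> \<dots>" .
  have bb: "b / r \<le> \<mu> * N"
    using b r0 by (simp add: field_simps r_def N_def)
  have tw: "(norm y)\<^sup>2 / r + W \<le> r * (norm D)\<^sup>2"
    using twist_radial_bound[OF x, of d] by (simp add: y_def D_def r_def W_def)
  have "N / r + (b / r + r * (2 * (G \<bullet> w))) - (2 / r * N + 2 / r * (u \<bullet> y)) - \<mu> * (3 * N + 2 * (u \<bullet> y)) + W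
     \<le> r * ((norm D)\<^sup>2 + 2 * (G \<bullet> w) + \<mu>\<^sup>2 * N)"
    using sq bb tw by (simp add: algebra_simps)
  then show ?thesis
    unfolding 3 W_def[symmetric] using 1 2 by (simp add: r_def N_def)
qed

end

lemma dirac_alpha_components:
  "(dirac_alpha 1 *v v) $ 1 = v $ 4" "(dirac_alpha 1 *v v) $ 2 = v $ 3"
  "(dirac_alpha 1 *v v) $ 3 = v $ 2" "(dirac_alpha 1 *v v) $ 4 = v $ 1"
  "(dirac_alpha 2 *v v) $ 1 = - \<i> * v $ 4" "(dirac_alpha 2 *v v) $ 2 = \<i> * v $ 3"
  "(dirac_alpha 2 *v v) $ 3 = - \<i> * v $ 2" "(dirac_alpha 2 *v v) $ 4 = \<i> * v $ 1"
  "(dirac_alpha 3 *v v) $ 1 = v $ 3" "(dirac_alpha 3 *v v) $ 2 = - v $ 4"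
  "(dirac_alpha 3 *v v) $ 3 = v $ 1" "(dirac_alpha 3 *v v) $ 4 = - v $ 2"
  by (simp_all add: dirac_alpha_def block_matrix_def pauli_def matrix_vector_mult_def sum_4 vector_2)

lemma dirac_beta_components:
  "(dirac_beta *v v) $ 1 = v $ 1" "(dirac_beta *v v) $ 2 = v $ 2"
  "(dirac_beta *v v) $ 3 = - v $ 3" "(dirac_beta *v v) $ 4 = - v $ 4"
  by (simp_all add: dirac_beta_def block_matrix_def matrix_vector_mult_def sum_4 mat_def)

interpretation dirac: clifford_triple "\<lambda>k v. dirac_alpha k *v v"
proof (rule clifford_triple.intro)
  fix j k :: 3 and u v :: "complex^4"
  show "linear ((*v) (dirac_alpha k))"
    by (rule linearI) (simp_all add: vec_eq_iff matrix_vector_mult_def sum.distrib distrib_left scaleR_sum_right)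
  show "(dirac_alpha k *v u) \<bullet> v = u \<bullet> (dirac_alpha k *v v)"
    using exhaust_3[of k]
    by (elim disjE) (simp_all add: inner_vec_def sum_4 dirac_alpha_components inner_complex_def algebra_simps)
  show "dirac_alpha j *v (dirac_alpha k *v u) + dirac_alpha k *v (dirac_alpha j *v u) = (if j = k then 2 else 0) *\<^sub>R u"
    using exhaust_3[of k] exhaust_3[of j]
    by (elim disjE) (simp_all add: vec_eq_iff forall_4 dirac_alpha_components scaleR_2)
qed

definition lower_order :: "real \<Rightarrow> complex \<Rightarrow> complex^4 \<Rightarrow> complex^4" where
  "lower_order m c u = c *s u - complex_of_real m *s (dirac_beta *v u)"

lemma shifted_dirac_split:
  "shifted_dirac m c \<psi> D x = \<i> *s (\<Sum>k\<in>UNIV. dirac_alpha k *v D k x) + lower_order m c (\<psi> x)"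
  by (simp add: shifted_dirac_def lower_order_def algebra_simps)

lemma norm_i_vec [simp]: "norm (\<i> *s (v :: complex^'n)) = norm v"
  by (simp add: norm_vec_def norm_mult)

lemma linear_lower_order: "linear (lower_order m c)"
  by (rule linearI) (simp_all add: vec_eq_iff forall_4 lower_order_def dirac_beta_components algebra_simps)

lemma linear_i_vec: "linear (\<lambda>v :: complex^'n. \<i> *s v)"
  by (rule linearI) (simp_all add: vec_eq_iff algebra_simps)

text \<open>
  For imaginary \<open>c\<close> the operators \<open>c\<close> and \<open>m\<beta>\<close> are orthogonal in the real inner product.
\<close>

lemma norm_lower_order:
  assumes "Re c = 0"
  shows "norm (lower_order m c u) = sqrt (m\<^sup>2 + (norm c)\<^sup>2) * norm u"
proof -
  have "(norm (lower_order m c u))\<^sup>2 = (m\<^sup>2 + (norm c)\<^sup>2) * (norm u)\<^sup>2"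
    using assms
    by (simp add: power2_norm_eq_inner inner_vec_def sum_4 lower_order_def dirac_beta_components inner_complex_def)
       (simp add: algebra_simps power2_eq_square)
  then have "norm (lower_order m c u) = sqrt ((m\<^sup>2 + (norm c)\<^sup>2) * (norm u)\<^sup>2)"
    by (metis norm_ge_zero real_sqrt_unique)
  then show ?thesis by (simp add: real_sqrt_mult)
qed

text \<open>
  The form whose radial flux carries the interaction of the first-order part with mass and shift.
\<close>

definition boundary_form :: "real \<Rightarrow> complex \<Rightarrow> 3 \<Rightarrow> complex^4 \<Rightarrow> complex^4 \<Rightarrow> real" where
  "boundary_form m c k u v = (\<i> *s (dirac_alpha k *v u)) \<bullet> lower_order m c v"

text \<open>
  Symmetry is what turns \<open>2 \<langle>i\<alpha>\<^sub>k \<partial>\<^sub>k\<psi>, (c - m\<beta>)\<psi>\<rangle>\<close> into the derivative of a quadratic expression.  It holds because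
  \<open>\<beta>\<close> anticommutes with \<open>\<alpha>\<^sub>k\<close> and \<open>c\<close> is imaginary.
\<close>

lemma boundary_form_sym:
  assumes "Re c = 0"
  shows "boundary_form m c k u v = boundary_form m c k v u"
  using exhaust_3[of k] assms
  by (elim disjE)
     (simp_all add: boundary_form_def inner_vec_def sum_4 lower_order_def dirac_alpha_components dirac_beta_components
       inner_complex_def algebra_simps)

lemma boundary_form_slash:
  "(\<Sum>k\<in>UNIV. x $ k * boundary_form m c k u v) = (\<i> *s dirac.slash x u) \<bullet> lower_order m c v"
proof -
  interpret i: linear "\<lambda>v :: complex^4. \<i> *s v" by (rule linear_i_vec)
  show ?thesis
    by (simp add: boundary_form_def dirac.slash_def i.sum i.scale inner_sum_left)
qed

text \<open>
  The sum of \<open>\<partial>\<^sub>k (r B\<^sub>k)\<close>, \<open>- \<partial>\<^sub>k (x\<^sub>k |u|\<^sup>2 / r)\<close>, \<open>- \<mu> \<partial>\<^sub>k (x\<^sub>k |u|\<^sup>2)\<close> and \<open>\<partial>\<^sub>l (r x\<^sub>m C\<^sub>l\<^sub>m)\<close>, written out for a field with value \<open>u\<close>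
  and partial derivatives \<open>d\<close> at \<open>x\<close>; here \<open>B\<^sub>k\<close> is the boundary form on the diagonal and \<open>C\<^sub>l\<^sub>m\<close> are the
  curl components above.
\<close>

definition divergence_density :: "real \<Rightarrow> complex \<Rightarrow> real^3 \<Rightarrow> complex^4 \<Rightarrow> (3 \<Rightarrow> complex^4) \<Rightarrow> real" where
  "divergence_density m c x u d =
      (\<Sum>k\<in>UNIV. x $ k / norm x * boundary_form m c k u u + norm x * (2 * boundary_form m c k (d k) u))
      - (\<Sum>k\<in>UNIV. (1 / norm x - (x $ k)\<^sup>2 / norm x ^ 3) * (norm u)\<^sup>2 + x $ k / norm x * (2 * (u \<bullet> d k)))
      - sqrt (m\<^sup>2 + (norm c)\<^sup>2) * (\<Sum>k\<in>UNIV. (norm u)\<^sup>2 + x $ k * (2 * (u \<bullet> d k)))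
      + (\<Sum>l\<in>UNIV. \<Sum>m\<in>UNIV. (x $ l * x $ m / norm x + (if l = m then norm x else 0)) * dirac.twist d l m)"

lemma pointwise_hardy:
  assumes "x \<noteq> 0" "Re c = 0"
  shows "(norm u)\<^sup>2 / norm x + divergence_density m c x u d
    \<le> norm x * (norm (\<i> *s (\<Sum>k\<in>UNIV. dirac_alpha k *v d k) + lower_order m c u))\<^sup>2"
proof -
  interpret i: linear "\<lambda>v :: complex^4. \<i> *s v" by (rule linear_i_vec)
  define \<mu> where "\<mu> = sqrt (m\<^sup>2 + (norm c)\<^sup>2)"
  have w: "norm (lower_order m c u) = \<mu> * norm u"
    using assms by (simp add: norm_lower_order \<mu>_def)
  have "(\<i> *s dirac.slash x u) \<bullet> lower_order m c u \<le> norm (\<i> *s dirac.slash x u) * norm (lower_order m c u)"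
    by (rule norm_cauchy_schwarz)
  then have b: "(\<i> *s dirac.slash x u) \<bullet> lower_order m c u \<le> norm x * (\<mu> * (norm u)\<^sup>2)"
    by (simp add: w dirac.norm_slash power2_eq_square algebra_simps)
  have e: "(\<Sum>k\<in>UNIV. x $ k / norm x * boundary_form m c k u u + norm x * (2 * boundary_form m c k (d k) u))
    = ((\<i> *s dirac.slash x u) \<bullet> lower_order m c u) / norm x
      + norm x * (2 * ((\<i> *s (\<Sum>k\<in>UNIV. dirac_alpha k *v d k)) \<bullet> lower_order m c u))"
    unfolding boundary_form_slash[symmetric]
    by (simp add: sum.distrib sum_divide_distrib boundary_form_def i.sum inner_sum_left sum_distrib_left)
  have "\<mu> \<ge> 0" by (simp add: \<mu>_def)
  from dirac.massive_radial_bound[OF assms(1) this w norm_i_vec b]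
  show ?thesis
    unfolding divergence_density_def e \<mu>_def[symmetric] by (simp only: add_diff_eq add.assoc[symmetric])
qed

section \<open>The inequality for test functions vanishing near the origin\<close>

lemma partial_inner:
  assumes "smooth f" "smooth g"
  shows "partial k (\<lambda>x. f x \<bullet> g x) x = f x \<bullet> partial k g x + partial k f x \<bullet> g x"
  using partial_eq[OF has_derivative_inner[OF smooth_derivative[OF assms(1)] smooth_derivative[OF assms(2)]], of k]
  by simp

lemma norm_has_derivative:
  "x \<noteq> 0 \<Longrightarrow> (norm has_derivative (\<lambda>v. (x \<bullet> v) / norm x)) (at (x :: real^3))"
  using has_derivative_norm[of x] by (simp add: sgn_div_norm inner_commute divide_inverse mult.commute)

lemma inner_axis_unit: "x \<bullet> axis k 1 = x $ (k::3)" for x :: "real^3"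
  by (simp add: inner_axis)

lemma coord_has_derivative: "((\<lambda>x :: real^3. x $ k) has_derivative (\<lambda>v. v $ k)) (at x)"
  by (rule bounded_linear_imp_has_derivative[OF bounded_linear_vec_nth])

text \<open>
  For test functions the integrand is continuous with compact support.
\<close>

lemma integrable_dirac_energy:
  fixes \<psi> :: "real^3 \<Rightarrow> complex^4"
  assumes "test_function \<psi>"
  shows "integrable lebesgue (\<lambda>x. norm x * (norm (shifted_dirac m c \<psi> (\<lambda>k. partial k \<psi>) x))\<^sup>2)"
proof -
  have s: "smooth \<psi>" and b: "bounded {x. \<psi> x \<noteq> 0}" using assms by (auto simp: test_function_iff)
  define F where "F = shifted_dirac m c \<psi> (\<lambda>k. partial k \<psi>)"
  have F: "F x = \<i> *s (\<Sum>k\<in>UNIV. dirac_alpha k *v partial k \<psi> x) + lower_order m c (\<psi> x)" for x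
    by (simp add: F_def shifted_dirac_split)
  have bl: "bounded_linear (\<lambda>v. dirac_alpha k *v v)" "bounded_linear (\<lambda>v :: complex^4. \<i> *s v)" "bounded_linear (lower_order m c)" for k
    by (simp_all add: linear_conv_bounded_linear[symmetric] linear_lower_order dirac.lin linear_i_vec)
  have cF: "continuous_on UNIV F"
    unfolding F[abs_def]
    by (intro continuous_on_add bounded_linear.continuous_on[OF bl(1)] bounded_linear.continuous_on[OF bl(2)]
        bounded_linear.continuous_on[OF bl(3)] continuous_on_sum smooth_continuous[OF s]
        smooth_continuous[OF smooth_partial[OF s]])
  have l0: "lower_order m c 0 = 0" by (rule linear_0[OF linear_lower_order])
  have bF: "bounded {x. F x \<noteq> 0}"
  proof (rule bounded_subset)
    show "bounded ({x. \<psi> x \<noteq> 0} \<union> (\<Union>k\<in>UNIV. {x. partial k \<psi> x \<noteq> 0}))"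
      using b bounded_support_partial[OF b] by (auto intro: bounded_UN)
    show "{x. F x \<noteq> 0} \<subseteq> {x. \<psi> x \<noteq> 0} \<union> (\<Union>k\<in>UNIV. {x. partial k \<psi> x \<noteq> 0})"
      by (auto simp: F l0)
  qed
  show ?thesis
    unfolding F_def[symmetric]
    by (rule integrable_bounded_support) (auto intro!: continuous_intros cF intro: bounded_subset[OF bF])
qed

abbreviation coulomb_energy :: "(real^3 \<Rightarrow> complex^4) \<Rightarrow> ennreal" where
  "coulomb_energy u \<equiv> \<integral>\<^sup>+x. ennreal ((norm (u x))\<^sup>2 / norm x) \<partial>lebesgue"

abbreviation weighted_energy :: "(real^3 \<Rightarrow> 'b::real_normed_vector) \<Rightarrow> ennreal" where
  "weighted_energy f \<equiv> \<integral>\<^sup>+x. ennreal (norm x * (norm (f x))\<^sup>2) \<partial>lebesgue"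

locale origin_free_spinor =
  fixes \<psi> :: "real^3 \<Rightarrow> complex^4" and \<rho> :: real
  assumes test: "test_function \<psi>" and \<rho>: "\<rho> > 0" and away: "\<And>x. norm x < \<rho> \<Longrightarrow> \<psi> x = 0"
begin

lemma smooth_spinor: "smooth \<psi>" and bdd: "bounded {x. \<psi> x \<noteq> 0}"
  using test by (auto simp: test_function_iff)

lemma partial_away: "norm x < \<rho> \<Longrightarrow> partial k \<psi> x = 0"
  using partial_cong_open[of "ball 0 \<rho>" x \<psi> "\<lambda>_. 0" k] away by simp

lemma divergence_boundary:
  assumes "Re c = 0"
  shows "has_bochner_integral lebesgue (\<lambda>x. x $ k / norm x * boundary_form m c k (\<psi> x) (\<psi> x)
      + norm x * (2 * boundary_form m c k (partial k \<psi> x) (\<psi> x))) 0"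
proof -
  let ?h = "\<lambda>x. boundary_form m c k (\<psi> x) (\<psi> x)"
  have L: "bounded_linear (\<lambda>v. \<i> *s (dirac_alpha k *v v))" "bounded_linear (lower_order m c)"
    by (simp_all add: linear_conv_bounded_linear[symmetric] linear_lower_order
        linear_compose[OF dirac.lin linear_i_vec, unfolded o_def])
  note sm = smooth_linear_compose[OF L(1) smooth_spinor] smooth_linear_compose[OF L(2) smooth_spinor]
  have sh: "smooth ?h"
    unfolding boundary_form_def by (rule smooth_inner[OF sm])
  have ph: "partial k ?h x = 2 * boundary_form m c k (partial k \<psi> x) (\<psi> x)" for x
  proof -
    have "partial k ?h x = boundary_form m c k (\<psi> x) (partial k \<psi> x) + boundary_form m c k (partial k \<psi> x) (\<psi> x)"
      unfolding boundary_form_def partial_inner[OF sm]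
      using partial_bounded_linear[OF L(1) smooth_differentiable[OF smooth_spinor]]
        partial_bounded_linear[OF L(2) smooth_differentiable[OF smooth_spinor]] by simp
    then show ?thesis using boundary_form_sym[OF assms] by simp
  qed
  have z: "boundary_form m c k 0 v = 0" for v
    using linear_0[OF dirac.lin[of k]] by (simp add: boundary_form_def)
  have "has_bochner_integral lebesgue (\<lambda>x. (x \<bullet> axis k 1) / norm x * ?h x + norm x * partial k ?h x) 0"
  proof (rule weighted_partial[OF norm_has_derivative _ sh _ \<rho>])
    show "continuous_on (- {0}) (\<lambda>x :: real^3. x \<bullet> axis k 1 / norm x)"
      by (intro continuous_intros) auto
    show "bounded {x. ?h x \<noteq> 0}" by (rule bounded_subset[OF bdd]) (auto simp: z)
  qed (simp_all add: away z)
  then show ?thesis by (simp add: ph inner_axis_unit)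
qed

lemma smooth_norm_square: "smooth (\<lambda>x. (norm (\<psi> x))\<^sup>2)"
  and partial_norm_square: "partial k (\<lambda>x. (norm (\<psi> x))\<^sup>2) x = 2 * (\<psi> x \<bullet> partial k \<psi> x)"
  and bdd_norm_square: "bounded {x. (norm (\<psi> x))\<^sup>2 \<noteq> 0}"
  unfolding power2_norm_eq_inner
  using smooth_inner[OF smooth_spinor smooth_spinor] partial_inner[OF smooth_spinor smooth_spinor, of k x] bdd
  by (simp_all add: inner_commute)

lemma divergence_radial:
  "has_bochner_integral lebesgue (\<lambda>x. (1 / norm x - (x $ k)\<^sup>2 / norm x ^ 3) * (norm (\<psi> x))\<^sup>2
      + x $ k / norm x * (2 * (\<psi> x \<bullet> partial k \<psi> x))) 0"
proof -
  let ?w' = "\<lambda>(x :: real^3) v. v $ k / norm x - x $ k * (x \<bullet> v) / norm x ^ 3"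
  have w: "((\<lambda>x. x $ k / norm x) has_derivative ?w' x) (at x)" if "x \<noteq> 0" for x :: "real^3"
  proof -
    have "((\<lambda>x. x $ k / norm x) has_derivative
       (\<lambda>v. - (x $ k) * (inverse (norm x) * (x \<bullet> v / norm x) * inverse (norm x)) + v $ k / norm x)) (at x)"
      using that by (intro has_derivative_divide coord_has_derivative norm_has_derivative) auto
    moreover have "- (x $ k) * (inverse (norm x) * (x \<bullet> v / norm x) * inverse (norm x)) + v $ k / norm x = ?w' x v" for v
      by (simp add: divide_inverse power3_eq_cube)
    ultimately show ?thesis by simp
  qed
  have "has_bochner_integral lebesgue (\<lambda>x. ?w' x (axis k 1) * (norm (\<psi> x))\<^sup>2
      + x $ k / norm x * partial k (\<lambda>x. (norm (\<psi> x))\<^sup>2) x) 0"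
  proof (rule weighted_partial[OF w _ smooth_norm_square bdd_norm_square \<rho>])
    show "continuous_on (- {0}) (\<lambda>x :: real^3. ?w' x (axis k 1))"
      by (intro continuous_intros) auto
  qed (simp_all add: away)
  then show ?thesis
    by (simp add: partial_norm_square inner_axis_unit flip: power2_eq_square)
qed

lemma divergence_position:
  "has_bochner_integral lebesgue (\<lambda>x. (norm (\<psi> x))\<^sup>2 + x $ k * (2 * (\<psi> x \<bullet> partial k \<psi> x))) 0"
proof -
  have "has_bochner_integral lebesgue (\<lambda>x. axis k 1 $ k * (norm (\<psi> x))\<^sup>2
      + x $ k * partial k (\<lambda>x. (norm (\<psi> x))\<^sup>2) x) 0"
    by (rule weighted_partial[OF coord_has_derivative _ smooth_norm_square bdd_norm_square \<rho>])
       (simp_all add: away)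
  then show ?thesis by (simp add: partial_norm_square)
qed

text \<open>
  The integrand is \<open>\<nabla>w\<close> with \<open>w = r x\<^sub>m\<close> paired with a curl.  After integration by parts the second derivatives
  cancel in pairs, by their symmetry and the antisymmetry of \<open>M\<close>.
\<close>

lemma divergence_twist:
  "has_bochner_integral lebesgue (\<lambda>x. \<Sum>l\<in>UNIV. (x $ l * x $ m / norm x + (if l = m then norm x else 0))
      * dirac.twist (\<lambda>k. partial k \<psi> x) l m) 0"
proof -
  define M where "M v = dirac_alpha (m + 1) *v (dirac_alpha (m + 2) *v v)" for v
  define T where "T l x = dirac.twist (\<lambda>k. partial k \<psi> x) l m" for l x
  have T: "T l x = 2 * (partial (l + 1) \<psi> x \<bullet> M (partial (l + 2) \<psi> x))" for l x
    by (simp add: T_def dirac.twist_def M_def)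
  have ne: "m + 1 \<noteq> m + 2"
    by simp
  have anti: "a \<bullet> M b = - (b \<bullet> M a)" for a b
    unfolding M_def by (rule dirac.inner_swap[OF ne])
  have lM: "bounded_linear M"
    unfolding M_def[abs_def] linear_conv_bounded_linear[symmetric]
    by (rule linear_compose[OF dirac.lin dirac.lin, unfolded o_def])
  have sM: "smooth (\<lambda>x. M (partial j \<psi> x))" for j
    by (rule smooth_linear_compose[OF lM smooth_partial[OF smooth_spinor]])
  have sT: "smooth (T l)" for l
    unfolding T[abs_def] by (intro smooth_mult smooth_const smooth_inner smooth_partial[OF smooth_spinor] sM)
  define e where "e l j x = partial l (partial j \<psi>) x" for l j x
  have esym: "e l j x = e j l x" for l j x
    unfolding e_def by (rule partial_commute[OF smooth_spinor])
  have pM: "partial l (\<lambda>x. M (partial j \<psi> x)) x = M (e l j x)" for l j x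
    unfolding e_def by (rule partial_bounded_linear[OF lM smooth_differentiable[OF smooth_partial[OF smooth_spinor]]])
  have pT: "partial l (T l) x = 2 * (partial (l + 1) \<psi> x \<bullet> M (e l (l + 2) x) + e l (l + 1) x \<bullet> M (partial (l + 2) \<psi> x))" for l x
  proof -
    have s: "smooth (\<lambda>x. partial (l + 1) \<psi> x \<bullet> M (partial (l + 2) \<psi> x))"
      by (intro smooth_inner smooth_partial[OF smooth_spinor] sM)
    have "partial l (T l) x = 2 * partial l (\<lambda>x. partial (l + 1) \<psi> x \<bullet> M (partial (l + 2) \<psi> x)) x"
      unfolding T[abs_def]
      by (rule partial_bounded_linear[OF bounded_linear_mult_right smooth_differentiable[OF s]])
    then show ?thesis
      by (simp only: partial_inner[OF smooth_partial[OF smooth_spinor] sM] pM e_def[symmetric])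
  qed
  have cancel: "(\<Sum>l\<in>UNIV. partial l (T l) x) = 0" for x
    unfolding sum_3 pT
    using anti[of "e 1 2 x" "partial 3 \<psi> x"] anti[of "e 2 3 x" "partial 1 \<psi> x"] anti[of "e 3 1 x" "partial 2 \<psi> x"]
    by (simp add: dirac.cyclic_index esym[of 2 1] esym[of 3 2] esym[of 1 3])
  let ?w' = "\<lambda>(x :: real^3) v. norm x * v $ m + x \<bullet> v / norm x * x $ m"
  have w: "((\<lambda>x. norm x * x $ m) has_derivative ?w' x) (at x)" if "x \<noteq> 0" for x :: "real^3"
    using that by (intro has_derivative_mult coord_has_derivative norm_has_derivative)
  have "has_bochner_integral lebesgue (\<lambda>x. ?w' x (axis l 1) * T l x + norm x * x $ m * partial l (T l) x) 0" for l
  proof (rule weighted_partial[OF w _ sT _ \<rho>])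
    show "continuous_on (- {0}) (\<lambda>x :: real^3. ?w' x (axis l 1))"
      by (intro continuous_intros) auto
    have M0: "M 0 = 0" by (simp add: M_def)
    show "bounded {x. T l x \<noteq> 0}"
      by (rule bounded_subset[OF bounded_support_partial[OF bdd, of "l + 1"]]) (auto simp: T)
    show "T l x = 0" if "norm x < \<rho>" for x
      using partial_away[OF that] by (simp add: T)
  qed auto
  then have "has_bochner_integral lebesgue
     (\<lambda>x. \<Sum>l\<in>UNIV. ?w' x (axis l 1) * T l x + norm x * x $ m * partial l (T l) x) (\<Sum>l\<in>(UNIV :: 3 set). 0)"
    by (intro has_bochner_integral_sum)
  moreover have "(\<Sum>l\<in>UNIV. ?w' x (axis l 1) * T l x + norm x * x $ m * partial l (T l) x)
     = (\<Sum>l\<in>UNIV. (x $ l * x $ m / norm x + (if l = m then norm x else 0)) * T l x)" for x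
  proof -
    have "(\<Sum>l\<in>UNIV. norm x * x $ m * partial l (T l) x) = 0"
      by (simp add: cancel flip: sum_distrib_left)
    moreover have "?w' x (axis l 1) = x $ l * x $ m / norm x + (if l = m then norm x else 0)" for l
    proof -
      have "axis l (1 :: real) $ m = (if l = m then 1 else 0)" by (simp add: axis_def)
      then show ?thesis by (simp add: inner_axis_unit)
    qed
    ultimately show ?thesis by (simp add: sum.distrib)
  qed
  ultimately show ?thesis by (simp add: T_def)
qed

lemma divergence_integral:
  assumes "Re c = 0"
  shows "has_bochner_integral lebesgue (\<lambda>x. divergence_density m c x (\<psi> x) (\<lambda>k. partial k \<psi> x)) 0"
proof -
  have "has_bochner_integral lebesgue (\<lambda>x. divergence_density m c x (\<psi> x) (\<lambda>k. partial k \<psi> x))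
     ((\<Sum>k\<in>(UNIV :: 3 set). 0) - (\<Sum>k\<in>(UNIV :: 3 set). 0) - sqrt (m\<^sup>2 + (norm c)\<^sup>2) * (\<Sum>k\<in>(UNIV :: 3 set). 0)
       + (\<Sum>m\<in>(UNIV :: 3 set). 0))"
    unfolding divergence_density_def
    by (subst sum.swap) (intro has_bochner_integral_add has_bochner_integral_diff has_bochner_integral_sum
        has_bochner_integral_mult_right divergence_boundary[OF assms] divergence_radial divergence_position divergence_twist)
  then show ?thesis by simp
qed

lemma hardy:
  assumes "Re c = 0"
  shows "coulomb_energy \<psi>
      \<le> weighted_energy (shifted_dirac m c \<psi> (\<lambda>k. partial k \<psi>))"
proof -
  define L where "L x = (norm (\<psi> x))\<^sup>2 / norm x" for x
  define F where "F = shifted_dirac m c \<psi> (\<lambda>k. partial k \<psi>)"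
  define R where "R x = norm x * (norm (F x))\<^sup>2" for x
  define Z where "Z x = divergence_density m c x (\<psi> x) (\<lambda>k. partial k \<psi> x)" for x
  have Z: "integrable lebesgue Z" "integral\<^sup>L lebesgue Z = 0"
    using divergence_integral[OF assms, of m] by (simp_all add: Z_def[abs_def] has_bochner_integral_iff)
  have F: "F x = \<i> *s (\<Sum>k\<in>UNIV. dirac_alpha k *v partial k \<psi> x) + lower_order m c (\<psi> x)" for x
    by (simp add: F_def shifted_dirac_split)
  have iR: "integrable lebesgue R"
    unfolding R_def F_def by (rule integrable_dirac_energy[OF test])
  have cL: "continuous_on UNIV L"
  proof -
    have "continuous_on (- {0}) L"
      unfolding L_def by (intro continuous_intros smooth_continuous[OF smooth_spinor]) auto
    moreover have "continuous_on (ball 0 \<rho>) L"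
      by (rule continuous_on_eq[of _ "\<lambda>_. 0"]) (auto simp: L_def away)
    ultimately have "continuous_on (- {0} \<union> ball 0 \<rho>) L"
      by (intro continuous_on_open_Un) auto
    moreover have "- {0} \<union> ball 0 \<rho> = (UNIV :: (real^3) set)" using \<rho> by auto
    ultimately show ?thesis by simp
  qed
  have iL: "integrable lebesgue L"
    by (rule integrable_bounded_support[OF cL]) (rule bounded_subset[OF bdd], auto simp: L_def)
  have pw: "L x + Z x \<le> R x" for x
  proof (cases "x = 0")
    case False
    then show ?thesis using pointwise_hardy[OF False assms] by (simp add: L_def Z_def R_def F)
  next
    case True
    have "\<psi> 0 = 0" "partial k \<psi> 0 = 0" for k
      using away[of 0] partial_away[of 0 k] \<rho> by auto
    then show ?thesis
      by (simp add: True L_def Z_def R_def divergence_density_def boundary_form_def dirac.twist_def)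
  qed
  have "integral\<^sup>L lebesgue L = integral\<^sup>L lebesgue (\<lambda>x. L x + Z x)"
    using iL Z by simp
  also have "\<dots> \<le> integral\<^sup>L lebesgue R"
    by (intro integral_mono) (simp_all add: iL Z iR pw)
  finally have "integral\<^sup>L lebesgue L \<le> integral\<^sup>L lebesgue R" .
  moreover have "(\<integral>\<^sup>+ x. ennreal (L x) \<partial>lebesgue) = ennreal (integral\<^sup>L lebesgue L)"
    by (rule nn_integral_eq_integral[OF iL]) (simp add: L_def)
  moreover have "(\<integral>\<^sup>+ x. ennreal (R x) \<partial>lebesgue) = ennreal (integral\<^sup>L lebesgue R)"
    by (rule nn_integral_eq_integral[OF iR]) (simp add: R_def)
  ultimately show ?thesis
    by (simp add: L_def R_def F_def ennreal_leI)
qed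

end

section \<open>Mollification\<close>

lemma sigma_finite_lebesgue: "sigma_finite_measure (lebesgue :: 'a::euclidean_space measure)"
proof
  obtain A :: "'a set set" where A: "countable A" "A \<subseteq> sets lborel" "\<Union>A = space lborel" "\<forall>a\<in>A. emeasure lborel a \<noteq> \<infinity>"
    using lborel.sigma_finite_countable by blast
  have "a \<in> sets lebesgue \<and> emeasure lebesgue a \<noteq> \<infinity>" if "a \<in> A" for a
    using A that by (auto simp: main_part_sets)
  then show "\<exists>A :: 'a set set. countable A \<and> A \<subseteq> sets lebesgue \<and> \<Union>A = space lebesgue \<and> (\<forall>a\<in>A. emeasure lebesgue a \<noteq> \<infinity>)"
    using A by (intro exI[of _ A]) auto
qed

interpretation lebesgue_pair: pair_sigma_finite "lebesgue :: (real^3) measure" "lebesgue :: (real^3) measure"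
  by (simp add: pair_sigma_finite_def sigma_finite_lebesgue)

lemma measurable_continuous_lebesgue:
  fixes f :: "real^3 \<Rightarrow> 'b::euclidean_space"
  shows "continuous_on UNIV f \<Longrightarrow> f \<in> borel_measurable lebesgue"
  by (simp add: borel_measurable_continuous_onI measurable_completion)

lemma norm_measurable_lebesgue: "norm \<in> borel_measurable (lebesgue :: (real^3) measure)"
  by (intro measurable_continuous_lebesgue continuous_on_norm_id)

lemma smooth_flat_exp_ball: "smooth (\<lambda>x :: real^3. flat_exp (1 - (norm x)\<^sup>2 / \<delta>\<^sup>2))"
proof -
  have "smooth (\<lambda>x :: real^3. 1 + (- 1 / \<delta>\<^sup>2) * (norm (x - 0))\<^sup>2)"
    by (rule smooth_add[OF smooth_const smooth_mult[OF smooth_const smooth_dist_square]])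
  from smooth_compose[OF smooth_real_on_flat_exp this] show ?thesis by simp
qed

lemma flat_exp_nonneg [simp]: "0 \<le> flat_exp t" and flat_exp_le_1: "flat_exp t \<le> 1" and flat_exp_pos: "0 < t \<Longrightarrow> 0 < flat_exp t"
  and flat_exp_0: "t \<le> 0 \<Longrightarrow> flat_exp t = 0"
  by (simp_all add: flat_exp_def)

text \<open>
  A nonnegative even bump of total mass one supported in the ball of radius \<open>\<delta>\<close>.
\<close>

definition mollifier :: "real \<Rightarrow> (real^3 \<Rightarrow> real) \<Rightarrow> bool" where
  "mollifier \<delta> \<phi> \<longleftrightarrow> test_function \<phi> \<and> (\<forall>x. 0 \<le> \<phi> x) \<and> (\<forall>x. \<delta> \<le> norm x \<longrightarrow> \<phi> x = 0)
     \<and> (\<forall>x. \<phi> (- x) = \<phi> x) \<and> (LINT x|lebesgue. \<phi> x) = 1"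

lemma mollifier_exists:
  assumes "\<delta> > 0"
  shows "\<exists>\<phi>. mollifier \<delta> \<phi>"
proof -
  define b where "b x = flat_exp (1 - (norm x)\<^sup>2 / \<delta>\<^sup>2)" for x :: "real^3"
  have sb: "smooth b" unfolding b_def by (rule smooth_flat_exp_ball)
  have b0: "b x = 0" if "\<delta> \<le> norm x" for x
  proof -
    have "\<delta>\<^sup>2 \<le> (norm x)\<^sup>2" using that assms by (intro power_mono) auto
    then show ?thesis using assms by (simp add: b_def flat_exp_0)
  qed
  have bpos: "b x > 0" if "norm x < \<delta>" for x
  proof -
    have "(norm x)\<^sup>2 < \<delta>\<^sup>2" using that by (intro power_strict_mono) auto
    then show ?thesis using assms by (simp add: b_def flat_exp_pos)
  qed
  have bnn: "0 \<le> b x" for x by (simp add: b_def)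
  have bb: "bounded {x. b x \<noteq> 0}"
    by (rule bounded_subset[OF bounded_ball[of 0 \<delta>]]) (auto simp: not_le[symmetric] dest: b0)
  have ib: "integrable lebesgue b"
    by (rule integrable_bounded_support[OF smooth_continuous[OF sb] bb])
  define N where "N = (LINT x|lebesgue. b x)"
  have "N \<noteq> 0"
  proof
    assume "N = 0"
    then have "AE x in lebesgue. b x = 0"
      using integral_nonneg_eq_0_iff_AE[OF ib] bnn by (simp add: N_def)
    then obtain S where S: "S \<in> null_sets lebesgue" "{x. b x \<noteq> 0} \<subseteq> S"
      by (auto simp: eventually_ae_filter)
    have "negligible S" using S(1) by (simp add: negligible_iff_null_sets)
    from negligible_subset[OF this S(2)] have "negligible {x. b x \<noteq> 0}" .
    then have "negligible (ball (0 :: real^3) \<delta>)"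
      by (rule negligible_subset) (auto dest!: bpos)
    then show False using assms open_not_negligible[of "ball (0 :: real^3) \<delta>"] by simp
  qed
  moreover have "N \<ge> 0" unfolding N_def by (rule integral_nonneg_AE) (simp add: bnn)
  ultimately have N: "N > 0" by simp
  have "smooth (\<lambda>x. inverse N * b x)"
    by (rule smooth_mult[OF smooth_const sb])
  moreover have "(LINT x|lebesgue. inverse N * b x) = 1"
    using N by (simp add: N_def[symmetric])
  moreover have "b (- x) = b x" for x by (simp add: b_def)
  ultimately have "mollifier \<delta> (\<lambda>x. inverse N * b x)"
    using N bnn b0 bb by (simp add: mollifier_def test_function_iff)
  then show ?thesis by blast
qed

definition mollify :: "(real^3 \<Rightarrow> real) \<Rightarrow> (real^3 \<Rightarrow> 'b::euclidean_space) \<Rightarrow> real^3 \<Rightarrow> 'b" where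
  "mollify \<phi> f x = (LINT y|lebesgue. \<phi> (x - y) *\<^sub>R f y)"

lemma uniformly_continuous_bounded_support:
  fixes f :: "real^3 \<Rightarrow> 'b::euclidean_space"
  assumes c: "continuous_on UNIV f" and b: "bounded {x. f x \<noteq> 0}" and e: "e > 0"
  shows "\<exists>d>0. \<forall>x v. norm v < d \<longrightarrow> norm (f (x + v) - f x) < e"
proof -
  obtain R where R: "\<And>x. f x \<noteq> 0 \<Longrightarrow> norm x \<le> R" using b unfolding bounded_iff by blast
  have "uniformly_continuous_on (cball 0 (R + 2)) f"
    by (rule compact_uniformly_continuous[OF continuous_on_subset[OF c]]) auto
  then obtain d where d: "d > 0"
    "\<And>x y. x \<in> cball 0 (R + 2) \<Longrightarrow> y \<in> cball 0 (R + 2) \<Longrightarrow> dist y x < d \<Longrightarrow> dist (f y) (f x) < e"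
    unfolding uniformly_continuous_on_def using e by blast
  have "norm (f (x + v) - f x) < e" if v: "norm v < min d 1" for x v
  proof (cases "norm x \<le> R + 1")
    case True
    have "norm (x + v) \<le> R + 2" using norm_triangle_ineq[of x v] True v by linarith
    moreover have "dist (x + v) x < d" using v by (simp add: dist_norm)
    ultimately have "dist (f (x + v)) (f x) < e"
      using True by (intro d(2)) simp_all
    then show ?thesis by (simp add: dist_norm)
  next
    case False
    have "norm x \<le> norm (x + v) + norm v" using norm_triangle_ineq4[of "x + v" v] by simp
    then have "\<not> norm (x + v) \<le> R" using False v by linarith
    then have "f (x + v) = 0" "f x = 0" using R[of x] R[of "x + v"] False by linarith+
    then show ?thesis using e by simp
  qed
  then show ?thesis using d(1) by (intro exI[of _ "min d 1"]) simp
qed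

text \<open>
  The first-order Taylor remainder of a test function is uniformly small, which is what differentiation under the
  convolution integral needs.
\<close>

lemma uniform_derivative:
  fixes \<phi> :: "real^3 \<Rightarrow> real"
  assumes \<phi>: "test_function \<phi>" and e: "e > 0"
  shows "\<exists>d>0. \<forall>x v. norm v < d \<longrightarrow> \<bar>\<phi> (x + v) - \<phi> x - (\<Sum>k\<in>UNIV. v $ k * partial k \<phi> x)\<bar> \<le> e * norm v"
proof -
  have s: "smooth \<phi>" and b: "bounded {x. \<phi> x \<noteq> 0}" using \<phi> by (auto simp: test_function_iff)
  have "\<exists>d>0. \<forall>x v. norm v < d \<longrightarrow> norm (partial k \<phi> (x + v) - partial k \<phi> x) < e / 3" for k
    using e by (intro uniformly_continuous_bounded_support smooth_continuous[OF smooth_partial[OF s]] bounded_support_partial[OF b]) simp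
  then obtain d where d: "\<And>k. d k > 0" "\<And>k x v. norm v < d k \<Longrightarrow> norm (partial k \<phi> (x + v) - partial k \<phi> x) < e / 3"
    by metis
  define D where "D = Min (range d)"
  have D: "D > 0" "D \<le> d k" for k
    unfolding D_def using d(1) by (simp_all add: Min_gr_iff)
  have "\<bar>\<phi> (x + v) - \<phi> x - (\<Sum>k\<in>UNIV. v $ k * partial k \<phi> x)\<bar> \<le> e * norm v" if v: "norm v < D" for x v
  proof -
    define g where "g t = \<phi> (x + t *\<^sub>R v) - t * (\<Sum>k\<in>UNIV. v $ k * partial k \<phi> x)" for t
    have dg: "(g has_real_derivative (\<Sum>k\<in>UNIV. v $ k * (partial k \<phi> (x + t *\<^sub>R v) - partial k \<phi> x))) (at t)" for t
    proof -
      have "((\<lambda>t. x + t *\<^sub>R v) has_derivative (\<lambda>t. t *\<^sub>R v)) (at t)"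
        by (auto intro!: derivative_eq_intros)
      from has_derivative_compose[OF this smooth_derivative[OF s]]
      have "((\<lambda>t. \<phi> (x + t *\<^sub>R v)) has_derivative (\<lambda>h. \<Sum>k\<in>UNIV. (h *\<^sub>R v) $ k *\<^sub>R partial k \<phi> (x + t *\<^sub>R v))) (at t)" .
      moreover have "(\<Sum>k\<in>UNIV. (h *\<^sub>R v) $ k *\<^sub>R partial k \<phi> (x + t *\<^sub>R v)) = (\<Sum>k\<in>UNIV. v $ k * partial k \<phi> (x + t *\<^sub>R v)) * h" for h
        unfolding sum_distrib_right by (intro sum.cong) (simp_all add: mult_ac)
      ultimately have 1: "((\<lambda>t. \<phi> (x + t *\<^sub>R v)) has_real_derivative (\<Sum>k\<in>UNIV. v $ k * partial k \<phi> (x + t *\<^sub>R v))) (at t)"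
        by (simp add: has_field_derivative_def)
      have 2: "((\<lambda>t. t * (\<Sum>k\<in>UNIV. v $ k * partial k \<phi> x)) has_real_derivative (\<Sum>k\<in>UNIV. v $ k * partial k \<phi> x)) (at t)"
        using DERIV_cmult_right[OF DERIV_ident] by simp
      show ?thesis
        using DERIV_diff[OF 1 2] unfolding g_def by (simp add: right_diff_distrib sum_subtractf)
    qed
    from MVT2[of 0 1 g, OF _ dg] obtain t where t: "0 < t" "t < 1"
      and eq: "g 1 - g 0 = (\<Sum>k\<in>UNIV. v $ k * (partial k \<phi> (x + t *\<^sub>R v) - partial k \<phi> x))" by auto
    have "norm (t *\<^sub>R v) \<le> norm v" using t by (simp add: mult_left_le_one_le)
    then have "norm (t *\<^sub>R v) < d k" for k using v D(2)[of k] by linarith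
    then have "\<bar>v $ k * (partial k \<phi> (x + t *\<^sub>R v) - partial k \<phi> x)\<bar> \<le> norm v * (e / 3)" for k
      unfolding abs_mult using d(2)[of "t *\<^sub>R v" k x] component_le_norm_cart[of v k]
      by (intro mult_mono) (simp_all add: less_imp_le)
    then have "(\<Sum>k\<in>(UNIV :: 3 set). \<bar>v $ k * (partial k \<phi> (x + t *\<^sub>R v) - partial k \<phi> x)\<bar>) \<le> (\<Sum>k\<in>(UNIV :: 3 set). norm v * (e / 3))"
      by (intro sum_mono)
    then have "\<bar>g 1 - g 0\<bar> \<le> e * norm v"
      unfolding eq by (intro order_trans[OF sum_abs]) (simp add: mult.commute)
    then show ?thesis by (simp add: g_def algebra_simps)
  qed
  then show ?thesis using D(1) by blast
qed

lemma mollify_integrand_integrable: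
  fixes f :: "real^3 \<Rightarrow> 'b::euclidean_space"
  assumes \<phi>: "continuous_on UNIV \<phi>" "bounded {x. \<phi> x \<noteq> 0}" and f: "integrable lebesgue f"
  shows "integrable lebesgue (\<lambda>y. \<phi> (x - y) *\<^sub>R f y)"
proof -
  obtain M where M: "\<And>x. norm (\<phi> x) \<le> M" using bounded_continuous_support[OF \<phi>] by blast
  have "continuous_on UNIV (\<lambda>y. \<phi> (x - y))"
    by (rule continuous_on_compose2[OF \<phi>(1)]) (auto intro!: continuous_intros)
  then have m: "(\<lambda>y. \<phi> (x - y)) \<in> borel_measurable lebesgue" by (rule measurable_continuous_lebesgue)
  have "integrable lebesgue (\<lambda>y. M *\<^sub>R f y)" using f by simp
  then show ?thesis
  proof (rule Bochner_Integration.integrable_bound)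
    show "(\<lambda>y. \<phi> (x - y) *\<^sub>R f y) \<in> borel_measurable lebesgue"
      by (rule borel_measurable_scaleR[OF m borel_measurable_integrable[OF f]])
    have "norm (\<phi> (x - y) *\<^sub>R f y) \<le> norm (M *\<^sub>R f y)" for y
      using M[of "x - y"] by (simp add: mult_right_mono)
    then show "AE y in lebesgue. norm (\<phi> (x - y) *\<^sub>R f y) \<le> norm (M *\<^sub>R f y)" by simp
  qed
qed

lemma mollify_has_derivative:
  fixes f :: "real^3 \<Rightarrow> 'b::euclidean_space"
  assumes \<phi>: "test_function \<phi>" and f: "integrable lebesgue f"
  shows "(mollify \<phi> f has_derivative (\<lambda>v. \<Sum>k\<in>UNIV. v $ k *\<^sub>R mollify (partial k \<phi>) f x)) (at x)"
  unfolding has_derivative_at_alt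
proof (intro conjI allI impI)
  show "bounded_linear (\<lambda>v :: real^3. \<Sum>k\<in>UNIV. v $ k *\<^sub>R mollify (partial k \<phi>) f x)"
    by (intro bounded_linear_sum bounded_linear_scaleR_const bounded_linear_vec_nth)
  fix e :: real assume e: "e > 0"
  define A where "A = (LINT y|lebesgue. norm (f y))"
  have A: "A \<ge> 0" by (simp add: A_def)
  have "e / (A + 1) > 0" using e A by simp
  from uniform_derivative[OF \<phi> this] obtain d where d: "d > 0"
    "\<And>x v. norm v < d \<Longrightarrow> \<bar>\<phi> (x + v) - \<phi> x - (\<Sum>k\<in>UNIV. v $ k * partial k \<phi> x)\<bar> \<le> e / (A + 1) * norm v"
    by blast
  have int: "integrable lebesgue (\<lambda>y. \<phi>' (x - y) *\<^sub>R f y)" if "test_function \<phi>'" for \<phi>' x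
    using that by (intro mollify_integrand_integrable f) (auto simp: test_function_iff smooth_continuous)
  note int1 = int[OF \<phi>] and int2 = int[OF test_function_partial[OF \<phi>]]
  have "norm (mollify \<phi> f y - mollify \<phi> f x - (\<Sum>k\<in>UNIV. (y - x) $ k *\<^sub>R mollify (partial k \<phi>) f x)) \<le> e * norm (y - x)"
    if y: "norm (y - x) < d" for y
  proof -
    define v where "v = y - x"
    define q where "q z = \<phi> (x - z + v) - \<phi> (x - z) - (\<Sum>k\<in>UNIV. v $ k * partial k \<phi> (x - z))" for z
    have yv: "y - z = x - z + v" for z by (simp add: v_def)
    have "mollify \<phi> f y - mollify \<phi> f x - (\<Sum>k\<in>UNIV. v $ k *\<^sub>R mollify (partial k \<phi>) f x)
       = (LINT z|lebesgue. \<phi> (y - z) *\<^sub>R f z - \<phi> (x - z) *\<^sub>R f z - (\<Sum>k\<in>UNIV. v $ k *\<^sub>R (partial k \<phi> (x - z) *\<^sub>R f z)))"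
      unfolding mollify_def
      by (subst Bochner_Integration.integral_diff Bochner_Integration.integral_sum integral_scaleR_right
          | intro Bochner_Integration.integrable_diff Bochner_Integration.integrable_sum integrable_scaleR_right int1 int2 refl)+
    also have qf: "(\<lambda>z. \<phi> (y - z) *\<^sub>R f z - \<phi> (x - z) *\<^sub>R f z - (\<Sum>k\<in>UNIV. v $ k *\<^sub>R (partial k \<phi> (x - z) *\<^sub>R f z)))
        = (\<lambda>z. q z *\<^sub>R f z)"
      by (simp add: q_def yv scaleR_diff_left scaleR_sum_left fun_eq_iff)
    finally have eq: "mollify \<phi> f y - mollify \<phi> f x - (\<Sum>k\<in>UNIV. v $ k *\<^sub>R mollify (partial k \<phi>) f x) = (LINT z|lebesgue. q z *\<^sub>R f z)" .
    have qb: "\<bar>q z\<bar> \<le> e / (A + 1) * norm v" for z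
      unfolding q_def using d(2)[of v "x - z"] y by (simp add: v_def)
    have qfb: "norm (q z *\<^sub>R f z) \<le> e / (A + 1) * norm v * norm (f z)" for z
      using mult_right_mono[OF qb[of z] norm_ge_zero[of "f z"]] by simp
    have "integrable lebesgue (\<lambda>z. q z *\<^sub>R f z)"
      unfolding qf[symmetric]
      by (intro Bochner_Integration.integrable_diff Bochner_Integration.integrable_sum integrable_scaleR_right int1 int2)
    then have "norm (LINT z|lebesgue. q z *\<^sub>R f z) \<le> (LINT z|lebesgue. e / (A + 1) * norm v * norm (f z))"
      by (intro order_trans[OF integral_norm_bound] integral_mono integrable_mult_right integrable_norm f qfb)
    also have "\<dots> = e * norm v * (A / (A + 1))" by (simp add: A_def)
    also have "\<dots> \<le> e * norm v * 1"
      using A e by (intro mult_left_mono) auto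
    finally show ?thesis unfolding eq[unfolded v_def] by (simp add: v_def)
  qed
  then show "\<exists>d>0. \<forall>y. norm (y - x) < d \<longrightarrow>
    norm (mollify \<phi> f y - mollify \<phi> f x - (\<Sum>k\<in>UNIV. (y - x) $ k *\<^sub>R mollify (partial k \<phi>) f x)) \<le> e * norm (y - x)"
    using d(1) by blast
qed

lemma partial_mollify:
  assumes "test_function \<phi>" "integrable lebesgue f"
  shows "partial k (mollify \<phi> f) = mollify (partial k \<phi>) f"
  using partial_eq[OF mollify_has_derivative[OF assms], of k] by (simp add: fun_eq_iff)

lemma smooth_mollify:
  fixes f :: "real^3 \<Rightarrow> 'b::euclidean_space"
  assumes \<phi>: "test_function \<phi>" and f: "integrable lebesgue f"
  shows "smooth (mollify \<phi> f)"
proof -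
  have "cont_diff n (mollify \<phi> f)" if "test_function \<phi>" for n \<phi>
    using that
  proof (induction n arbitrary: \<phi>)
    case 0
    show ?case
      using has_derivative_continuous[OF mollify_has_derivative[OF 0 f]] by (simp add: continuous_at_imp_continuous_on)
  next
    case (Suc n)
    show ?case
      by (rule cont_diff_SucI[OF mollify_has_derivative[OF Suc.prems f]])
         (simp add: Suc.IH test_function_partial[OF Suc.prems])
  qed
  then show ?thesis using \<phi> by (simp add: smooth_def)
qed

lemma smooth_reflect:
  fixes f :: "real^3 \<Rightarrow> real"
  assumes "smooth f"
  shows "smooth (\<lambda>y. f (x - y))" and "partial k (\<lambda>y. f (x - y)) y = - partial k f (x - y)"
proof -
  have der: "((\<lambda>y. g (x - y)) has_derivative (\<lambda>v. - (\<Sum>k\<in>UNIV. v $ k *\<^sub>R partial k g (x - y)))) (at y)"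
    if "g differentiable (at (x - y))" for g :: "real^3 \<Rightarrow> real" and y
  proof -
    have "((\<lambda>y. x - y) has_derivative (\<lambda>v. - v)) (at y)"
      by (auto intro!: derivative_eq_intros)
    from has_derivative_compose[OF this has_derivative_partial[OF that]] show ?thesis by (simp add: sum_negf)
  qed
  have "cont_diff n (\<lambda>y. g (x - y))" if "cont_diff n g" for n and g :: "real^3 \<Rightarrow> real"
    using that
  proof (induction n arbitrary: g)
    case 0
    then have "continuous_on UNIV g" by simp
    then have "continuous_on UNIV (\<lambda>y. g (x - y))"
      by (rule continuous_on_compose2) (auto intro!: continuous_intros)
    then show ?case by simp
  next
    case (Suc n)
    then have d: "g differentiable (at z)" and c: "cont_diff n (partial k g)" for z k by auto
    have "cont_diff n (\<lambda>y. (- 1) * partial k g (x - y))" for k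
      by (rule bounded_bilinear.cont_diff_prod[OF bounded_bilinear_mult cont_diff_const Suc.IH[OF c]])
    then show ?case
      by (intro cont_diff_SucI[OF der[OF d]]) simp
  qed
  then show "smooth (\<lambda>y. f (x - y))" using assms by (simp add: smooth_def)
  show "partial k (\<lambda>y. f (x - y)) y = - partial k f (x - y)"
    using partial_eq[OF der[OF smooth_differentiable[OF assms]], of k] by simp
qed

lemma mollifierD:
  assumes "mollifier \<delta> \<phi>"
  shows "test_function \<phi>" "smooth \<phi>" "bounded {x. \<phi> x \<noteq> 0}" "0 \<le> \<phi> x" "\<delta> \<le> norm x \<Longrightarrow> \<phi> x = 0"
    "\<phi> (- x) = \<phi> x" "(LINT x|lebesgue. \<phi> x) = 1" "continuous_on UNIV \<phi>" "integrable lebesgue \<phi>"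
  using assms smooth_continuous[of \<phi> UNIV] integrable_bounded_support[of \<phi>] by (auto simp: mollifier_def test_function_iff)

lemma nn_integral_mollifier:
  assumes "mollifier \<delta> \<phi>"
  shows "(\<integral>\<^sup>+x. ennreal (\<phi> (x - y)) \<partial>lebesgue) = 1" "(\<integral>\<^sup>+x. ennreal (\<phi> (y - x)) \<partial>lebesgue) = 1"
proof -
  have m: "\<phi> \<in> borel_measurable borel"
    using mollifierD(8)[OF assms] by (rule borel_measurable_continuous_onI)
  have "(\<integral>\<^sup>+x. ennreal (\<phi> (x + (- y))) \<partial>lebesgue) = (\<integral>\<^sup>+x. ennreal (\<phi> x) \<partial>lebesgue)"
    by (rule nn_integral_translate) (use m in measurable)
  also have "\<dots> = ennreal 1"
    using nn_integral_eq_integral[OF mollifierD(9)[OF assms]] mollifierD(4,7)[OF assms] by simp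
  finally show 1: "(\<integral>\<^sup>+x. ennreal (\<phi> (x - y)) \<partial>lebesgue) = 1" by simp
  have "\<phi> (y - x) = \<phi> (x - y)" for x using mollifierD(6)[OF assms, of "x - y"] by simp
  then show "(\<integral>\<^sup>+x. ennreal (\<phi> (y - x)) \<partial>lebesgue) = 1" using 1 by simp
qed

text \<open>
  Tonelli, moving a weight through a convolution.
\<close>

lemma nn_integral_mollify_swap:
  fixes r \<phi> :: "real^3 \<Rightarrow> real" and G :: "real^3 \<Rightarrow> ennreal"
  assumes r: "continuous_on UNIV r" and \<phi>: "continuous_on UNIV \<phi>" and G: "G \<in> borel_measurable lebesgue"
  shows "(\<integral>\<^sup>+x. \<integral>\<^sup>+y. ennreal (r x) * (ennreal (\<phi> (x - y)) * G y) \<partial>lebesgue \<partial>lebesgue)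
     = (\<integral>\<^sup>+y. G y * (\<integral>\<^sup>+x. ennreal (r x) * ennreal (\<phi> (x - y)) \<partial>lebesgue) \<partial>lebesgue)"
proof -
  let ?L = "lebesgue :: (real^3) measure"
  have rm: "r \<in> borel_measurable borel" and pm: "\<phi> \<in> borel_measurable borel"
    using r \<phi> by (auto intro: borel_measurable_continuous_onI)
  have idm: "(\<lambda>x. x) \<in> ?L \<rightarrow>\<^sub>M borel" by (simp add: measurable_completion)
  have f1: "fst \<in> ?L \<Otimes>\<^sub>M ?L \<rightarrow>\<^sub>M borel" and s1: "snd \<in> ?L \<Otimes>\<^sub>M ?L \<rightarrow>\<^sub>M borel"
    by (rule measurable_compose[OF measurable_fst idm], rule measurable_compose[OF measurable_snd idm])
  have m1: "(\<lambda>p. ennreal (r (fst p))) \<in> borel_measurable (?L \<Otimes>\<^sub>M ?L)"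
    by (rule measurable_compose[OF measurable_compose[OF f1 rm] measurable_ennreal])
  have "(\<lambda>p. fst p - snd p) \<in> ?L \<Otimes>\<^sub>M ?L \<rightarrow>\<^sub>M borel"
    by (rule borel_measurable_diff[OF f1 s1])
  from measurable_compose[OF measurable_compose[OF this pm] measurable_ennreal]
  have m2: "(\<lambda>p. ennreal (\<phi> (fst p - snd p))) \<in> borel_measurable (?L \<Otimes>\<^sub>M ?L)" .
  have m3: "(\<lambda>p. G (snd p)) \<in> borel_measurable (?L \<Otimes>\<^sub>M ?L)"
    by (rule measurable_compose[OF measurable_snd G])
  let ?f = "\<lambda>p. ennreal (r (fst p)) * (ennreal (\<phi> (fst p - snd p)) * G (snd p))"
  have "?f \<in> borel_measurable (?L \<Otimes>\<^sub>M ?L)"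
    by (intro borel_measurable_times_ennreal m1 m2 m3)
  then have "(\<lambda>(x, y). ennreal (r x) * (ennreal (\<phi> (x - y)) * G y)) \<in> borel_measurable (?L \<Otimes>\<^sub>M ?L)"
    by (simp add: case_prod_beta)
  from lebesgue_pair.Fubini'[OF this]
  have "(\<integral>\<^sup>+x. \<integral>\<^sup>+y. ennreal (r x) * (ennreal (\<phi> (x - y)) * G y) \<partial>lebesgue \<partial>lebesgue)
     = (\<integral>\<^sup>+y. \<integral>\<^sup>+x. ennreal (r x) * (ennreal (\<phi> (x - y)) * G y) \<partial>lebesgue \<partial>lebesgue)" by simp
  also have "\<dots> = (\<integral>\<^sup>+y. G y * (\<integral>\<^sup>+x. ennreal (r x) * ennreal (\<phi> (x - y)) \<partial>lebesgue) \<partial>lebesgue)"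
  proof (rule nn_integral_cong)
    fix y :: "real^3"
    have "continuous_on UNIV (\<lambda>x. \<phi> (x - y))"
      by (rule continuous_on_compose2[OF \<phi>]) (auto intro!: continuous_intros)
    then have "(\<lambda>x. ennreal (\<phi> (x - y))) \<in> borel_measurable ?L"
      by (rule measurable_compose[OF measurable_continuous_lebesgue measurable_ennreal])
    moreover have "(\<lambda>x. ennreal (r x)) \<in> borel_measurable ?L"
      by (rule measurable_compose[OF measurable_continuous_lebesgue[OF r] measurable_ennreal])
    ultimately show "(\<integral>\<^sup>+x. ennreal (r x) * (ennreal (\<phi> (x - y)) * G y) \<partial>?L)
       = G y * (\<integral>\<^sup>+x. ennreal (r x) * ennreal (\<phi> (x - y)) \<partial>?L)"
      by (simp add: nn_integral_cmult[symmetric] borel_measurable_times_ennreal mult_ac)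
  qed
  finally show ?thesis .
qed

lemma norm_mollify_le:
  fixes f :: "real^3 \<Rightarrow> 'b::euclidean_space"
  assumes \<phi>: "mollifier \<delta> \<phi>" and f: "integrable lebesgue f"
  shows "ennreal (norm (mollify \<phi> f x)) \<le> (\<integral>\<^sup>+y. ennreal (\<phi> (x - y)) * ennreal (norm (f y)) \<partial>lebesgue)"
proof -
  have i: "integrable lebesgue (\<lambda>y. \<phi> (x - y) *\<^sub>R f y)"
    by (rule mollify_integrand_integrable[OF mollifierD(8,3)[OF \<phi>] f])
  have "ennreal (norm (mollify \<phi> f x)) \<le> (\<integral>\<^sup>+y. ennreal (norm (\<phi> (x - y) *\<^sub>R f y)) \<partial>lebesgue)"
    unfolding mollify_def by (rule integral_norm_bound_ennreal[OF i])
  also have "\<dots> = (\<integral>\<^sup>+y. ennreal (\<phi> (x - y)) * ennreal (norm (f y)) \<partial>lebesgue)"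
    using mollifierD(4)[OF \<phi>] by (intro nn_integral_cong) (simp add: ennreal_mult)
  finally show ?thesis .
qed

text \<open>
  Jensen's inequality for the probability density \<open>\<phi> (x - y)\<close>, proved by the Cauchy-Schwarz inequality with the
  square root of the density.
\<close>

lemma norm_mollify_square_le:
  fixes f :: "real^3 \<Rightarrow> 'b::euclidean_space"
  assumes \<phi>: "mollifier \<delta> \<phi>" and f: "integrable lebesgue f"
  shows "ennreal ((norm (mollify \<phi> f x))\<^sup>2) \<le> (\<integral>\<^sup>+y. ennreal (\<phi> (x - y)) * ennreal ((norm (f y))\<^sup>2) \<partial>lebesgue)"
proof -
  let ?s = "\<lambda>y. ennreal (sqrt (\<phi> (x - y)))" and ?t = "\<lambda>y. ennreal (sqrt (\<phi> (x - y)) * norm (f y))"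
  note nn = mollifierD(4)[OF \<phi>]
  have c: "continuous_on UNIV (\<lambda>y. sqrt (\<phi> (x - y)))"
    by (intro continuous_on_real_sqrt continuous_on_compose2[OF mollifierD(8)[OF \<phi>]]) (auto intro!: continuous_intros)
  have m: "?s \<in> borel_measurable lebesgue" "?t \<in> borel_measurable lebesgue"
    by (rule measurable_compose[OF _ measurable_ennreal], rule measurable_continuous_lebesgue[OF c])
       (intro measurable_compose[OF _ measurable_ennreal] borel_measurable_times measurable_continuous_lebesgue[OF c]
         borel_measurable_integrable[OF integrable_norm[OF f]])
  have st: "?s y * ?t y = ennreal (\<phi> (x - y)) * ennreal (norm (f y))" for y
  proof -
    have "?s y * ?t y = ennreal (sqrt (\<phi> (x - y)) * (sqrt (\<phi> (x - y)) * norm (f y)))"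
      using nn by (subst ennreal_mult) auto
    also have "sqrt (\<phi> (x - y)) * (sqrt (\<phi> (x - y)) * norm (f y)) = \<phi> (x - y) * norm (f y)"
      using nn by (simp flip: mult.assoc)
    finally show ?thesis using nn by (simp add: ennreal_mult)
  qed
  have ss: "(?s y)\<^sup>2 = ennreal (\<phi> (x - y))" for y
    using nn by (simp add: ennreal_power)
  have tt: "(?t y)\<^sup>2 = ennreal (\<phi> (x - y)) * ennreal ((norm (f y))\<^sup>2)" for y
    using nn by (simp add: ennreal_power power_mult_distrib ennreal_mult)
  have "ennreal ((norm (mollify \<phi> f x))\<^sup>2) = (ennreal (norm (mollify \<phi> f x)))\<^sup>2"
    by (simp add: ennreal_power)
  also have "\<dots> \<le> (\<integral>\<^sup>+y. ?s y * ?t y \<partial>lebesgue)\<^sup>2"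
    unfolding st by (rule power_mono[OF norm_mollify_le[OF \<phi> f]]) simp
  also have "\<dots> \<le> (\<integral>\<^sup>+y. (?s y)\<^sup>2 \<partial>lebesgue) * (\<integral>\<^sup>+y. (?t y)\<^sup>2 \<partial>lebesgue)"
    by (rule Cauchy_Schwarz_nn_integral[OF m])
  also have "\<dots> = (\<integral>\<^sup>+y. ennreal (\<phi> (x - y)) * ennreal ((norm (f y))\<^sup>2) \<partial>lebesgue)"
    unfolding ss tt nn_integral_mollifier(2)[OF \<phi>] by simp
  finally show ?thesis .
qed

text \<open>
  On the support of \<open>\<phi> (x - y)\<close> the weights at \<open>x\<close> and \<open>y\<close> differ by at most \<open>\<delta>\<close>.
\<close>

lemma weighted_energy_mollify_le:
  fixes f :: "real^3 \<Rightarrow> 'b::euclidean_space"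
  assumes \<phi>: "mollifier \<delta> \<phi>" and f: "integrable lebesgue f"
  shows "weighted_energy (mollify \<phi> f)
      \<le> (\<integral>\<^sup>+y. ennreal ((norm y + \<delta>) * (norm (f y))\<^sup>2) \<partial>lebesgue)"
proof -
  let ?G = "\<lambda>y. ennreal ((norm (f y))\<^sup>2)"
  have G: "?G \<in> borel_measurable lebesgue"
    by (intro measurable_compose[OF _ measurable_ennreal] borel_measurable_power
        borel_measurable_integrable[OF integrable_norm[OF f]])
  have cont: "continuous_on UNIV (\<lambda>y. \<phi> (x - y))" for x
    by (rule continuous_on_compose2[OF mollifierD(8)[OF \<phi>]]) (auto intro!: continuous_intros)
  have cont': "continuous_on UNIV (\<lambda>x. \<phi> (x - y))" for y
    by (rule continuous_on_compose2[OF mollifierD(8)[OF \<phi>]]) (auto intro!: continuous_intros)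
  have "weighted_energy (mollify \<phi> f)
     \<le> (\<integral>\<^sup>+x. \<integral>\<^sup>+y. ennreal (norm x) * (ennreal (\<phi> (x - y)) * ?G y) \<partial>lebesgue \<partial>lebesgue)"
  proof (rule nn_integral_mono)
    fix x :: "real^3"
    have "ennreal (norm x * (norm (mollify \<phi> f x))\<^sup>2) = ennreal (norm x) * ennreal ((norm (mollify \<phi> f x))\<^sup>2)"
      by (simp add: ennreal_mult)
    also have "\<dots> \<le> ennreal (norm x) * (\<integral>\<^sup>+y. ennreal (\<phi> (x - y)) * ?G y \<partial>lebesgue)"
      by (rule mult_left_mono[OF norm_mollify_square_le[OF \<phi> f]]) simp
    also have "\<dots> = (\<integral>\<^sup>+y. ennreal (norm x) * (ennreal (\<phi> (x - y)) * ?G y) \<partial>lebesgue)"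
      by (rule nn_integral_cmult[symmetric])
         (intro borel_measurable_times_ennreal G measurable_compose[OF measurable_continuous_lebesgue[OF cont] measurable_ennreal])
    finally show "ennreal (norm x * (norm (mollify \<phi> f x))\<^sup>2)
       \<le> (\<integral>\<^sup>+y. ennreal (norm x) * (ennreal (\<phi> (x - y)) * ?G y) \<partial>lebesgue)" .
  qed
  also have "\<dots> = (\<integral>\<^sup>+y. ?G y * (\<integral>\<^sup>+x. ennreal (norm x) * ennreal (\<phi> (x - y)) \<partial>lebesgue) \<partial>lebesgue)"
    by (rule nn_integral_mollify_swap[OF _ mollifierD(8)[OF \<phi>] G]) (rule continuous_on_norm_id)
  also have "\<dots> \<le> (\<integral>\<^sup>+y. ennreal ((norm y + \<delta>) * (norm (f y))\<^sup>2) \<partial>lebesgue)"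
  proof (rule nn_integral_mono)
    fix y :: "real^3"
    have le: "ennreal (norm x) * ennreal (\<phi> (x - y)) \<le> ennreal (norm y + \<delta>) * ennreal (\<phi> (x - y))" for x
    proof (cases "norm (x - y) < \<delta>")
      case True
      have "norm x \<le> norm y + norm (x - y)" by (rule norm_triangle_sub)
      with True show ?thesis by (intro mult_right_mono ennreal_leI) auto
    next
      case False
      then show ?thesis using mollifierD(5)[OF \<phi>, of "x - y"] by simp
    qed
    have \<delta>: "\<delta> \<ge> 0"
    proof (rule ccontr)
      assume "\<not> \<delta> \<ge> 0"
      then have "\<phi> x = 0" for x using mollifierD(5)[OF \<phi>, of x] norm_ge_zero[of x] by linarith
      then show False using mollifierD(7)[OF \<phi>] by simp
    qed
    have "(\<integral>\<^sup>+x. ennreal (norm x) * ennreal (\<phi> (x - y)) \<partial>lebesgue) \<le> (\<integral>\<^sup>+x. ennreal (norm y + \<delta>) * ennreal (\<phi> (x - y)) \<partial>lebesgue)"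
      by (rule nn_integral_mono[OF le])
    also have "\<dots> = ennreal (norm y + \<delta>) * (\<integral>\<^sup>+x. ennreal (\<phi> (x - y)) \<partial>lebesgue)"
      by (rule nn_integral_cmult) (rule measurable_compose[OF measurable_continuous_lebesgue[OF cont'] measurable_ennreal])
    also have "\<dots> = ennreal (norm y + \<delta>)" using nn_integral_mollifier(1)[OF \<phi>] by simp
    finally have "?G y * (\<integral>\<^sup>+x. ennreal (norm x) * ennreal (\<phi> (x - y)) \<partial>lebesgue) \<le> ?G y * ennreal (norm y + \<delta>)"
      by (rule mult_left_mono) simp
    also have "\<dots> = ennreal ((norm y + \<delta>) * (norm (f y))\<^sup>2)"
      using \<delta> by (simp add: ennreal_mult mult.commute)
    finally show "?G y * (\<integral>\<^sup>+x. ennreal (norm x) * ennreal (\<phi> (x - y)) \<partial>lebesgue) \<le> ennreal ((norm y + \<delta>) * (norm (f y))\<^sup>2)" .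
  qed
  finally show ?thesis .
qed

lemma mollify_L1_contraction:
  fixes f :: "real^3 \<Rightarrow> 'b::euclidean_space"
  assumes \<phi>: "mollifier \<delta> \<phi>" and f: "integrable lebesgue f"
  shows "(\<integral>\<^sup>+x. ennreal (norm (mollify \<phi> f x)) \<partial>lebesgue) \<le> (\<integral>\<^sup>+x. ennreal (norm (f x)) \<partial>lebesgue)"
proof -
  let ?G = "\<lambda>y. ennreal (norm (f y))"
  have G: "?G \<in> borel_measurable lebesgue"
    by (intro measurable_compose[OF _ measurable_ennreal] borel_measurable_integrable[OF integrable_norm[OF f]])
  have "(\<integral>\<^sup>+x. ennreal (norm (mollify \<phi> f x)) \<partial>lebesgue)
      \<le> (\<integral>\<^sup>+x. \<integral>\<^sup>+y. ennreal 1 * (ennreal (\<phi> (x - y)) * ?G y) \<partial>lebesgue \<partial>lebesgue)"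
    using norm_mollify_le[OF \<phi> f] by (intro nn_integral_mono) simp
  also have "\<dots> = (\<integral>\<^sup>+y. ?G y * (\<integral>\<^sup>+x. ennreal 1 * ennreal (\<phi> (x - y)) \<partial>lebesgue) \<partial>lebesgue)"
    by (rule nn_integral_mollify_swap[OF continuous_on_const mollifierD(8)[OF \<phi>] G])
  also have "\<dots> = (\<integral>\<^sup>+x. ennreal (norm (f x)) \<partial>lebesgue)"
    using nn_integral_mollifier(1)[OF \<phi>] by simp
  finally show ?thesis .
qed

lemma mollify_eq_0:
  assumes \<phi>: "mollifier \<delta> \<phi>" and "\<And>y. norm (x - y) < \<delta> \<Longrightarrow> f y = 0"
  shows "mollify \<phi> f x = 0"
proof -
  have "\<phi> (x - y) *\<^sub>R f y = 0" for y
    using mollifierD(5)[OF \<phi>, of "x - y"] assms(2)[of y] by (cases "norm (x - y) < \<delta>") auto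
  then have "(\<lambda>y. \<phi> (x - y) *\<^sub>R f y) = (\<lambda>y. 0)" by (rule ext)
  then show ?thesis unfolding mollify_def by (simp only:) simp
qed

lemma mollify_uniform_close:
  fixes g :: "real^3 \<Rightarrow> 'b::euclidean_space"
  assumes \<phi>: "mollifier \<delta> \<phi>" and g: "integrable lebesgue g"
    and e: "\<And>v. norm v < \<delta> \<Longrightarrow> norm (g (x + v) - g x) \<le> e"
  shows "norm (mollify \<phi> g x - g x) \<le> e"
proof -
  have c: "continuous_on UNIV (\<lambda>y. \<phi> (x - y))"
    by (rule continuous_on_compose2[OF mollifierD(8)[OF \<phi>]]) (auto intro!: continuous_intros)
  have b: "bounded {y. \<phi> (x - y) \<noteq> 0}"
  proof (rule bounded_subset[OF bounded_cball[of x \<delta>]], safe)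
    fix y assume "\<phi> (x - y) \<noteq> 0"
    then have "\<not> \<delta> \<le> norm (x - y)" using mollifierD(5)[OF \<phi>, of "x - y"] by blast
    then show "y \<in> cball x \<delta>" by (simp add: dist_norm)
  qed
  have i\<phi>: "integrable lebesgue (\<lambda>y. \<phi> (x - y))" by (rule integrable_bounded_support[OF c b])
  have one: "(LINT y|lebesgue. \<phi> (x - y)) = 1"
  proof -
    have "ennreal (LINT y|lebesgue. \<phi> (x - y)) = 1"
      using nn_integral_eq_integral[OF i\<phi>] mollifierD(4)[OF \<phi>] nn_integral_mollifier(2)[OF \<phi>, of x] by simp
    then show ?thesis by (simp add: ennreal_eq_1)
  qed
  have i1: "integrable lebesgue (\<lambda>y. \<phi> (x - y) *\<^sub>R g y)"
    by (rule mollify_integrand_integrable[OF mollifierD(8,3)[OF \<phi>] g])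
  have i2: "integrable lebesgue (\<lambda>y. \<phi> (x - y) *\<^sub>R g x)"
    by (rule integrable_scaleR_left) (use i\<phi> in simp)
  have "mollify \<phi> g x - g x = (LINT y|lebesgue. \<phi> (x - y) *\<^sub>R g y) - (LINT y|lebesgue. \<phi> (x - y) *\<^sub>R g x)"
    using one i\<phi> by (simp add: mollify_def)
  also have "\<dots> = (LINT y|lebesgue. \<phi> (x - y) *\<^sub>R (g y - g x))"
    by (simp add: Bochner_Integration.integral_diff[OF i1 i2, symmetric] scaleR_diff_right)
  finally have eq: "mollify \<phi> g x - g x = (LINT y|lebesgue. \<phi> (x - y) *\<^sub>R (g y - g x))" .
  have b: "norm (\<phi> (x - y) *\<^sub>R (g y - g x)) \<le> \<phi> (x - y) * e" for y
  proof (cases "norm (x - y) < \<delta>")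
    case True
    then have "norm (g y - g x) \<le> e" using e[of "y - x"] by (simp add: norm_minus_commute)
    then show ?thesis using mollifierD(4)[OF \<phi>, of "x - y"] by (simp add: mult_left_mono)
  next
    case False
    then show ?thesis using mollifierD(5)[OF \<phi>, of "x - y"] by simp
  qed
  have "norm (LINT y|lebesgue. \<phi> (x - y) *\<^sub>R (g y - g x)) \<le> (LINT y|lebesgue. \<phi> (x - y) * e)"
    by (intro order_trans[OF integral_norm_bound] integral_mono integrable_norm integrable_mult_left i\<phi> b)
       (simp add: scaleR_diff_right i1 i2)
  also have "\<dots> = e" using one by simp
  finally show ?thesis unfolding eq .
qed

text \<open>
  The nearest point to \<open>v\<close> in the ball of radius \<open>M\<close>.
\<close>

definition clip :: "real \<Rightarrow> 'b::euclidean_space \<Rightarrow> 'b" where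
  "clip M v = (M / max M (norm v)) *\<^sub>R v"

lemma clip: assumes "M > 0"
  shows "norm (clip M v) \<le> M" "norm (clip M v) \<le> norm v" "norm v \<le> M \<Longrightarrow> clip M v = v" "continuous_on UNIV (clip M)"
proof -
  have n: "norm (clip M v) = M * norm v / max M (norm v)" using assms by (simp add: clip_def)
  show "norm (clip M v) \<le> M"
    unfolding n using assms by (simp add: divide_le_eq max_def mult_left_mono)
  show "norm (clip M v) \<le> norm v"
    unfolding n using assms by (simp add: divide_le_eq max_def mult_right_mono mult.commute)
  show "norm v \<le> M \<Longrightarrow> clip M v = v" using assms by (simp add: clip_def)
  have "max M (norm w) \<noteq> 0" for w :: 'b using assms by (auto simp: max_def)
  then show "continuous_on UNIV (clip M :: 'b \<Rightarrow> 'b)"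
    unfolding clip_def[abs_def] by (intro continuous_intros) auto
qed

text \<open>
  A Lebesgue measurable function is almost everywhere a limit of continuous functions.  Clipping them
  at a large height and multiplying by a continuous cutoff makes dominated convergence applicable.
\<close>

lemma integrable_approx_continuous:
  fixes f :: "real^3 \<Rightarrow> 'b::euclidean_space"
  assumes f: "integrable lebesgue f" and R: "\<And>y. R < norm y \<Longrightarrow> f y = 0" and e: "e > 0"
  shows "\<exists>g. continuous_on UNIV g \<and> bounded {x. g x \<noteq> 0} \<and> (LINT x|lebesgue. norm (f x - g x)) < e"
proof -
  have fm: "f \<in> borel_measurable lebesgue" using f by (rule borel_measurable_integrable)
  have clipm: "(\<lambda>x. clip M (f x)) \<in> borel_measurable lebesgue" if "M > 0" for M
    by (rule measurable_compose[OF fm borel_measurable_continuous_onI[OF clip(4)[OF that]]])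
  have "(\<lambda>n. LINT x|lebesgue. norm (f x - clip (real (Suc n)) (f x))) \<longlonglongrightarrow> (LINT x|(lebesgue :: (real^3) measure). (0 :: real))"
  proof (rule integral_dominated_convergence)
    show "(\<lambda>x. norm (f x - clip (real (Suc n)) (f x))) \<in> borel_measurable lebesgue" for n
      by (intro measurable_compose[OF borel_measurable_diff[OF fm clipm] borel_measurable_norm]) simp
    show "integrable lebesgue (\<lambda>x. 2 * norm (f x))" by (intro integrable_mult_right integrable_norm f)
    show "AE x in lebesgue. (\<lambda>n. norm (f x - clip (real (Suc n)) (f x))) \<longlonglongrightarrow> 0"
    proof (rule AE_I2)
      fix x
      obtain N where N: "norm (f x) \<le> real N" using real_arch_simple by blast
      have "\<forall>\<^sub>F n in sequentially. norm (f x - clip (real (Suc n)) (f x)) = 0"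
      proof (rule eventually_sequentiallyI[of N])
        fix n assume "N \<le> n"
        then have "norm (f x) \<le> real (Suc n)" using N by simp
        then show "norm (f x - clip (real (Suc n)) (f x)) = 0" using clip(3)[of "real (Suc n)" "f x"] by simp
      qed
      then show "(\<lambda>n. norm (f x - clip (real (Suc n)) (f x))) \<longlonglongrightarrow> 0" by (rule tendsto_eventually)
    qed
    show "AE x in lebesgue. norm (norm (f x - clip (real (Suc n)) (f x))) \<le> 2 * norm (f x)" for n
    proof (rule AE_I2)
      fix x
      show "norm (norm (f x - clip (real (Suc n)) (f x))) \<le> 2 * norm (f x)"
        using norm_triangle_ineq4[of "f x" "clip (real (Suc n)) (f x)"] clip(2)[of "real (Suc n)" "f x"] by simp
    qed
  qed simp
  then have "\<forall>\<^sub>F n in sequentially. (LINT x|lebesgue. norm (f x - clip (real (Suc n)) (f x))) < e / 2"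
    using e by (intro order_tendstoD(2)) auto
  then obtain n where n: "(LINT x|lebesgue. norm (f x - clip (real (Suc n)) (f x))) < e / 2"
    by (meson eventually_happens trivial_limit_sequentially)
  define M where "M = real (Suc n)"
  have M: "M > 0" by (simp add: M_def)
  define k where "k x = clip M (f x)" for x
  have km: "k \<in> borel_measurable lebesgue" unfolding k_def[abs_def] by (rule clipm[OF M])
  have ik: "integrable lebesgue k"
    by (rule Bochner_Integration.integrable_bound[OF f km]) (simp add: k_def clip(2)[OF M])
  have fk: "(LINT x|lebesgue. norm (f x - k x)) < e / 2" using n by (simp add: k_def M_def)
  have "f measurable_on UNIV"
    using fm measurable_on_iff_borel_measurable[of UNIV f] by simp
  then obtain N h where N: "negligible N" and ch: "\<And>i. continuous_on UNIV (h i)"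
    and h: "\<And>x. x \<notin> N \<Longrightarrow> (\<lambda>i. h i x) \<longlonglongrightarrow> f x"
    unfolding measurable_on_def by auto
  define \<theta> where "\<theta> x = max 0 (min 1 (R + 1 - norm x))" for x :: "real^3"
  have \<theta>: "0 \<le> \<theta> x" "\<theta> x \<le> 1" "norm x \<le> R \<Longrightarrow> \<theta> x = 1" "R + 1 \<le> norm x \<Longrightarrow> \<theta> x = 0" for x
    by (auto simp: \<theta>_def)
  define g where "g i x = \<theta> x *\<^sub>R clip M (h i x)" for i x
  have cg: "continuous_on UNIV (g i)" for i
  proof -
    have "continuous_on UNIV (\<lambda>x. clip M (h i x))"
      by (rule continuous_on_compose2[OF clip(4)[OF M] ch]) simp
    then show ?thesis unfolding g_def[abs_def] \<theta>_def[abs_def] by (intro continuous_intros)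
  qed
  have bg: "bounded {x. g i x \<noteq> 0}" for i
  proof (rule bounded_subset[OF bounded_cball[of 0 "R + 1"]], safe)
    fix x assume "g i x \<noteq> 0"
    then have "\<not> R + 1 \<le> norm x" using \<theta>(4)[of x] by (auto simp: g_def)
    then show "x \<in> cball 0 (R + 1)" by simp
  qed
  have "(\<lambda>i. LINT x|lebesgue. norm (k x - g i x)) \<longlonglongrightarrow> (LINT x|(lebesgue :: (real^3) measure). (0 :: real))"
  proof (rule integral_dominated_convergence)
    show "(\<lambda>x. norm (k x - g i x)) \<in> borel_measurable lebesgue" for i
      by (intro measurable_compose[OF borel_measurable_diff[OF km measurable_continuous_lebesgue[OF cg]] borel_measurable_norm])
    have "integrable lebesgue (indicator (cball 0 (R + 1)) :: real^3 \<Rightarrow> real)"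
      using emeasure_bounded_finite[OF bounded_cball, of "0 :: real^3" "R + 1"]
      by (intro integrable_real_indicator) (simp_all add: infinity_ennreal_def)
    then show "integrable lebesgue (\<lambda>x :: real^3. 2 * M * indicator (cball 0 (R + 1)) x)"
      by (rule integrable_mult_right)
    show "AE x in lebesgue. (\<lambda>i. norm (k x - g i x)) \<longlonglongrightarrow> 0"
    proof (rule AE_I')
      show "N \<in> null_sets lebesgue" using N by (simp add: negligible_iff_null_sets)
      show "{x \<in> space lebesgue. \<not> (\<lambda>i. norm (k x - g i x)) \<longlonglongrightarrow> 0} \<subseteq> N"
      proof safe
        fix x assume no: "\<not> (\<lambda>i. norm (k x - g i x)) \<longlonglongrightarrow> 0"
        show "x \<in> N"
        proof (rule ccontr)
          assume "x \<notin> N"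
          have "continuous_on UNIV (clip M :: 'b \<Rightarrow> 'b)" by (rule clip(4)[OF M])
          then have "isCont (clip M) (f x)" by (simp add: continuous_on_eq_continuous_at)
          from isCont_tendsto_compose[OF this h[OF \<open>x \<notin> N\<close>]]
          have "(\<lambda>i. \<theta> x *\<^sub>R clip M (h i x)) \<longlonglongrightarrow> \<theta> x *\<^sub>R clip M (f x)"
            by (rule tendsto_scaleR[OF tendsto_const])
          moreover have "\<theta> x *\<^sub>R clip M (f x) = k x"
          proof (cases "norm x \<le> R")
            case False
            then have "f x = 0" using R[of x] by simp
            then show ?thesis by (simp add: k_def clip_def)
          qed (simp add: k_def \<theta>)
          ultimately have "(\<lambda>i. g i x) \<longlonglongrightarrow> k x" by (simp add: g_def)
          from tendsto_norm[OF tendsto_diff[OF tendsto_const[of "k x"] this]] no show False by simp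
        qed
      qed
    qed
    show "AE x in lebesgue. norm (norm (k x - g i x)) \<le> 2 * M * indicator (cball 0 (R + 1)) x" for i
    proof (rule AE_I2)
      fix x
      show "norm (norm (k x - g i x)) \<le> 2 * M * indicator (cball 0 (R + 1)) x"
      proof (cases "norm x \<le> R + 1")
        case True
        have "norm (g i x) \<le> 1 * M"
          unfolding g_def norm_scaleR using \<theta>[of x] by (intro mult_mono clip(1)[OF M]) auto
        moreover have "norm (k x) \<le> M" unfolding k_def by (rule clip(1)[OF M])
        ultimately show ?thesis using norm_triangle_ineq4[of "k x" "g i x"] True by simp
      next
        case False
        then have "f x = 0" "\<theta> x = 0" using R[of x] \<theta>(4)[of x] by simp_all
        then show ?thesis using False by (simp add: k_def g_def clip_def)
      qed
    qed
  qed simp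
  then have "\<forall>\<^sub>F i in sequentially. (LINT x|lebesgue. norm (k x - g i x)) < e / 2"
    using e by (intro order_tendstoD(2)) auto
  then obtain i where i: "(LINT x|lebesgue. norm (k x - g i x)) < e / 2"
    by (meson eventually_happens trivial_limit_sequentially)
  have ig: "integrable lebesgue (g i)" by (rule integrable_bounded_support[OF cg bg])
  have "(LINT x|lebesgue. norm (f x - g i x)) \<le> (LINT x|lebesgue. norm (f x - k x) + norm (k x - g i x))"
    by (intro integral_mono Bochner_Integration.integrable_add integrable_norm Bochner_Integration.integrable_diff f ik ig)
       (metis diff_add_cancel diff_add_eq_diff_diff_swap norm_diff_triangle_ineq norm_triangle_sub order_refl norm_triangle_ineq add_diff_eq)
  also have "\<dots> = (LINT x|lebesgue. norm (f x - k x)) + (LINT x|lebesgue. norm (k x - g i x))"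
    by (intro Bochner_Integration.integral_add integrable_norm Bochner_Integration.integrable_diff f ik ig)
  also have "\<dots> < e" using fk i by simp
  finally show ?thesis using cg bg by blast
qed

lemma mollify_bounded_support:
  assumes \<phi>: "mollifier \<delta> \<phi>" and R: "\<And>y. R < norm y \<Longrightarrow> f y = 0"
  shows "R + \<delta> < norm x \<Longrightarrow> mollify \<phi> f x = 0" "bounded {x. mollify \<phi> f x \<noteq> 0}"
proof -
  show out: "mollify \<phi> f x = 0" if "R + \<delta> < norm x" for x
  proof (rule mollify_eq_0[OF \<phi>])
    fix y assume "norm (x - y) < \<delta>"
    moreover have "norm x \<le> norm y + norm (x - y)" by (rule norm_triangle_sub)
    ultimately show "f y = 0" using that by (intro R) linarith
  qed
  show "bounded {x. mollify \<phi> f x \<noteq> 0}"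
  proof (rule bounded_subset[OF bounded_cball[of 0 "R + \<delta>"]], safe)
    fix x assume "mollify \<phi> f x \<noteq> 0"
    then have "\<not> R + \<delta> < norm x" using out by blast
    then show "x \<in> cball 0 (R + \<delta>)" by simp
  qed
qed

lemma integrable_mollify:
  fixes f :: "real^3 \<Rightarrow> 'b::euclidean_space"
  assumes \<phi>: "mollifier \<delta> \<phi>" and f: "integrable lebesgue f" and R: "\<And>y. R < norm y \<Longrightarrow> f y = 0"
  shows "integrable lebesgue (mollify \<phi> f)"
  by (rule integrable_bounded_support[OF smooth_continuous[OF smooth_mollify[OF mollifierD(1)[OF \<phi>] f]]
        mollify_bounded_support(2)[OF \<phi> R]])

lemma mollify_diff:
  fixes f g :: "real^3 \<Rightarrow> 'b::euclidean_space"
  assumes \<phi>: "mollifier \<delta> \<phi>" and f: "integrable lebesgue f" and g: "integrable lebesgue g"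
  shows "mollify \<phi> (\<lambda>x. f x - g x) x = mollify \<phi> f x - mollify \<phi> g x"
  unfolding mollify_def
  by (subst Bochner_Integration.integral_diff[symmetric])
     (simp_all add: scaleR_diff_right mollify_integrand_integrable[OF mollifierD(8,3)[OF \<phi>]] f g)

text \<open>
  Approximate \<open>f\<close> by a continuous \<open>g\<close> of compact support: mollification contracts the error \<open>f - g\<close> and converges
  uniformly on \<open>g\<close>.
\<close>

lemma mollifier_L1_convergence:
  fixes f :: "real^3 \<Rightarrow> 'b::euclidean_space"
  assumes f: "integrable lebesgue f" and R: "\<And>y. R < norm y \<Longrightarrow> f y = 0"
    and \<phi>: "\<And>n. mollifier (\<delta> n) (\<phi> n)" and \<delta>: "\<delta> \<longlonglongrightarrow> 0"
  shows "(\<lambda>n. LINT x|lebesgue. norm (mollify (\<phi> n) f x - f x)) \<longlonglongrightarrow> 0"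
proof (rule LIMSEQ_I)
  fix e :: real assume e: "e > 0"
  obtain g where cg: "continuous_on UNIV g" and bg: "bounded {x. g x \<noteq> 0}"
    and fg: "(LINT x|lebesgue. norm (f x - g x)) < e / 3"
    using integrable_approx_continuous[OF f R, where e = "e / 3"] e by auto
  have ig: "integrable lebesgue g" by (rule integrable_bounded_support[OF cg bg])
  obtain S where "\<forall>x\<in>{x. g x \<noteq> 0}. norm x \<le> S" using bg unfolding bounded_iff by blast
  then have S: "g x = 0" if "S < norm x" for x using that by force
  define B where "B = cball (0 :: real^3) (S + 1)"
  define V where "V = measure lebesgue B"
  have V: "V \<ge> 0" by (simp add: V_def)
  have ib: "integrable lebesgue (indicator B :: real^3 \<Rightarrow> real)"
    using emeasure_bounded_finite[OF bounded_cball, of "0 :: real^3" "S + 1"]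
    unfolding B_def by (intro integrable_real_indicator) (simp_all add: infinity_ennreal_def)
  define e' where "e' = e / (3 * (V + 1))"
  have e': "e' > 0" using e V by (simp add: e'_def)
  obtain d where d: "d > 0" and gd: "\<And>x v. norm v < d \<Longrightarrow> norm (g (x + v) - g x) < e'"
    using uniformly_continuous_bounded_support[OF cg bg e'] by blast
  obtain N where N: "\<And>n. n \<ge> N \<Longrightarrow> \<bar>\<delta> n\<bar> < min d 1"
    using LIMSEQ_D[OF \<delta>, of "min d 1"] d by auto
  have "norm ((LINT x|lebesgue. norm (mollify (\<phi> n) f x - f x)) - 0) < e" if n: "n \<ge> N" for n
  proof -
    let ?c = "mollify (\<phi> n)"
    have \<delta>n: "\<delta> n < d" "\<delta> n < 1" using N[OF n] by auto
    have i1: "integrable lebesgue (?c f)" by (rule integrable_mollify[OF \<phi> f R])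
    have i2: "integrable lebesgue (?c g)" by (rule integrable_mollify[OF \<phi> ig S])
    have ifg: "integrable lebesgue (\<lambda>x. f x - g x)" by (rule Bochner_Integration.integrable_diff[OF f ig])
    have ic: "integrable lebesgue (?c (\<lambda>x. f x - g x))"
      by (rule integrable_mollify[OF \<phi> ifg, of "max R S"]) (simp add: R S)
    have contr: "(LINT x|lebesgue. norm (?c (\<lambda>x. f x - g x) x)) \<le> (LINT x|lebesgue. norm (f x - g x))"
    proof -
      have "ennreal (LINT x|lebesgue. norm (?c (\<lambda>x. f x - g x) x)) = (\<integral>\<^sup>+x. ennreal (norm (?c (\<lambda>x. f x - g x) x)) \<partial>lebesgue)"
        by (rule nn_integral_eq_integral[symmetric, OF integrable_norm[OF ic]]) simp
      also have "\<dots> \<le> (\<integral>\<^sup>+x. ennreal (norm (f x - g x)) \<partial>lebesgue)"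
        by (rule mollify_L1_contraction[OF \<phi> ifg])
      also have "\<dots> = ennreal (LINT x|lebesgue. norm (f x - g x))"
        by (rule nn_integral_eq_integral[OF integrable_norm[OF ifg]]) simp
      finally show ?thesis by (simp add: ennreal_le_iff)
    qed
    have close: "norm (?c g x - g x) \<le> e' * indicator B x" for x
    proof (cases "norm x \<le> S + 1")
      case True
      have "norm (?c g x - g x) \<le> e'"
        using gd \<delta>n by (intro mollify_uniform_close[OF \<phi> ig] less_imp_le) auto
      then show ?thesis using True by (simp add: B_def)
    next
      case False
      then have "S + \<delta> n < norm x" using \<delta>n by linarith
      then have "?c g x = 0" by (rule mollify_bounded_support(1)[OF \<phi>, of S, rotated]) (rule S)
      moreover have "g x = 0" using False by (intro S) linarith
      ultimately show ?thesis using e' by simp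
    qed
    have pw: "norm (?c f x - f x) \<le> norm (?c (\<lambda>x. f x - g x) x) + e' * indicator B x + norm (f x - g x)" for x
    proof -
      have "?c f x - f x = ?c (\<lambda>x. f x - g x) x + (?c g x - g x) - (f x - g x)"
        by (simp add: mollify_diff[OF \<phi> f ig])
      also have "norm \<dots> \<le> norm (?c (\<lambda>x. f x - g x) x) + norm (?c g x - g x) + norm (f x - g x)"
        by (intro order_trans[OF norm_triangle_ineq4] add_right_mono norm_triangle_ineq)
      finally show ?thesis using close[of x] by linarith
    qed
    have "(LINT x|lebesgue. norm (?c f x - f x)) \<le> (LINT x|lebesgue. norm (?c (\<lambda>x. f x - g x) x) + e' * indicator B x + norm (f x - g x))"
      by (intro integral_mono Bochner_Integration.integrable_add integrable_norm integrable_mult_right ib ic ifg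
          Bochner_Integration.integrable_diff i1 f pw)
    also have "\<dots> = (LINT x|lebesgue. norm (?c (\<lambda>x. f x - g x) x)) + e' * V + (LINT x|lebesgue. norm (f x - g x))"
      using ib ic ifg by (simp add: Bochner_Integration.integral_add V_def)
    also have "e' * V \<le> e / 3"
      using V e by (simp add: e'_def field_simps)
    finally have "(LINT x|lebesgue. norm (?c f x - f x)) < e"
      using contr fg by linarith
    moreover have "(LINT x|lebesgue. norm (?c f x - f x)) \<ge> 0" by simp
    ultimately show ?thesis by simp
  qed
  then show "\<exists>no. \<forall>n\<ge>no. norm ((LINT x|lebesgue. norm (mollify (\<phi> n) f x - f x)) - 0) < e" by blast
qed

section \<open>Cutting off a weakly differentiable spinor field\<close>

lemma locally_integrable_mult:
  assumes f: "locally_integrable f" and c: "continuous_on UNIV \<eta>" and b: "bounded {x. \<eta> x \<noteq> 0}"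
  shows "integrable lebesgue (\<lambda>x. \<eta> x *\<^sub>R f x)"
proof -
  obtain R where "\<forall>x\<in>{x. \<eta> x \<noteq> 0}. norm x \<le> R" using b unfolding bounded_iff by blast
  then have R: "\<eta> x = 0" if "x \<notin> cball 0 R" for x using that by force
  obtain M where M: "\<And>x. norm (\<eta> x) \<le> M" using bounded_continuous_support[OF c b] by blast
  define h where "h x = indicat_real (cball 0 R) x *\<^sub>R f x" for x
  have i: "integrable lebesgue h"
    unfolding h_def[abs_def]
    by (rule f[unfolded locally_integrable_def set_integrable_def, rule_format, OF compact_cball])
  have eq: "\<eta> x *\<^sub>R f x = \<eta> x *\<^sub>R h x" for x
  proof (cases "x \<in> cball 0 R")
    case True
    then show ?thesis by (simp only: h_def indicator_simps scaleR_one)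
  next
    case False
    then have "\<eta> x = 0" by (rule R)
    then show ?thesis by (simp only: scaleR_zero_left)
  qed
  have "integrable lebesgue (\<lambda>x. \<eta> x *\<^sub>R h x)"
  proof (rule Bochner_Integration.integrable_bound)
    show "integrable lebesgue (\<lambda>x. M *\<^sub>R h x)" using i by simp
    show "(\<lambda>x. \<eta> x *\<^sub>R h x) \<in> borel_measurable lebesgue"
      by (rule borel_measurable_scaleR[OF measurable_continuous_lebesgue[OF c] borel_measurable_integrable[OF i]])
    have "norm (\<eta> x *\<^sub>R h x) \<le> norm (M *\<^sub>R h x)" for x
      using M[of x] by (simp add: mult_right_mono)
    then show "AE x in lebesgue. norm (\<eta> x *\<^sub>R h x) \<le> norm (M *\<^sub>R h x)"
      by simp
  qed
  then show ?thesis by (simp only: eq)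
qed

lemma mollify_add:
  fixes f g :: "real^3 \<Rightarrow> 'b::euclidean_space"
  assumes \<phi>: "mollifier \<delta> \<phi>" and f: "integrable lebesgue f" and g: "integrable lebesgue g"
  shows "mollify \<phi> (\<lambda>x. f x + g x) x = mollify \<phi> f x + mollify \<phi> g x"
  unfolding mollify_def
  by (subst Bochner_Integration.integral_add[symmetric])
     (simp_all add: scaleR_add_right mollify_integrand_integrable[OF mollifierD(8,3)[OF \<phi>]] f g)

lemma mollify_sum:
  fixes f :: "'i \<Rightarrow> real^3 \<Rightarrow> 'b::euclidean_space"
  assumes \<phi>: "mollifier \<delta> \<phi>" and f: "\<And>k. integrable lebesgue (f k)"
  shows "mollify \<phi> (\<lambda>x. \<Sum>k\<in>I. f k x) x = (\<Sum>k\<in>I. mollify \<phi> (f k) x)"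
  unfolding mollify_def
  by (subst Bochner_Integration.integral_sum[symmetric])
     (simp_all add: scaleR_sum_right mollify_integrand_integrable[OF mollifierD(8,3)[OF \<phi>]] f)

lemma mollify_bounded_linear:
  fixes f :: "real^3 \<Rightarrow> 'b::euclidean_space" and L :: "'b \<Rightarrow> 'c::euclidean_space"
  assumes \<phi>: "mollifier \<delta> \<phi>" and f: "integrable lebesgue f" and L: "bounded_linear L"
  shows "mollify \<phi> (\<lambda>x. L (f x)) x = L (mollify \<phi> f x)"
proof -
  have "L (mollify \<phi> f x) = (LINT y|lebesgue. L (\<phi> (x - y) *\<^sub>R f y))"
    unfolding mollify_def
    by (rule integral_bounded_linear[OF L mollify_integrand_integrable[OF mollifierD(8,3)[OF \<phi>] f], symmetric])
  then show ?thesis by (simp add: mollify_def linear_scale[OF bounded_linear.linear[OF L]])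
qed

text \<open>
  For fixed \<open>x\<close> the function \<open>\<phi> (x - y) \<eta> y\<close> of \<open>y\<close> is an admissible test function in the definition of
  the weak derivative.
\<close>

lemma partial_mollify_weak:
  fixes \<psi> :: "real^3 \<Rightarrow> complex^4"
  assumes \<phi>: "mollifier \<delta> \<phi>" and \<eta>: "test_function \<eta>" and w: "has_weak_partial k \<psi> g"
  shows "partial k (mollify \<phi> (\<lambda>y. \<eta> y *\<^sub>R \<psi> y)) x
      = mollify \<phi> (\<lambda>y. partial k \<eta> y *\<^sub>R \<psi> y + \<eta> y *\<^sub>R g y) x"
proof -
  have loc: "locally_integrable \<psi>" "locally_integrable g"
    and byparts: "\<And>\<theta>. test_function \<theta> \<Longrightarrow>
      (LINT x|lebesgue. partial k \<theta> x *\<^sub>R \<psi> x) = - (LINT x|lebesgue. \<theta> x *\<^sub>R g x)"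
    using w by (auto simp: has_weak_partial_def)
  have s\<eta>: "smooth \<eta>" and b\<eta>: "bounded {x. \<eta> x \<noteq> 0}" using \<eta> by (auto simp: test_function_iff)
  note c\<eta> = smooth_continuous[OF s\<eta>] and cp\<eta> = smooth_continuous[OF smooth_partial[OF s\<eta>]]
  have i1: "integrable lebesgue (\<lambda>y. \<eta> y *\<^sub>R \<psi> y)" by (rule locally_integrable_mult[OF loc(1) c\<eta> b\<eta>])
  have i2: "integrable lebesgue (\<lambda>y. partial k \<eta> y *\<^sub>R \<psi> y)"
    by (rule locally_integrable_mult[OF loc(1) cp\<eta> bounded_support_partial[OF b\<eta>]])
  have i3: "integrable lebesgue (\<lambda>y. \<eta> y *\<^sub>R g y)" by (rule locally_integrable_mult[OF loc(2) c\<eta> b\<eta>])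
  note \<phi>t = mollifierD(1)[OF \<phi>] and s\<phi> = mollifierD(2)[OF \<phi>]
  define \<theta> where "\<theta> y = \<phi> (x - y) * \<eta> y" for y
  have s\<theta>: "smooth \<theta>" unfolding \<theta>_def[abs_def] by (rule smooth_mult[OF smooth_reflect(1)[OF s\<phi>] s\<eta>])
  have "bounded {y. \<theta> y \<noteq> 0}" by (rule bounded_subset[OF b\<eta>]) (auto simp: \<theta>_def)
  with s\<theta> have t\<theta>: "test_function \<theta>" by (simp add: test_function_iff)
  have p\<theta>: "partial k \<theta> y = \<phi> (x - y) * partial k \<eta> y - partial k \<phi> (x - y) * \<eta> y" for y
    unfolding \<theta>_def[abs_def]
    using partial_eq[OF has_derivative_mult[OF smooth_derivative[OF smooth_reflect(1)[OF s\<phi>]] smooth_derivative[OF s\<eta>]], of k]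
    by (simp add: smooth_reflect(2)[OF s\<phi>] sum_negf)
  have j: "integrable lebesgue (\<lambda>y. \<phi>' (x - y) *\<^sub>R f y)" if "test_function \<phi>'" "integrable lebesgue f" for \<phi>' and f :: "real^3 \<Rightarrow> complex^4"
    using that by (intro mollify_integrand_integrable) (auto simp: test_function_iff smooth_continuous)
  have "(LINT y|lebesgue. partial k \<theta> y *\<^sub>R \<psi> y)
     = (LINT y|lebesgue. \<phi> (x - y) *\<^sub>R (partial k \<eta> y *\<^sub>R \<psi> y) - partial k \<phi> (x - y) *\<^sub>R (\<eta> y *\<^sub>R \<psi> y))"
    by (simp add: p\<theta> scaleR_diff_left)
  also have "\<dots> = mollify \<phi> (\<lambda>y. partial k \<eta> y *\<^sub>R \<psi> y) x - mollify (partial k \<phi>) (\<lambda>y. \<eta> y *\<^sub>R \<psi> y) x"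
    unfolding mollify_def
    by (rule Bochner_Integration.integral_diff[OF j[OF \<phi>t i2] j[OF test_function_partial[OF \<phi>t] i1]])
  finally have "mollify \<phi> (\<lambda>y. partial k \<eta> y *\<^sub>R \<psi> y) x - mollify (partial k \<phi>) (\<lambda>y. \<eta> y *\<^sub>R \<psi> y) x
      = - mollify \<phi> (\<lambda>y. \<eta> y *\<^sub>R g y) x"
    using byparts[OF t\<theta>] by (simp add: \<theta>_def mollify_def)
  then have "mollify (partial k \<phi>) (\<lambda>y. \<eta> y *\<^sub>R \<psi> y) x
      = mollify \<phi> (\<lambda>y. partial k \<eta> y *\<^sub>R \<psi> y) x + mollify \<phi> (\<lambda>y. \<eta> y *\<^sub>R g y) x"
    by (simp add: algebra_simps)
  then show ?thesis
    unfolding partial_mollify[OF \<phi>t i1] mollify_add[OF \<phi> i2 i3] .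
qed

definition i_alpha :: "3 \<Rightarrow> complex^4 \<Rightarrow> complex^4" where
  "i_alpha k v = \<i> *s (dirac_alpha k *v v)"

lemma bounded_linear_i_alpha: "bounded_linear (i_alpha k)"
  unfolding i_alpha_def[abs_def] linear_conv_bounded_linear[symmetric]
  by (rule linear_compose[OF dirac.lin linear_i_vec, unfolded o_def])

lemma bounded_linear_lower_order: "bounded_linear (lower_order m c)"
  by (simp add: linear_lower_order flip: linear_conv_bounded_linear)

lemma shifted_dirac_i_alpha: "shifted_dirac m c \<psi> D x = (\<Sum>k\<in>UNIV. i_alpha k (D k x)) + lower_order m c (\<psi> x)"
  by (simp add: shifted_dirac_split i_alpha_def linear_sum[OF linear_i_vec])

text \<open>
  The operator applied to the product of the cutoff and the field.
\<close>

definition cutoff_dirac :: "real \<Rightarrow> complex \<Rightarrow> (real^3 \<Rightarrow> real) \<Rightarrow> (real^3 \<Rightarrow> complex^4) \<Rightarrow>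
     (3 \<Rightarrow> real^3 \<Rightarrow> complex^4) \<Rightarrow> real^3 \<Rightarrow> complex^4" where
  "cutoff_dirac m c \<eta> \<psi> D x = \<eta> x *\<^sub>R shifted_dirac m c \<psi> D x + (\<Sum>k\<in>UNIV. partial k \<eta> x *\<^sub>R i_alpha k (\<psi> x))"

text \<open>
  The operator has constant coefficients, so it commutes with mollification.
\<close>

lemma shifted_dirac_mollify:
  fixes \<psi> :: "real^3 \<Rightarrow> complex^4"
  assumes \<phi>: "mollifier \<delta> \<phi>" and \<eta>: "test_function \<eta>" and w: "\<And>k. has_weak_partial k \<psi> (D k)"
  defines "f \<equiv> \<lambda>y. \<eta> y *\<^sub>R \<psi> y"
  shows "shifted_dirac m c (mollify \<phi> f) (\<lambda>k. partial k (mollify \<phi> f)) x = mollify \<phi> (cutoff_dirac m c \<eta> \<psi> D) x"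
    and "integrable lebesgue (cutoff_dirac m c \<eta> \<psi> D)" and "integrable lebesgue f"
proof -
  have s\<eta>: "smooth \<eta>" and b\<eta>: "bounded {x. \<eta> x \<noteq> 0}" using \<eta> by (auto simp: test_function_iff)
  note c\<eta> = smooth_continuous[OF s\<eta>] and cp\<eta> = smooth_continuous[OF smooth_partial[OF s\<eta>]]
  have loc: "locally_integrable \<psi>" "locally_integrable (D k)" for k
    using w by (auto simp: has_weak_partial_def)
  have i1: "integrable lebesgue f" unfolding f_def by (rule locally_integrable_mult[OF loc(1) c\<eta> b\<eta>])
  have i2: "integrable lebesgue (\<lambda>y. partial k \<eta> y *\<^sub>R \<psi> y)" for k
    by (rule locally_integrable_mult[OF loc(1) cp\<eta> bounded_support_partial[OF b\<eta>]])
  have i3: "integrable lebesgue (\<lambda>y. \<eta> y *\<^sub>R D k y)" for k by (rule locally_integrable_mult[OF loc(2) c\<eta> b\<eta>])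
  define g where "g k y = partial k \<eta> y *\<^sub>R \<psi> y + \<eta> y *\<^sub>R D k y" for k y
  have ig: "integrable lebesgue (g k)" for k
    unfolding g_def[abs_def] by (rule Bochner_Integration.integrable_add[OF i2 i3])
  note La = bounded_linear_i_alpha and Ll = bounded_linear_lower_order[of m c]
  have F: "cutoff_dirac m c \<eta> \<psi> D = (\<lambda>y. (\<Sum>k\<in>UNIV. i_alpha k (g k y)) + lower_order m c (f y))"
    by (simp add: fun_eq_iff cutoff_dirac_def shifted_dirac_i_alpha g_def f_def sum.distrib scaleR_add_right
        scaleR_sum_right linear_add[OF bounded_linear.linear[OF La]] linear_scale[OF bounded_linear.linear[OF La]]
        linear_scale[OF bounded_linear.linear[OF Ll]])
  have ia: "integrable lebesgue (\<lambda>y. i_alpha k (g k y))" for k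
    by (rule integrable_bounded_linear[OF La ig])
  have il: "integrable lebesgue (\<lambda>y. lower_order m c (f y))"
    by (rule integrable_bounded_linear[OF Ll i1])
  have isum: "integrable lebesgue (\<lambda>y. \<Sum>k\<in>UNIV. i_alpha k (g k y))"
    by (rule Bochner_Integration.integrable_sum[OF ia])
  show "integrable lebesgue (cutoff_dirac m c \<eta> \<psi> D)"
    unfolding F by (rule Bochner_Integration.integrable_add[OF isum il])
  show "integrable lebesgue f" by (rule i1)
  have "mollify \<phi> (cutoff_dirac m c \<eta> \<psi> D) x = (\<Sum>k\<in>UNIV. i_alpha k (mollify \<phi> (g k) x)) + lower_order m c (mollify \<phi> f x)"
    unfolding F mollify_add[OF \<phi> isum il] mollify_sum[OF \<phi> ia] mollify_bounded_linear[OF \<phi> ig La] mollify_bounded_linear[OF \<phi> i1 Ll] ..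
  moreover have "partial k (mollify \<phi> f) x = mollify \<phi> (g k) x" for k
    unfolding f_def g_def[abs_def] by (rule partial_mollify_weak[OF \<phi> \<eta> w])
  ultimately show "shifted_dirac m c (mollify \<phi> f) (\<lambda>k. partial k (mollify \<phi> f)) x = mollify \<phi> (cutoff_dirac m c \<eta> \<psi> D) x"
    by (simp add: shifted_dirac_i_alpha)
qed

text \<open>
  The mollified product is a test function vanishing near the origin, so the inequality holds for it.  On
  the support of \<open>\<eta>\<close> the weight is at least \<open>\<rho>\<close>, hence the error \<open>\<delta>\<close> in the weight costs only a factor \<open>1 + \<delta> / \<rho>\<close>.
  Along a subsequence the mollified fields converge almost everywhere.
\<close>

lemma cutoff_hardy:
  fixes \<psi> :: "real^3 \<Rightarrow> complex^4"
  assumes \<eta>: "test_function \<eta>" and \<rho>: "\<rho> > 0" "\<And>x. norm x < \<rho> \<Longrightarrow> \<eta> x = 0"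
    and w: "\<And>k. has_weak_partial k \<psi> (D k)" and c: "Re c = 0"
  shows "(\<integral>\<^sup>+x. ennreal ((norm (\<eta> x *\<^sub>R \<psi> x))\<^sup>2 / norm x) \<partial>lebesgue)
     \<le> weighted_energy (cutoff_dirac m c \<eta> \<psi> D)"
proof -
  define \<delta> where "\<delta> n = \<rho> / 2 * inverse (real (Suc n))" for n
  have \<delta>0: "\<delta> n > 0" "\<delta> n \<le> \<rho> / 2" for n
    using \<rho>(1) mult_left_mono[of "inverse (real (Suc n))" 1 "\<rho> / 2"] by (simp_all add: \<delta>_def inverse_le_1_iff)
  have \<delta>l: "\<delta> \<longlonglongrightarrow> 0"
    unfolding \<delta>_def[abs_def] using tendsto_mult_right_zero[OF LIMSEQ_inverse_real_of_nat] by simp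
  have "\<exists>\<phi>. \<forall>n. mollifier (\<delta> n) (\<phi> n)" using mollifier_exists[OF \<delta>0(1)] by (intro choice allI)
  then obtain \<phi> where \<phi>: "\<And>n. mollifier (\<delta> n) (\<phi> n)" by blast
  define f where "f y = \<eta> y *\<^sub>R \<psi> y" for y
  define G where "G = cutoff_dirac m c \<eta> \<psi> D"
  have b\<eta>: "bounded {x. \<eta> x \<noteq> 0}" using \<eta> by (simp add: test_function_iff)
  note sc = shifted_dirac_mollify(1)[OF \<phi> \<eta> w, where m = m and c = c, folded f_def[abs_def] G_def]
    and iG = shifted_dirac_mollify(2)[OF \<phi> \<eta> w, where m = m and c = c, folded G_def]
    and iff = shifted_dirac_mollify(3)[OF \<phi> \<eta> w, folded f_def[abs_def]]
  obtain R where "\<forall>x\<in>{x. \<eta> x \<noteq> 0}. norm x \<le> R" using b\<eta> unfolding bounded_iff by blast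
  then have R: "f x = 0" if "R < norm x" for x using that unfolding f_def by force
  have near: "partial k \<eta> x = 0" if "norm x < \<rho>" for x k
    using partial_cong_open[of "ball 0 \<rho>" x \<eta> "\<lambda>_. 0" k] \<rho> that by simp
  have G0: "G x = 0" if "norm x < \<rho>" for x
    using near[OF that] \<rho>(2)[OF that] by (simp add: G_def cutoff_dirac_def)
  let ?K = "weighted_energy G"
  have bound: "(\<integral>\<^sup>+x. ennreal ((norm (mollify (\<phi> n) f x))\<^sup>2 / norm x) \<partial>lebesgue) \<le> ennreal (1 + \<delta> n / \<rho>) * ?K" for n
  proof -
    let ?u = "mollify (\<phi> n) f"
    have tu: "test_function ?u"
      by (simp add: test_function_iff smooth_mollify[OF mollifierD(1)[OF \<phi>] iff] mollify_bounded_support(2)[OF \<phi> R])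
    interpret origin_free_spinor ?u "\<rho> / 2"
    proof
      show "test_function ?u" by (rule tu)
      show "\<rho> / 2 > 0" using \<rho> by simp
      fix x :: "real^3" assume x: "norm x < \<rho> / 2"
      show "?u x = 0"
      proof (rule mollify_eq_0[OF \<phi>])
        fix y assume y: "norm (x - y) < \<delta> n"
        have "norm y \<le> norm x + norm (x - y)" using norm_triangle_sub[of y x] by (simp add: norm_minus_commute)
        then have "norm y < \<rho>" using x y \<delta>0(2)[of n] by linarith
        then show "f y = 0" by (simp add: f_def \<rho>)
      qed
    qed
    have "coulomb_energy ?u
       \<le> weighted_energy (shifted_dirac m c ?u (\<lambda>k. partial k ?u))"
      by (rule hardy[OF c])
    also have "\<dots> = weighted_energy (mollify (\<phi> n) G)"
      unfolding sc ..
    also have "\<dots> \<le> (\<integral>\<^sup>+x. ennreal ((norm x + \<delta> n) * (norm (G x))\<^sup>2) \<partial>lebesgue)"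
      by (rule weighted_energy_mollify_le[OF \<phi> iG])
    also have "\<dots> \<le> (\<integral>\<^sup>+x. ennreal (1 + \<delta> n / \<rho>) * ennreal (norm x * (norm (G x))\<^sup>2) \<partial>lebesgue)"
    proof (rule nn_integral_mono)
      fix x :: "real^3"
      have "(norm x + \<delta> n) * (norm (G x))\<^sup>2 \<le> (1 + \<delta> n / \<rho>) * (norm x * (norm (G x))\<^sup>2)"
      proof (cases "norm x < \<rho>")
        case False
        then have "\<delta> n * 1 \<le> \<delta> n * (norm x / \<rho>)" using \<delta>0(1)[of n] \<rho>(1) by (intro mult_left_mono) auto
        then have "norm x + \<delta> n \<le> (1 + \<delta> n / \<rho>) * norm x" by (simp add: algebra_simps)
        then have "(norm x + \<delta> n) * (norm (G x))\<^sup>2 \<le> (1 + \<delta> n / \<rho>) * norm x * (norm (G x))\<^sup>2"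
          by (rule mult_right_mono) simp
        then show ?thesis by (simp only: mult.assoc)
      qed (simp add: G0)
      moreover have "0 \<le> 1 + \<delta> n / \<rho>" using \<delta>0(1)[of n] \<rho>(1) by simp
      ultimately show "ennreal ((norm x + \<delta> n) * (norm (G x))\<^sup>2) \<le> ennreal (1 + \<delta> n / \<rho>) * ennreal (norm x * (norm (G x))\<^sup>2)"
        by (simp add: ennreal_leI flip: ennreal_mult)
    qed
    also have "\<dots> = ennreal (1 + \<delta> n / \<rho>) * ?K"
      by (intro nn_integral_cmult measurable_compose[OF _ measurable_ennreal] borel_measurable_times borel_measurable_power
          borel_measurable_integrable[OF integrable_norm[OF iG]] measurable_continuous_lebesgue continuous_on_norm_id)
    finally show ?thesis .
  qed
  have iu: "integrable lebesgue (mollify (\<phi> n) f)" for n by (rule integrable_mollify[OF \<phi> iff R])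
  have "\<exists>r::nat\<Rightarrow>nat. strict_mono r \<and> (AE x in lebesgue. (\<lambda>n. mollify (\<phi> (r n)) f x - f x) \<longlonglongrightarrow> 0)"
    by (rule tendsto_L1_AE_subseq[OF Bochner_Integration.integrable_diff[OF iu iff] mollifier_L1_convergence[OF iff R \<phi> \<delta>l]])
  then obtain r where r: "strict_mono r" and ae: "AE x in lebesgue. (\<lambda>n. mollify (\<phi> (r n)) f x - f x) \<longlonglongrightarrow> 0" by blast
  let ?U = "\<lambda>n x. ennreal ((norm (mollify (\<phi> (r n)) f x))\<^sup>2 / norm x)"
  have "coulomb_energy f \<le> (\<integral>\<^sup>+x. liminf (\<lambda>n. ?U n x) \<partial>lebesgue)"
  proof (rule nn_integral_mono_AE, use ae in eventually_elim)
    fix x assume l: "(\<lambda>n. mollify (\<phi> (r n)) f x - f x) \<longlonglongrightarrow> 0"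
    then have "(\<lambda>n. mollify (\<phi> (r n)) f x) \<longlonglongrightarrow> f x" by (rule LIM_zero_cancel)
    then have "(\<lambda>n. (norm (mollify (\<phi> (r n)) f x))\<^sup>2 / norm x) \<longlonglongrightarrow> (norm (f x))\<^sup>2 / norm x"
      unfolding divide_inverse by (intro tendsto_mult tendsto_power tendsto_norm tendsto_const)
    then have "(\<lambda>n. ?U n x) \<longlonglongrightarrow> ennreal ((norm (f x))\<^sup>2 / norm x)" by (rule tendsto_ennrealI)
    then have "liminf (\<lambda>n. ?U n x) = ennreal ((norm (f x))\<^sup>2 / norm x)"
      by (intro lim_imp_Liminf) simp_all
    then show "ennreal ((norm (f x))\<^sup>2 / norm x) \<le> liminf (\<lambda>n. ?U n x)" by simp
  qed
  also have "\<dots> \<le> liminf (\<lambda>n. \<integral>\<^sup>+x. ?U n x \<partial>lebesgue)"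
    by (intro nn_integral_liminf measurable_compose[OF _ measurable_ennreal] borel_measurable_divide borel_measurable_power
          borel_measurable_integrable[OF integrable_norm[OF iu]] measurable_continuous_lebesgue continuous_on_norm_id)
  also have "\<dots> \<le> liminf (\<lambda>n. ennreal (1 + \<delta> (r n) / \<rho>) * ?K)"
    by (intro Liminf_mono always_eventually allI bound)
  also have "\<dots> = ?K"
  proof (rule lim_imp_Liminf)
    have "(\<lambda>n. \<delta> (r n)) \<longlonglongrightarrow> 0" using LIMSEQ_subseq_LIMSEQ[OF \<delta>l r] by (simp add: o_def)
    then have "(\<lambda>n. 1 + \<delta> (r n) / \<rho>) \<longlonglongrightarrow> 1 + 0 / \<rho>"
      using \<rho>(1) by (intro tendsto_add tendsto_const tendsto_divide) auto
    then have "(\<lambda>n. ennreal (1 + \<delta> (r n) / \<rho>)) \<longlonglongrightarrow> ennreal 1" by (intro tendsto_ennrealI) simp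
    then have "(\<lambda>n. ennreal (1 + \<delta> (r n) / \<rho>) * ?K) \<longlonglongrightarrow> ennreal 1 * ?K"
      by (intro tendsto_mult_ennreal tendsto_const) auto
    then show "(\<lambda>n. ennreal (1 + \<delta> (r n) / \<rho>) * ?K) \<longlonglongrightarrow> ?K" by simp
  qed simp
  finally show ?thesis by (simp add: f_def G_def)
qed

section \<open>Removing the cutoff\<close>

definition flat_exp_deriv :: "real \<Rightarrow> real" where
  "flat_exp_deriv s = (if s \<le> 0 then 0 else exp (- (1 / s)) / s\<^sup>2)"

lemma flat_exp_has_derivative: "(flat_exp has_real_derivative flat_exp_deriv s) (at s)"
proof (cases s "0 :: real" rule: linorder_cases)
  case less
  have "((\<lambda>_. 0) has_real_derivative 0) (at s)" by simp
  then have "(flat_exp has_real_derivative 0) (at s)"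
    by (rule has_field_derivative_transform_within_open[where S = "{..<0}"]) (use less in \<open>auto simp: flat_exp_def\<close>)
  then show ?thesis using less by (simp add: flat_exp_deriv_def)
next
  case greater
  have "((\<lambda>t. 1 / t) has_real_derivative - (1 / s\<^sup>2)) (at s)"
    using greater by (auto intro!: derivative_eq_intros simp: power2_eq_square)
  from DERIV_chain2[OF DERIV_exp DERIV_minus[OF this]]
  have "((\<lambda>t. exp (- (1 / t))) has_real_derivative flat_exp_deriv s) (at s)"
    using greater by (simp add: flat_exp_deriv_def)
  then show ?thesis
    by (rule has_field_derivative_transform_within_open[where S = "{0<..}"]) (use greater in \<open>auto simp: flat_exp_def\<close>)
next
  case equal
  obtain d where d: "d 0 = flat_exp" "\<forall>n. \<forall>t\<in>UNIV. (d n has_real_derivative d (Suc n) t) (at t)"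
    using smooth_real_on_flat_exp unfolding smooth_real_on_def by blast
  have D: "(flat_exp has_real_derivative d (Suc 0) 0) (at 0)"
    using d(2)[rule_format, OF UNIV_I, of 0 0] unfolding d(1) .
  have "d (Suc 0) 0 = 0"
    by (rule DERIV_local_min[OF D, of 1]) (auto simp: flat_exp_def)
  then show ?thesis using D by (simp add: equal flat_exp_deriv_def)
qed

lemma flat_exp_deriv_nonneg: "0 \<le> flat_exp_deriv s" by (simp add: flat_exp_deriv_def)

lemma exp_quadratic: "u \<ge> 0 \<Longrightarrow> u + u\<^sup>2 \<le> 2 * exp (u :: real)"
  using exp_lower_Taylor_quadratic[of u] by (simp add: power2_eq_square field_simps)

text \<open>
  In terms of \<open>u = 1 / s\<close> both follow from \<open>u + u\<^sup>2 \<le> 2 exp u\<close>.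
\<close>

lemma flat_exp_deriv_bounds:
  shows "(s + 1) * flat_exp_deriv s \<le> 2" "flat_exp_deriv s \<le> 2"
proof -
  have *: "(s + 1) * flat_exp_deriv s \<le> 2 \<and> flat_exp_deriv s \<le> 2" if "s > 0"
  proof -
    define u where "u = 1 / s"
    have u: "u > 0" using that by (simp add: u_def)
    have fd: "flat_exp_deriv s = u\<^sup>2 * exp (- u)"
      using that by (simp add: flat_exp_deriv_def u_def power_divide)
    have su: "s * u = 1" using that by (simp add: u_def)
    have "(s + 1) * u\<^sup>2 = u + u\<^sup>2"
      using su by (simp add: algebra_simps power2_eq_square)
    then have "(s + 1) * flat_exp_deriv s = (u + u\<^sup>2) * exp (- u)"
      unfolding fd by (simp flip: mult.assoc)
    moreover have "(u + u\<^sup>2) * exp (- u) \<le> 2 * exp u * exp (- u)"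
      using u by (intro mult_right_mono exp_quadratic) auto
    moreover have "u\<^sup>2 * exp (- u) \<le> (u + u\<^sup>2) * exp (- u)"
      using u by (intro mult_right_mono) auto
    moreover have "2 * exp u * exp (- u) = 2" by (simp add: exp_minus)
    moreover note fd
    ultimately show ?thesis by linarith
  qed
  show "(s + 1) * flat_exp_deriv s \<le> 2" "flat_exp_deriv s \<le> 2"
    using * by (cases "s > 0"; simp add: flat_exp_deriv_def)+
qed

lemma flat_exp_tendsto_1: "(flat_exp \<longlongrightarrow> 1) at_top"
proof -
  have "((\<lambda>s. exp (- inverse s)) \<longlongrightarrow> exp (- 0)) (at_top :: real filter)"
    by (intro tendsto_exp tendsto_minus tendsto_inverse_0_at_top filterlim_ident)
  then have "((\<lambda>s. exp (- inverse s)) \<longlongrightarrow> 1) (at_top :: real filter)" by simp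
  then show ?thesis
    by (rule Lim_transform_eventually)
       (auto intro!: eventually_mono[OF eventually_gt_at_top[of 0]] simp: flat_exp_def inverse_eq_divide)
qed

lemma flat_exp_deriv_tendsto_0: "((\<lambda>s. (s + 1) * flat_exp_deriv s) \<longlongrightarrow> 0) at_top"
proof -
  have "((\<lambda>s. (inverse s + (inverse s)\<^sup>2) * exp (- inverse s)) \<longlongrightarrow> (0 + 0\<^sup>2) * exp (- 0)) (at_top :: real filter)"
    by (intro tendsto_mult tendsto_add tendsto_power tendsto_exp tendsto_minus tendsto_inverse_0_at_top filterlim_ident)
  then have "((\<lambda>s. (inverse s + (inverse s)\<^sup>2) * exp (- inverse s)) \<longlongrightarrow> 0) (at_top :: real filter)" by simp
  then show ?thesis
  proof (rule Lim_transform_eventually)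
    have "(inverse s + (inverse s)\<^sup>2) * exp (- inverse s) = (s + 1) * flat_exp_deriv s" if "s > 0" for s
      using that by (simp add: flat_exp_deriv_def inverse_eq_divide field_simps power2_eq_square)
    then show "\<forall>\<^sub>F s in at_top. (inverse s + (inverse s)\<^sup>2) * exp (- inverse s) = (s + 1) * flat_exp_deriv s"
      by (intro eventually_mono[OF eventually_gt_at_top[of 0]])
  qed
qed

lemma powr_shift_derivative:
  assumes "t + p > 0"
  shows "((\<lambda>t. (t + p) powr s) has_real_derivative (t + p) powr s * (s / (t + p))) (at t)"
proof -
  have "((\<lambda>t. (t + p) powr s) has_real_derivative s * (t + p) powr (s - 1) * 1) (at t)"
  proof (rule DERIV_chain2[where f = "\<lambda>z. z powr s" and g = "\<lambda>t. t + p"])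
    show "((\<lambda>z. z powr s) has_real_derivative s * (t + p) powr (s - 1)) (at (t + p))"
      by (rule has_real_derivative_powr[OF assms])
    show "((\<lambda>t. t + p) has_real_derivative 1) (at t)" by (auto intro!: derivative_eq_intros)
  qed
  moreover have "s * (t + p) powr (s - 1) * 1 = (t + p) powr s * (s / (t + p))"
    using assms by (simp add: powr_diff)
  ultimately show ?thesis by simp
qed

text \<open>
  The cutoff is \<open>\<eta> x = g (r\<^sup>2)\<close>.  The factor \<open>z\<close> has the size of \<open>(r / \<delta>)\<^sup>1\<^sup>/\<^sup>2\<close> between the scales \<open>\<rho>\<close> and \<open>\<delta>\<close>, the factor \<open>a\<close> vanishes
  for \<open>r \<le> \<rho>\<close> and the factor \<open>b\<close> for \<open>r \<ge> R\<close>; as \<open>n\<close> grows, \<open>\<rho>\<close> tends to \<open>0\<close> and \<open>R\<close> to infinity.  The function \<open>N\<close> is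
  \<open>2 t g' (t)\<close>, the derivative of the cutoff with respect to \<open>log r\<close>, so that \<open>|N (r\<^sup>2)|\<close> is \<open>r |\<nabla>\<eta>|\<close>.
\<close>

locale radial_cutoff =
  fixes \<delta> :: real and n :: nat
  assumes \<delta>: "\<delta> > 0"
begin

definition "\<rho> = \<delta> * inverse (real (Suc n))"
definition "R = real (Suc n)"

definition "z t = (t + \<rho>\<^sup>2) powr (1/4) * (t + \<delta>\<^sup>2) powr (- 1/4)"
definition "a t = flat_exp (t / \<rho>\<^sup>2 - 1)"
definition "b t = exp 1 * flat_exp (1 - t / R\<^sup>2)"
definition "g t = z t * a t * b t"
definition "N t = z t * ((t / (t + \<rho>\<^sup>2) - t / (t + \<delta>\<^sup>2)) / 2 * (a t * b t)
    + 2 * (t / \<rho>\<^sup>2) * flat_exp_deriv (t / \<rho>\<^sup>2 - 1) * b t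
    - a t * (2 * exp 1 * (t / R\<^sup>2) * flat_exp_deriv (1 - t / R\<^sup>2)))"
definition "\<eta> x = g ((norm x)\<^sup>2)" for x :: "real^3"

lemma pos: "\<rho> > 0" "R > 0" "\<rho> \<le> \<delta>"
  using \<delta> mult_left_mono[of "inverse (real (Suc n))" 1 \<delta>] by (simp_all add: \<rho>_def R_def inverse_le_1_iff)

lemma smooth_\<eta>: "smooth \<eta>"
proof -
  note q = smooth_affine_norm_square
  have 1: "smooth (\<lambda>x :: real^3. (p + 1 * (norm (x - 0))\<^sup>2) powr s)" if "p > 0" for p s
    by (rule smooth_compose[OF smooth_real_on_powr q]) (use that in \<open>simp add: add_pos_nonneg\<close>)
  have 2: "smooth (\<lambda>x :: real^3. flat_exp (p + s * (norm (x - 0))\<^sup>2))" for p s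
    by (rule smooth_compose[OF smooth_real_on_flat_exp q]) simp
  have "smooth (\<lambda>x :: real^3. (\<rho>\<^sup>2 + 1 * (norm (x - 0))\<^sup>2) powr (1/4) * (\<delta>\<^sup>2 + 1 * (norm (x - 0))\<^sup>2) powr (- 1/4)
      * flat_exp (- 1 + (1 / \<rho>\<^sup>2) * (norm (x - 0))\<^sup>2) * (exp 1 * flat_exp (1 + (- 1 / R\<^sup>2) * (norm (x - 0))\<^sup>2)))"
    by (rule smooth_mult[OF smooth_mult[OF smooth_mult[OF 1 1] 2] smooth_mult[OF smooth_const 2]])
       (use pos \<delta> in simp_all)
  then show ?thesis
    unfolding \<eta>_def[abs_def] g_def z_def a_def b_def
    by (simp add: add.commute[of "(norm _)\<^sup>2"])
qed

lemma \<eta>_near: "norm x < \<rho> \<Longrightarrow> \<eta> x = 0"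
proof -
  assume "norm x < \<rho>"
  then have "(norm x)\<^sup>2 \<le> \<rho>\<^sup>2" by (intro power_mono) auto
  then show "\<eta> x = 0" using pos by (simp add: \<eta>_def g_def a_def flat_exp_0)
qed

lemma \<eta>_far: "R \<le> norm x \<Longrightarrow> \<eta> x = 0"
proof -
  assume "R \<le> norm x"
  then have "R\<^sup>2 \<le> (norm x)\<^sup>2" using pos by (intro power_mono) auto
  then show "\<eta> x = 0" using pos by (simp add: \<eta>_def g_def b_def flat_exp_0)
qed

lemma test_\<eta>: "test_function \<eta>"
proof -
  have "bounded {x. \<eta> x \<noteq> 0}"
  proof (rule bounded_subset[OF bounded_cball[of 0 R]], safe)
    fix x assume "\<eta> x \<noteq> 0"
    then have "\<not> R \<le> norm x" using \<eta>_far by blast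
    then show "x \<in> cball 0 R" by simp
  qed
  then show ?thesis by (simp add: test_function_iff smooth_\<eta>)
qed

lemma g_derivative:
  assumes "t \<ge> 0"
  shows "\<exists>g'. (g has_real_derivative g') (at t) \<and> 2 * t * g' = N t"
proof -
  have p: "t + \<rho>\<^sup>2 > 0" "t + \<delta>\<^sup>2 > 0" using assms pos \<delta> by (simp_all add: add_nonneg_pos)
  have dz: "(z has_real_derivative z t * ((1/4) / (t + \<rho>\<^sup>2) + (- 1/4) / (t + \<delta>\<^sup>2))) (at t)"
    using DERIV_mult[OF powr_shift_derivative[OF p(1), of "1/4"] powr_shift_derivative[OF p(2), of "- 1/4"]]
    by (simp add: z_def[abs_def] algebra_simps)
  have l1: "((\<lambda>t. t / \<rho>\<^sup>2 - 1) has_real_derivative 1 / \<rho>\<^sup>2) (at t)"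
    by (rule DERIV_cong[OF DERIV_diff[OF DERIV_cdivide[OF DERIV_ident] DERIV_const]]) simp
  have l2: "((\<lambda>t. 1 - t / R\<^sup>2) has_real_derivative - (1 / R\<^sup>2)) (at t)"
    by (rule DERIV_cong[OF DERIV_diff[OF DERIV_const DERIV_cdivide[OF DERIV_ident]]]) simp
  have da: "(a has_real_derivative flat_exp_deriv (t / \<rho>\<^sup>2 - 1) * (1 / \<rho>\<^sup>2)) (at t)"
    unfolding a_def[abs_def] by (rule DERIV_chain2[OF flat_exp_has_derivative l1])
  have db: "(b has_real_derivative exp 1 * (flat_exp_deriv (1 - t / R\<^sup>2) * - (1 / R\<^sup>2))) (at t)"
    unfolding b_def[abs_def] by (rule DERIV_cmult[OF DERIV_chain2[OF flat_exp_has_derivative l2], of "exp 1"])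
  have alg: "2 * t * ((Z * ((1/4) / A + (- 1/4) / B) * a' + F * (1 / r) * Z) * b' + e * (H * - (1 / q)) * (Z * a'))
      = Z * ((t / A - t / B) / 2 * (a' * b') + 2 * (t / r) * F * b' - a' * (2 * e * (t / q) * H))"
    for Z A B a' b' F r e H q :: real
  proof -
    have "2 * t * ((Z * ((1/4) * A + (- 1/4) * B) * a' + F * r * Z) * b' + e * (H * - q) * (Z * a'))
      = Z * ((t * A - t * B) / 2 * (a' * b') + 2 * (t * r) * F * b' - a' * (2 * e * (t * q) * H))"
      for Z A B a' b' F r e H q :: real
      by (simp add: algebra_simps diff_divide_distrib)
    from this[of Z "1 / A" "1 / B" a' F "1 / r" b' e H "1 / q"] show ?thesis by simp
  qed
  note d = DERIV_mult[OF DERIV_mult[OF dz da] db]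
  show ?thesis
  proof (intro exI conjI)
    show "(g has_real_derivative (z t * ((1/4) / (t + \<rho>\<^sup>2) + (- 1/4) / (t + \<delta>\<^sup>2)) * a t
        + flat_exp_deriv (t / \<rho>\<^sup>2 - 1) * (1 / \<rho>\<^sup>2) * z t) * b t
        + exp 1 * (flat_exp_deriv (1 - t / R\<^sup>2) * - (1 / R\<^sup>2)) * (z t * a t)) (at t)"
      using d by (simp add: g_def[abs_def])
    show "2 * t * ((z t * ((1/4) / (t + \<rho>\<^sup>2) + (- 1/4) / (t + \<delta>\<^sup>2)) * a t
        + flat_exp_deriv (t / \<rho>\<^sup>2 - 1) * (1 / \<rho>\<^sup>2) * z t) * b t
        + exp 1 * (flat_exp_deriv (1 - t / R\<^sup>2) * - (1 / R\<^sup>2)) * (z t * a t)) = N t"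
      unfolding N_def by (rule alg)
  qed
qed

lemma gradient_norm: "norm x * norm (\<chi> k. partial k \<eta> x) = \<bar>N ((norm x)\<^sup>2)\<bar>"
proof -
  obtain g' where g': "(g has_real_derivative g') (at ((norm x)\<^sup>2))" "2 * (norm x)\<^sup>2 * g' = N ((norm x)\<^sup>2)"
    using g_derivative[of "(norm x)\<^sup>2"] by auto
  have "(\<eta> has_derivative (\<lambda>v. g' * (2 *\<^sub>R (x \<bullet> v)))) (at x)"
    unfolding \<eta>_def[abs_def]
    by (rule has_derivative_compose[OF has_derivative_sqnorm_at g'(1)[unfolded has_field_derivative_def]])
  from partial_eq[OF this] have "(\<chi> k. partial k \<eta> x) = (2 * g') *\<^sub>R x"
    by (simp add: vec_eq_iff inner_axis_unit)
  then have "norm x * norm (\<chi> k. partial k \<eta> x) = \<bar>2 * (norm x)\<^sup>2 * g'\<bar>"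
    by (simp add: abs_mult power2_eq_square)
  then show ?thesis unfolding g'(2) .
qed

lemma factor_bounds: "0 \<le> a t" "a t \<le> 1" "0 \<le> b t" "t \<ge> 0 \<Longrightarrow> b t \<le> 1"
proof -
  show "0 \<le> a t" "a t \<le> 1" "0 \<le> b t" by (simp_all add: a_def b_def flat_exp_le_1)
  assume "t \<ge> 0"
  define s where "s = 1 - t / R\<^sup>2"
  have "s \<le> 1" using \<open>t \<ge> 0\<close> pos by (simp add: s_def)
  have "flat_exp s \<le> exp (- 1)"
  proof (cases "s \<le> 0")
    case False
    then have "1 \<le> 1 / s" using \<open>s \<le> 1\<close> by simp
    then show ?thesis using False by (simp add: flat_exp_def)
  qed (simp add: flat_exp_def)
  then have "exp 1 * flat_exp s \<le> exp 1 * exp (- 1)" by (intro mult_left_mono) auto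
  then show "b t \<le> 1" by (simp add: b_def s_def exp_minus)
qed

lemma z_nonneg: "0 \<le> z t" by (simp add: z_def)

lemma z_square: "(z t)\<^sup>2 = (t + \<rho>\<^sup>2) powr (1/2) * (t + \<delta>\<^sup>2) powr (- 1/2)" if "t \<ge> 0"
proof -
  have "(x powr s)\<^sup>2 = x powr (s + s)" for x s :: real
    by (simp add: power2_eq_square flip: powr_add)
  then show ?thesis by (simp add: z_def power_mult_distrib)
qed

lemma z_le_1: "t \<ge> 0 \<Longrightarrow> z t \<le> 1"
proof -
  assume "t \<ge> 0"
  have p: "t + \<delta>\<^sup>2 > 0" using \<open>t \<ge> 0\<close> \<delta> by (simp add: add_nonneg_pos)
  have "(t + \<rho>\<^sup>2) powr (1/4) \<le> (t + \<delta>\<^sup>2) powr (1/4)"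
    using pos \<open>t \<ge> 0\<close> by (intro powr_mono2) (auto intro: power_mono)
  then have "z t \<le> (t + \<delta>\<^sup>2) powr (1/4) * (t + \<delta>\<^sup>2) powr (- 1/4)"
    unfolding z_def by (rule mult_right_mono) simp
  also have "\<dots> = 1" using p by (simp flip: powr_add)
  finally show ?thesis .
qed

lemma \<eta>_bounds: "0 \<le> \<eta> x" "\<eta> x \<le> 1"
proof -
  let ?t = "(norm x)\<^sup>2"
  show "0 \<le> \<eta> x" by (simp add: \<eta>_def g_def z_nonneg factor_bounds)
  have "z ?t * a ?t * b ?t \<le> 1 * 1 * 1"
    using factor_bounds[of ?t] z_nonneg z_le_1[of ?t] by (intro mult_mono) auto
  then show "\<eta> x \<le> 1" by (simp add: \<eta>_def g_def)
qed

text \<open>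
  Where \<open>N\<close> does not vanish, \<open>\<rho>\<^sup>2 < r\<^sup>2\<close>, so \<open>z\<^sup>2\<close> is at most \<open>sqrt 2 r / \<delta>\<close>; the exponent \<open>1/4\<close> in \<open>z\<close> is the smallest
  for which the quotient by \<open>r\<close> stays bounded.  The bound is uniform in \<open>n\<close>.
\<close>

lemma N_bound:
  assumes "x \<noteq> 0"
  shows "(N ((norm x)\<^sup>2))\<^sup>2 / norm x \<le> 800 / \<delta>"
proof (cases "(norm x)\<^sup>2 \<le> \<rho>\<^sup>2")
  case True
  then have "(norm x)\<^sup>2 / \<rho>\<^sup>2 - 1 \<le> 0" using pos by simp
  then have "a ((norm x)\<^sup>2) = 0" "flat_exp_deriv ((norm x)\<^sup>2 / \<rho>\<^sup>2 - 1) = 0"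
    by (simp_all add: a_def flat_exp_0 flat_exp_deriv_def)
  then show ?thesis using \<delta> by (simp add: N_def)
next
  case False
  let ?t = "(norm x)\<^sup>2"
  have t: "?t > 0" using assms by simp
  have p: "?t + \<delta>\<^sup>2 > 0" "?t + \<rho>\<^sup>2 > 0" using t by (simp_all add: add_pos_nonneg)
  have "0 \<le> ?t / (?t + \<rho>\<^sup>2)" "?t / (?t + \<rho>\<^sup>2) \<le> 1" "0 \<le> ?t / (?t + \<delta>\<^sup>2)" "?t / (?t + \<delta>\<^sup>2) \<le> 1"
    using t p by (simp_all add: divide_le_eq_1)
  moreover have "\<bar>(u - v) / 2\<bar> \<le> 1" if "0 \<le> u" "u \<le> 1" "0 \<le> v" "v \<le> 1" for u v :: real
    using that by (auto simp: abs_le_iff)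
  ultimately have q1: "\<bar>(?t / (?t + \<rho>\<^sup>2) - ?t / (?t + \<delta>\<^sup>2)) / 2\<bar> \<le> 1" by blast
  have ab1: "\<bar>a ?t * b ?t\<bar> \<le> 1 * 1" unfolding abs_mult using factor_bounds[of ?t] by (intro mult_mono) auto
  have "\<bar>(?t / (?t + \<rho>\<^sup>2) - ?t / (?t + \<delta>\<^sup>2)) / 2 * (a ?t * b ?t)\<bar> \<le> 1 * (1 * 1)"
    unfolding abs_mult[of "(?t / (?t + \<rho>\<^sup>2) - ?t / (?t + \<delta>\<^sup>2)) / 2"] by (intro mult_mono q1 ab1) auto
  moreover have "\<bar>2 * (?t / \<rho>\<^sup>2) * flat_exp_deriv (?t / \<rho>\<^sup>2 - 1) * b ?t\<bar> \<le> 4 * 1"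
  proof -
    have "(?t / \<rho>\<^sup>2) * flat_exp_deriv (?t / \<rho>\<^sup>2 - 1) \<le> 2" using flat_exp_deriv_bounds(1)[of "?t / \<rho>\<^sup>2 - 1"] by simp
    moreover have "0 \<le> (?t / \<rho>\<^sup>2) * flat_exp_deriv (?t / \<rho>\<^sup>2 - 1)" by (simp add: flat_exp_deriv_nonneg)
    ultimately show ?thesis
      unfolding abs_mult[of _ "b ?t"] using factor_bounds[of ?t] by (intro mult_mono) auto
  qed
  moreover have "\<bar>a ?t * (2 * exp 1 * (?t / R\<^sup>2) * flat_exp_deriv (1 - ?t / R\<^sup>2))\<bar> \<le> 1 * 12"
  proof -
    have "(?t / R\<^sup>2) * flat_exp_deriv (1 - ?t / R\<^sup>2) \<le> 1 * 2" if "?t / R\<^sup>2 \<le> 1"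
      using that flat_exp_deriv_bounds(2)[of "1 - ?t / R\<^sup>2"] by (intro mult_mono) (auto simp: flat_exp_deriv_nonneg)
    moreover have "(?t / R\<^sup>2) * flat_exp_deriv (1 - ?t / R\<^sup>2) \<le> 1 * 2" if "\<not> ?t / R\<^sup>2 \<le> 1"
      using that by (simp add: flat_exp_deriv_def)
    ultimately have 2: "(?t / R\<^sup>2) * flat_exp_deriv (1 - ?t / R\<^sup>2) \<le> 2" by fastforce
    have 0: "0 \<le> (?t / R\<^sup>2) * flat_exp_deriv (1 - ?t / R\<^sup>2)" by (simp add: flat_exp_deriv_nonneg)
    have "exp 1 * ((?t / R\<^sup>2) * flat_exp_deriv (1 - ?t / R\<^sup>2)) \<le> 3 * 2"
      using exp_le by (intro mult_mono 2 0) auto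
    then have "\<bar>2 * exp 1 * (?t / R\<^sup>2) * flat_exp_deriv (1 - ?t / R\<^sup>2)\<bar> \<le> 12"
      using 0 by (simp add: abs_mult flat_exp_deriv_nonneg mult.assoc)
    then show ?thesis unfolding abs_mult[of "a ?t"] using factor_bounds[of ?t] by (intro mult_mono) auto
  qed
  ultimately have br: "\<bar>(?t / (?t + \<rho>\<^sup>2) - ?t / (?t + \<delta>\<^sup>2)) / 2 * (a ?t * b ?t)
    + 2 * (?t / \<rho>\<^sup>2) * flat_exp_deriv (?t / \<rho>\<^sup>2 - 1) * b ?t
    - a ?t * (2 * exp 1 * (?t / R\<^sup>2) * flat_exp_deriv (1 - ?t / R\<^sup>2))\<bar> \<le> 20" (is "\<bar>?B\<bar> \<le> 20")
    by linarith
  have "\<bar>?B\<bar>\<^sup>2 \<le> 20\<^sup>2" by (rule power_mono[OF br]) simp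
  then have "?B\<^sup>2 \<le> 20\<^sup>2" by (simp only: power2_abs)
  have "(z ?t)\<^sup>2 \<le> (2 * ?t) powr (1/2) * (\<delta>\<^sup>2) powr (- 1/2)"
    unfolding z_square[OF less_imp_le[OF t]]
    using False t \<delta> by (intro mult_mono powr_mono2 powr_mono2') auto
  also have "(2 * ?t) powr (1/2) = sqrt 2 * norm x" using t by (simp add: powr_half_sqrt real_sqrt_mult)
  also have "(\<delta>\<^sup>2) powr (- 1/2) = 1 / \<delta>" using \<delta> by (simp add: powr_minus_divide powr_half_sqrt)
  finally have z2: "(z ?t)\<^sup>2 \<le> sqrt 2 * norm x * (1 / \<delta>)" .
  have "(N ?t)\<^sup>2 = (z ?t)\<^sup>2 * ?B\<^sup>2" by (simp add: N_def power_mult_distrib)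
  also have "\<dots> \<le> sqrt 2 * norm x * (1 / \<delta>) * 20\<^sup>2"
    by (intro mult_mono z2 \<open>?B\<^sup>2 \<le> 20\<^sup>2\<close>) (use \<delta> in auto)
  also have "\<dots> \<le> 2 * norm x * (1 / \<delta>) * 20\<^sup>2"
    using \<delta> sqrt2_less_2 by (intro mult_right_mono) auto
  finally have "(N ?t)\<^sup>2 / norm x \<le> 2 * norm x * (1 / \<delta>) * 20\<^sup>2 / norm x"
    by (rule divide_right_mono) simp
  also have "\<dots> = 800 / \<delta>" using assms by simp
  finally show ?thesis .
qed

end

lemma norm_add_square_le:
  fixes a b :: "'a::real_normed_vector"
  assumes s: "s > 0"
  shows "(norm (a + b))\<^sup>2 \<le> (1 + s) * (norm a)\<^sup>2 + (1 + 1 / s) * (norm b)\<^sup>2"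
proof -
  have "0 \<le> (s * norm a - norm b)\<^sup>2 / s" using s by simp
  also have "\<dots> = s * (norm a)\<^sup>2 + (norm b)\<^sup>2 / s - 2 * norm a * norm b"
    using s by (simp add: power2_eq_square field_simps)
  finally have "2 * norm a * norm b \<le> s * (norm a)\<^sup>2 + (norm b)\<^sup>2 / s" by simp
  moreover have "(norm (a + b))\<^sup>2 \<le> (norm a + norm b)\<^sup>2"
    by (intro power_mono norm_triangle_ineq) simp
  ultimately show ?thesis by (simp add: power2_sum algebra_simps)
qed

lemma norm_sum_i_alpha: "norm (\<Sum>k\<in>UNIV. w k *\<^sub>R i_alpha k v) = norm (\<chi> k. w k) * norm v"
proof -
  have "(\<Sum>k\<in>UNIV. w k *\<^sub>R i_alpha k v) = \<i> *s dirac.slash (\<chi> k. w k) v"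
    by (simp add: i_alpha_def dirac.slash_def linear_sum[OF linear_i_vec] linear_scale[OF linear_i_vec])
  then show ?thesis by (simp add: dirac.norm_slash)
qed

lemma locally_integrable_measurable:
  assumes "locally_integrable f"
  shows "f \<in> borel_measurable lebesgue"
proof (rule borel_measurable_LIMSEQ_metric)
  show "(\<lambda>x. indicat_real (cball 0 (real n)) x *\<^sub>R f x) \<in> borel_measurable lebesgue" for n
    by (rule borel_measurable_integrable)
       (rule assms[unfolded locally_integrable_def set_integrable_def, rule_format, OF compact_cball])
  show "(\<lambda>n. indicat_real (cball 0 (real n)) x *\<^sub>R f x) \<longlonglongrightarrow> f x" for x
  proof (rule tendsto_eventually)
    obtain N where N: "norm x \<le> real N" using real_arch_simple by blast
    show "\<forall>\<^sub>F n in sequentially. indicat_real (cball 0 (real n)) x *\<^sub>R f x = f x"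
      by (rule eventually_sequentiallyI[of N]) (use N in \<open>auto simp: indicator_def\<close>)
  qed
qed

lemma shifted_dirac_measurable:
  assumes "\<psi> \<in> borel_measurable lebesgue" "\<And>k. D k \<in> borel_measurable lebesgue"
  shows "shifted_dirac m c \<psi> D \<in> borel_measurable lebesgue"
proof -
  have L: "(\<lambda>x. L (f x)) \<in> borel_measurable lebesgue"
    if "bounded_linear L" "f \<in> borel_measurable lebesgue" for L :: "complex^4 \<Rightarrow> complex^4" and f :: "real^3 \<Rightarrow> complex^4"
    by (rule measurable_compose[OF that(2) borel_measurable_continuous_onI])
       (rule linear_continuous_on[OF that(1)])
  show ?thesis
    unfolding shifted_dirac_i_alpha[abs_def]
    by (rule borel_measurable_add[OF borel_measurable_sum[OF L[OF bounded_linear_i_alpha assms(2)]]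
          L[OF bounded_linear_lower_order assms(1)]])
qed

lemma (in radial_cutoff) N_measurable: "(\<lambda>x. (N ((norm x)\<^sup>2))\<^sup>2) \<in> borel_measurable (lebesgue :: (real^3) measure)"
proof -
  have "(\<lambda>x. (N ((norm x)\<^sup>2))\<^sup>2) = (\<lambda>x :: real^3. (norm x * norm (\<chi> k. partial k \<eta> x))\<^sup>2)"
    by (simp add: gradient_norm)
  moreover have "continuous_on UNIV (\<lambda>x :: real^3. (norm x * norm (\<chi> k. partial k \<eta> x))\<^sup>2)"
    by (intro continuous_on_power continuous_on_mult continuous_on_norm continuous_on_id continuous_on_vec_lambda
        smooth_continuous[OF smooth_partial[OF smooth_\<eta>]])
  ultimately show ?thesis using measurable_continuous_lebesgue by simp
qed

text \<open>
  The cutoff inequality with the product rule and Young's inequality; the last integral is the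
  commutator.
\<close>

lemma (in radial_cutoff) cutoff_estimate:
  assumes \<psi>: "\<psi> \<in> borel_measurable lebesgue" and w: "\<And>k. has_weak_partial k \<psi> (D k)" and c: "Re c = 0" and s: "s > 0"
  shows "(\<integral>\<^sup>+x. ennreal ((\<eta> x)\<^sup>2 / norm x * (norm (\<psi> x))\<^sup>2) \<partial>lebesgue)
     \<le> ennreal (1 + s) * weighted_energy (shifted_dirac m c \<psi> D)
       + ennreal (1 + 1 / s) * (\<integral>\<^sup>+x. ennreal ((N ((norm x)\<^sup>2))\<^sup>2 / norm x * (norm (\<psi> x))\<^sup>2) \<partial>lebesgue)"
proof -
  let ?F = "shifted_dirac m c \<psi> D"
  have Fm: "?F \<in> borel_measurable lebesgue"
    by (rule shifted_dirac_measurable[OF \<psi>]) (use w in \<open>auto simp: has_weak_partial_def intro: locally_integrable_measurable\<close>)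
  note nm = norm_measurable_lebesgue
  have Pm: "(\<lambda>x. ennreal (norm x * (norm (?F x))\<^sup>2)) \<in> borel_measurable lebesgue"
    by (intro measurable_compose[OF _ measurable_ennreal] borel_measurable_times borel_measurable_power nm
        measurable_compose[OF Fm borel_measurable_norm])
  note Nm = N_measurable
  have Qm: "(\<lambda>x. ennreal ((N ((norm x)\<^sup>2))\<^sup>2 / norm x * (norm (\<psi> x))\<^sup>2)) \<in> borel_measurable lebesgue"
    by (intro measurable_compose[OF _ measurable_ennreal] borel_measurable_times borel_measurable_divide borel_measurable_power nm Nm
        measurable_compose[OF \<psi> borel_measurable_norm])
  have "(\<integral>\<^sup>+x. ennreal ((\<eta> x)\<^sup>2 / norm x * (norm (\<psi> x))\<^sup>2) \<partial>lebesgue)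
      = (\<integral>\<^sup>+x. ennreal ((norm (\<eta> x *\<^sub>R \<psi> x))\<^sup>2 / norm x) \<partial>lebesgue)"
    by (intro nn_integral_cong) (simp add: power_mult_distrib)
  also have "\<dots> \<le> weighted_energy (cutoff_dirac m c \<eta> \<psi> D)"
    by (rule cutoff_hardy[OF test_\<eta> pos(1) \<eta>_near w c])
  also have "\<dots> \<le> (\<integral>\<^sup>+x. ennreal (1 + s) * ennreal (norm x * (norm (?F x))\<^sup>2)
       + ennreal (1 + 1 / s) * ennreal ((N ((norm x)\<^sup>2))\<^sup>2 / norm x * (norm (\<psi> x))\<^sup>2) \<partial>lebesgue)"
  proof (rule nn_integral_mono)
    fix x :: "real^3"
    let ?g = "norm (\<chi> k. partial k \<eta> x)"
    have "norm (\<eta> x *\<^sub>R ?F x) \<le> norm (?F x)"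
      using \<eta>_bounds[of x] by (simp add: mult_left_le_one_le)
    then have e: "(norm (\<eta> x *\<^sub>R ?F x))\<^sup>2 \<le> (norm (?F x))\<^sup>2" by (intro power_mono) auto
    have "(norm (cutoff_dirac m c \<eta> \<psi> D x))\<^sup>2
       \<le> (1 + s) * (norm (\<eta> x *\<^sub>R ?F x))\<^sup>2 + (1 + 1 / s) * (?g * norm (\<psi> x))\<^sup>2"
      using norm_add_square_le[OF s, of "\<eta> x *\<^sub>R ?F x" "\<Sum>k\<in>UNIV. partial k \<eta> x *\<^sub>R i_alpha k (\<psi> x)"]
      unfolding norm_sum_i_alpha by (simp only: cutoff_dirac_def)
    also have "\<dots> \<le> (1 + s) * (norm (?F x))\<^sup>2 + (1 + 1 / s) * (?g * norm (\<psi> x))\<^sup>2"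
      using s e by (intro add_right_mono mult_left_mono) auto
    finally have "norm x * (norm (cutoff_dirac m c \<eta> \<psi> D x))\<^sup>2
       \<le> norm x * ((1 + s) * (norm (?F x))\<^sup>2 + (1 + 1 / s) * (?g * norm (\<psi> x))\<^sup>2)"
      by (rule mult_left_mono) simp
    also have "\<dots> = (1 + s) * (norm x * (norm (?F x))\<^sup>2) + (1 + 1 / s) * ((N ((norm x)\<^sup>2))\<^sup>2 / norm x * (norm (\<psi> x))\<^sup>2)"
    proof (cases "x = 0")
      case False
      have "(N ((norm x)\<^sup>2))\<^sup>2 = (norm x * ?g)\<^sup>2" by (simp add: gradient_norm)
      then have "(N ((norm x)\<^sup>2))\<^sup>2 / norm x = norm x * ?g\<^sup>2"
        using False by (simp add: power2_eq_square)
      then show ?thesis by (simp add: algebra_simps power_mult_distrib)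
    qed simp
    finally show "ennreal (norm x * (norm (cutoff_dirac m c \<eta> \<psi> D x))\<^sup>2)
       \<le> ennreal (1 + s) * ennreal (norm x * (norm (?F x))\<^sup>2)
       + ennreal (1 + 1 / s) * ennreal ((N ((norm x)\<^sup>2))\<^sup>2 / norm x * (norm (\<psi> x))\<^sup>2)"
      using s by (simp add: ennreal_leI flip: ennreal_mult ennreal_plus)
  qed
  also have "\<dots> = ennreal (1 + s) * (\<integral>\<^sup>+x. ennreal (norm x * (norm (?F x))\<^sup>2) \<partial>lebesgue)
       + ennreal (1 + 1 / s) * (\<integral>\<^sup>+x. ennreal ((N ((norm x)\<^sup>2))\<^sup>2 / norm x * (norm (\<psi> x))\<^sup>2) \<partial>lebesgue)"
    by (simp only: nn_integral_add[OF borel_measurable_times_ennreal[OF borel_measurable_const Pm]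
          borel_measurable_times_ennreal[OF borel_measurable_const Qm]] nn_integral_cmult[OF Pm] nn_integral_cmult[OF Qm])
  finally show ?thesis .
qed

text \<open>
  The limits of \<open>g\<close> and \<open>N\<close> as the inner and the outer truncation are removed.
\<close>

definition profile :: "real \<Rightarrow> real \<Rightarrow> real" where
  "profile \<delta> t = t powr (1/4) * (t + \<delta>\<^sup>2) powr (- 1/4)"

definition slope :: "real \<Rightarrow> real \<Rightarrow> real" where
  "slope \<delta> t = profile \<delta> t * ((1 - t / (t + \<delta>\<^sup>2)) / 2)"

lemma radial_cutoff_limits:
  assumes \<delta>: "\<delta> > 0" and t: "t > 0"
  shows "(\<lambda>n. radial_cutoff.g \<delta> n t) \<longlonglongrightarrow> profile \<delta> t"
    and "(\<lambda>n. radial_cutoff.N \<delta> n t) \<longlonglongrightarrow> slope \<delta> t"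
proof -
  interpret radial_cutoff \<delta> n for n by unfold_locales (rule \<delta>)
  have inv: "(\<lambda>n. inverse (real (Suc n))) \<longlonglongrightarrow> 0" by (rule LIMSEQ_inverse_real_of_nat)
  have rho: "(\<lambda>n. (\<rho> n)\<^sup>2) \<longlonglongrightarrow> 0"
    unfolding \<rho>_def using tendsto_power[OF tendsto_mult_right_zero[OF inv], of \<delta> 2] by simp
  have tr: "(\<lambda>n. t + (\<rho> n)\<^sup>2) \<longlonglongrightarrow> t"
    using tendsto_add[OF tendsto_const[of t] rho] by simp
  have z: "(\<lambda>n. z n t) \<longlonglongrightarrow> profile \<delta> t"
    unfolding z_def profile_def
    using t by (intro tendsto_mult tendsto_const tendsto_powr[OF tr tendsto_const]) simp
  have q: "(\<lambda>n. t / (t + (\<rho> n)\<^sup>2)) \<longlonglongrightarrow> 1"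
    using t tendsto_divide[OF tendsto_const[of t] tendsto_add[OF tendsto_const[of t] rho]] by simp
  have "filterlim (\<lambda>n. real (Suc n)) at_top sequentially"
    using filterlim_Suc filterlim_real_sequentially by (rule filterlim_compose[rotated])
  then have "filterlim (\<lambda>n. (real (Suc n))\<^sup>2) at_top sequentially"
    by (intro filterlim_pow_at_top) auto
  then have "filterlim (\<lambda>n. (t / \<delta>\<^sup>2) * (real (Suc n))\<^sup>2) at_top sequentially"
    using t \<delta> by (intro filterlim_tendsto_pos_mult_at_top[OF tendsto_const]) auto
  then have "filterlim (\<lambda>n. - 1 + (t / \<delta>\<^sup>2) * (real (Suc n))\<^sup>2) at_top sequentially"
    by (intro filterlim_tendsto_add_at_top[OF tendsto_const])
  moreover have "- 1 + (t / \<delta>\<^sup>2) * (real (Suc n))\<^sup>2 = t / (\<rho> n)\<^sup>2 - 1" for n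
    by (simp add: \<rho>_def power_mult_distrib power_inverse divide_inverse)
  ultimately have S: "filterlim (\<lambda>n. t / (\<rho> n)\<^sup>2 - 1) at_top sequentially" by simp
  have a: "(\<lambda>n. a n t) \<longlonglongrightarrow> 1"
    unfolding a_def by (rule filterlim_compose[OF flat_exp_tendsto_1 S])
  have fa: "(\<lambda>n. t / (\<rho> n)\<^sup>2 * flat_exp_deriv (t / (\<rho> n)\<^sup>2 - 1)) \<longlonglongrightarrow> 0"
    using filterlim_compose[OF flat_exp_deriv_tendsto_0 S] by simp
  have "(\<lambda>n. t * (inverse (real (Suc n)))\<^sup>2) \<longlonglongrightarrow> t * 0\<^sup>2"
    by (intro tendsto_mult tendsto_const tendsto_power inv)
  then have TR: "(\<lambda>n. t / (R n)\<^sup>2) \<longlonglongrightarrow> 0" by (simp add: R_def divide_inverse power_inverse)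
  have "isCont flat_exp 1" by (rule DERIV_isCont[OF flat_exp_has_derivative])
  moreover have "(\<lambda>n. 1 - t / (R n)\<^sup>2) \<longlonglongrightarrow> 1" using tendsto_diff[OF tendsto_const[of 1] TR] by simp
  ultimately have "(\<lambda>n. flat_exp (1 - t / (R n)\<^sup>2)) \<longlonglongrightarrow> flat_exp 1" by (rule isCont_tendsto_compose)
  then have "(\<lambda>n. b n t) \<longlonglongrightarrow> exp 1 * flat_exp 1" unfolding b_def by (rule tendsto_mult_left)
  then have b: "(\<lambda>n. b n t) \<longlonglongrightarrow> 1" by (simp add: flat_exp_def exp_minus)
  have fb: "(\<lambda>n. 2 * exp 1 * (t / (R n)\<^sup>2) * flat_exp_deriv (1 - t / (R n)\<^sup>2)) \<longlonglongrightarrow> 0"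
  proof (rule tendsto_sandwich[OF _ _ tendsto_const])
    have "2 * exp 1 * (t / (R n)\<^sup>2) * flat_exp_deriv (1 - t / (R n)\<^sup>2) \<le> 2 * exp 1 * (t / (R n)\<^sup>2) * 2" for n
      using t by (intro mult_left_mono flat_exp_deriv_bounds) auto
    then show "\<forall>\<^sub>F n in sequentially. 2 * exp 1 * (t / (R n)\<^sup>2) * flat_exp_deriv (1 - t / (R n)\<^sup>2) \<le> 2 * exp 1 * (t / (R n)\<^sup>2) * 2"
      by simp
    show "\<forall>\<^sub>F n in sequentially. 0 \<le> 2 * exp 1 * (t / (R n)\<^sup>2) * flat_exp_deriv (1 - t / (R n)\<^sup>2)"
      using t by (simp add: flat_exp_deriv_nonneg)
    have "(\<lambda>n. 2 * exp 1 * (t / (R n)\<^sup>2) * 2) \<longlonglongrightarrow> 2 * exp 1 * 0 * 2"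
      by (intro tendsto_mult tendsto_const TR)
    then show "(\<lambda>n. 2 * exp 1 * (t / (R n)\<^sup>2) * 2) \<longlonglongrightarrow> 0" by simp
  qed
  show "(\<lambda>n. g n t) \<longlonglongrightarrow> profile \<delta> t"
    unfolding g_def using tendsto_mult[OF tendsto_mult[OF z a] b] by simp
  have "(\<lambda>n. z n t * ((t / (t + (\<rho> n)\<^sup>2) - t / (t + \<delta>\<^sup>2)) / 2 * (a n t * b n t)
    + 2 * (t / (\<rho> n)\<^sup>2 * flat_exp_deriv (t / (\<rho> n)\<^sup>2 - 1)) * b n t
    - a n t * (2 * exp 1 * (t / (R n)\<^sup>2) * flat_exp_deriv (1 - t / (R n)\<^sup>2))))
    \<longlonglongrightarrow> profile \<delta> t * ((1 - t / (t + \<delta>\<^sup>2)) / 2 * (1 * 1) + 2 * 0 * 1 - 1 * 0)"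
    by (intro tendsto_mult tendsto_add tendsto_diff tendsto_divide tendsto_const z q a b fa fb) simp
  then show "(\<lambda>n. N n t) \<longlonglongrightarrow> slope \<delta> t"
    by (simp add: N_def slope_def mult.assoc)
qed

lemma profile_square:
  assumes "\<delta> > 0" "x \<noteq> 0"
  shows "(profile \<delta> ((norm x)\<^sup>2))\<^sup>2 / norm x = 1 / sqrt ((norm x)\<^sup>2 + \<delta>\<^sup>2)"
proof -
  have "(v powr s)\<^sup>2 = v powr (s + s)" for v s :: real
    by (simp add: power2_eq_square flip: powr_add)
  then have "(profile \<delta> ((norm x)\<^sup>2))\<^sup>2 = ((norm x)\<^sup>2) powr (1/2) * ((norm x)\<^sup>2 + \<delta>\<^sup>2) powr (- (1/2))"
    by (simp add: profile_def power_mult_distrib)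
  also have "\<dots> = norm x / sqrt ((norm x)\<^sup>2 + \<delta>\<^sup>2)"
    using assms by (simp add: powr_half_sqrt powr_minus_divide)
  finally show ?thesis using assms by simp
qed

lemma AE_lebesgue_nonzero: "AE x in lebesgue. x \<noteq> (0 :: real^3)"
  by (rule AE_I'[of "{0}"]) (auto simp: negligible_iff_null_sets[symmetric])

text \<open>
  Fatou's lemma on the left and dominated convergence for the commutator, with the square integrable
  majorant from the uniform bound on \<open>N\<close>.
\<close>

lemma profile_energy_bound:
  fixes \<psi> :: "real^3 \<Rightarrow> complex^4"
  assumes \<psi>: "square_integrable \<psi>" and w: "\<And>k. has_weak_partial k \<psi> (D k)" and c: "Re c = 0"
    and s: "s > 0" and \<delta>: "\<delta> > 0"
  shows "(\<integral>\<^sup>+x. ennreal ((profile \<delta> ((norm x)\<^sup>2))\<^sup>2 / norm x * (norm (\<psi> x))\<^sup>2) \<partial>lebesgue)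
     \<le> ennreal (1 + s) * weighted_energy (shifted_dirac m c \<psi> D)
       + ennreal (1 + 1 / s) * (\<integral>\<^sup>+x. ennreal ((slope \<delta> ((norm x)\<^sup>2))\<^sup>2 / norm x * (norm (\<psi> x))\<^sup>2) \<partial>lebesgue)"
proof -
  interpret radial_cutoff \<delta> n for n by unfold_locales (rule \<delta>)
  have \<psi>m: "\<psi> \<in> borel_measurable lebesgue" and \<psi>i: "integrable lebesgue (\<lambda>x. (norm (\<psi> x))\<^sup>2)"
    using \<psi> by (auto simp: square_integrable_def)
  note nm = norm_measurable_lebesgue
  note pm = measurable_compose[OF \<psi>m borel_measurable_norm]
  have \<eta>m: "\<eta> n \<in> borel_measurable lebesgue" for n
    by (rule measurable_continuous_lebesgue[OF smooth_continuous[OF smooth_\<eta>]])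
  have Em: "(\<lambda>x. ennreal ((\<eta> n x)\<^sup>2 / norm x * (norm (\<psi> x))\<^sup>2)) \<in> borel_measurable lebesgue" for n
    by (intro measurable_compose[OF _ measurable_ennreal] borel_measurable_times borel_measurable_divide borel_measurable_power nm \<eta>m pm)
  note Nm = N_measurable
  have Qm: "(\<lambda>x. ennreal ((N n ((norm x)\<^sup>2))\<^sup>2 / norm x * (norm (\<psi> x))\<^sup>2)) \<in> borel_measurable lebesgue" for n
    by (intro measurable_compose[OF _ measurable_ennreal] borel_measurable_times borel_measurable_divide borel_measurable_power nm Nm pm)
  have Sm: "(\<lambda>x. ennreal ((slope \<delta> ((norm x)\<^sup>2))\<^sup>2 / norm x * (norm (\<psi> x))\<^sup>2)) \<in> borel_measurable lebesgue"
    unfolding slope_def profile_def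
    by (intro measurable_compose[OF _ measurable_ennreal] borel_measurable_times borel_measurable_divide borel_measurable_power
        borel_measurable_diff borel_measurable_add powr_real_measurable borel_measurable_const nm pm)
  have limE: "(\<lambda>n. ennreal ((\<eta> n x)\<^sup>2 / norm x * (norm (\<psi> x))\<^sup>2))
      \<longlonglongrightarrow> ennreal ((profile \<delta> ((norm x)\<^sup>2))\<^sup>2 / norm x * (norm (\<psi> x))\<^sup>2)" if "x \<noteq> 0" for x
    unfolding \<eta>_def using that
    by (intro tendsto_ennrealI tendsto_mult tendsto_divide tendsto_power tendsto_const radial_cutoff_limits(1)[OF \<delta>]) auto
  have limN: "(\<lambda>n. ennreal ((N n ((norm x)\<^sup>2))\<^sup>2 / norm x * (norm (\<psi> x))\<^sup>2))
      \<longlonglongrightarrow> ennreal ((slope \<delta> ((norm x)\<^sup>2))\<^sup>2 / norm x * (norm (\<psi> x))\<^sup>2)" if "x \<noteq> 0" for x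
    using that
    by (intro tendsto_ennrealI tendsto_mult tendsto_divide tendsto_power tendsto_const radial_cutoff_limits(2)[OF \<delta>]) auto
  have nz: "ennreal (1 + s) \<noteq> 0" "ennreal (1 + 1 / s) \<noteq> 0"
    using s by (simp_all add: ennreal_eq_0_iff add_pos_pos not_le)
  let ?A = "weighted_energy (shifted_dirac m c \<psi> D)"
  let ?I = "\<lambda>n. \<integral>\<^sup>+x. ennreal ((N n ((norm x)\<^sup>2))\<^sup>2 / norm x * (norm (\<psi> x))\<^sup>2) \<partial>lebesgue"
  let ?J = "\<integral>\<^sup>+x. ennreal ((slope \<delta> ((norm x)\<^sup>2))\<^sup>2 / norm x * (norm (\<psi> x))\<^sup>2) \<partial>lebesgue"
  have IJ: "?I \<longlonglongrightarrow> ?J"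
  proof (rule nn_integral_dominated_convergence[where w = "\<lambda>x. ennreal (800 / \<delta> * (norm (\<psi> x))\<^sup>2)"])
    show "(\<lambda>x. ennreal (800 / \<delta> * (norm (\<psi> x))\<^sup>2)) \<in> borel_measurable lebesgue"
      by (intro measurable_compose[OF _ measurable_ennreal] borel_measurable_times borel_measurable_power borel_measurable_const pm)
    have "integrable lebesgue (\<lambda>x. 800 / \<delta> * (norm (\<psi> x))\<^sup>2)" by (rule integrable_mult_right[OF \<psi>i])
    from nn_integral_eq_integral[OF this] \<delta>
    show "(\<integral>\<^sup>+x. ennreal (800 / \<delta> * (norm (\<psi> x))\<^sup>2) \<partial>lebesgue) < \<infinity>" by simp
    show "AE x in lebesgue. ennreal ((N n ((norm x)\<^sup>2))\<^sup>2 / norm x * (norm (\<psi> x))\<^sup>2) \<le> ennreal (800 / \<delta> * (norm (\<psi> x))\<^sup>2)" for n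
      using AE_lebesgue_nonzero
    proof eventually_elim
      case (elim x)
      show ?case by (intro ennreal_leI mult_right_mono N_bound elim) simp
    qed
    show "AE x in lebesgue. (\<lambda>n. ennreal ((N n ((norm x)\<^sup>2))\<^sup>2 / norm x * (norm (\<psi> x))\<^sup>2))
      \<longlonglongrightarrow> ennreal ((slope \<delta> ((norm x)\<^sup>2))\<^sup>2 / norm x * (norm (\<psi> x))\<^sup>2)"
      using AE_lebesgue_nonzero by eventually_elim (rule limN)
  qed (rule Qm Sm)+
  have "(\<integral>\<^sup>+x. ennreal ((profile \<delta> ((norm x)\<^sup>2))\<^sup>2 / norm x * (norm (\<psi> x))\<^sup>2) \<partial>lebesgue)
     \<le> (\<integral>\<^sup>+x. liminf (\<lambda>n. ennreal ((\<eta> n x)\<^sup>2 / norm x * (norm (\<psi> x))\<^sup>2)) \<partial>lebesgue)"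
  proof (rule nn_integral_mono_AE, use AE_lebesgue_nonzero in eventually_elim)
    fix x :: "real^3" assume "x \<noteq> 0"
    from lim_imp_Liminf[OF _ limE[OF this]]
    show "ennreal ((profile \<delta> ((norm x)\<^sup>2))\<^sup>2 / norm x * (norm (\<psi> x))\<^sup>2)
       \<le> liminf (\<lambda>n. ennreal ((\<eta> n x)\<^sup>2 / norm x * (norm (\<psi> x))\<^sup>2))" by simp
  qed
  also have "\<dots> \<le> liminf (\<lambda>n. \<integral>\<^sup>+x. ennreal ((\<eta> n x)\<^sup>2 / norm x * (norm (\<psi> x))\<^sup>2) \<partial>lebesgue)"
    by (rule nn_integral_liminf[OF Em])
  also have "\<dots> \<le> liminf (\<lambda>n. ennreal (1 + s) * ?A + ennreal (1 + 1 / s) * ?I n)"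
    by (intro Liminf_mono always_eventually allI cutoff_estimate \<psi>m w c s)
  also have "\<dots> = ennreal (1 + s) * ?A + ennreal (1 + 1 / s) * ?J"
    using nz by (intro lim_imp_Liminf tendsto_add tendsto_mult_ennreal tendsto_const IJ) auto
  finally show ?thesis .
qed

text \<open>
  Since the slope is at most half the profile, the commutator can be absorbed and the left-hand side is
  finite.  Then it serves as majorant for the commutators, which tend to \<open>0\<close> with \<open>\<delta>\<close>.
\<close>

theorem dirac_hardy_inequality:
  fixes \<psi> :: "real^3 \<Rightarrow> complex^4"
  assumes \<psi>: "square_integrable \<psi>" and w: "\<And>k. has_weak_partial k \<psi> (D k)" and c: "Re c = 0"
  shows "coulomb_energy \<psi>
     \<le> weighted_energy (shifted_dirac m c \<psi> D)"
proof (cases "weighted_energy (shifted_dirac m c \<psi> D) = \<infinity>")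
  case False
  let ?A = "weighted_energy (shifted_dirac m c \<psi> D)"
  let ?X = "coulomb_energy \<psi>"
  let ?L = "\<lambda>\<delta> x. ennreal ((profile \<delta> ((norm x)\<^sup>2))\<^sup>2 / norm x * (norm (\<psi> x))\<^sup>2)"
  let ?S = "\<lambda>\<delta> x. ennreal ((slope \<delta> ((norm x)\<^sup>2))\<^sup>2 / norm x * (norm (\<psi> x))\<^sup>2)"
  have A: "?A < \<infinity>" using False by (simp add: top.not_eq_extremum)
  have \<psi>m: "\<psi> \<in> borel_measurable lebesgue" and \<psi>i: "integrable lebesgue (\<lambda>x. (norm (\<psi> x))\<^sup>2)"
    using \<psi> by (auto simp: square_integrable_def)
  note nm = norm_measurable_lebesgue
  note pm = measurable_compose[OF \<psi>m borel_measurable_norm]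
  have Lm: "?L \<delta> \<in> borel_measurable lebesgue" for \<delta>
    unfolding profile_def
    by (intro measurable_compose[OF _ measurable_ennreal] borel_measurable_times borel_measurable_divide borel_measurable_power
        borel_measurable_diff borel_measurable_add powr_real_measurable borel_measurable_const nm pm)
  have Sm: "?S \<delta> \<in> borel_measurable lebesgue" for \<delta>
    unfolding slope_def profile_def
    by (intro measurable_compose[OF _ measurable_ennreal] borel_measurable_times borel_measurable_divide borel_measurable_power
        borel_measurable_diff borel_measurable_add powr_real_measurable borel_measurable_const nm pm)
  have Xm: "(\<lambda>x. ennreal ((norm (\<psi> x))\<^sup>2 / norm x)) \<in> borel_measurable lebesgue"
    by (intro measurable_compose[OF _ measurable_ennreal] borel_measurable_divide borel_measurable_power nm pm)
  define \<kappa> where "\<kappa> \<delta> x = (1 - (norm x)\<^sup>2 / ((norm x)\<^sup>2 + \<delta>\<^sup>2)) / 2" for \<delta> and x :: "real^3"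
  have \<kappa>: "0 \<le> \<kappa> \<delta> x" "\<kappa> \<delta> x \<le> 1 / 2" for \<delta> x
  proof -
    have "0 \<le> t / (t + d)" "t / (t + d) \<le> 1" if "t \<ge> 0" "d \<ge> 0" for t d :: real
      using that by (simp, cases "t + d = 0") (simp_all add: divide_le_eq_1)
    from this[of "(norm x)\<^sup>2" "\<delta>\<^sup>2"] show "0 \<le> \<kappa> \<delta> x" "\<kappa> \<delta> x \<le> 1 / 2"
      by (simp_all add: \<kappa>_def)
  qed
  have slope: "(slope \<delta> ((norm x)\<^sup>2))\<^sup>2 = (profile \<delta> ((norm x)\<^sup>2))\<^sup>2 * (\<kappa> \<delta> x)\<^sup>2" for \<delta> x
    unfolding slope_def \<kappa>_def by (rule power_mult_distrib)
  have SL: "?S \<delta> x \<le> ennreal (1/4) * ?L \<delta> x" for \<delta> x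
  proof -
    have "(\<kappa> \<delta> x)\<^sup>2 \<le> (1 / 2)\<^sup>2" using \<kappa> by (intro power_mono) auto
    then have "(\<kappa> \<delta> x)\<^sup>2 \<le> 1 / 4" by (simp add: power_divide)
    then have "(\<kappa> \<delta> x)\<^sup>2 * ((profile \<delta> ((norm x)\<^sup>2))\<^sup>2 / norm x * (norm (\<psi> x))\<^sup>2)
       \<le> 1 / 4 * ((profile \<delta> ((norm x)\<^sup>2))\<^sup>2 / norm x * (norm (\<psi> x))\<^sup>2)"
      by (rule mult_right_mono) simp
    then show ?thesis by (simp add: slope ennreal_leI mult_ac flip: ennreal_mult)
  qed
  have Xd: "(\<integral>\<^sup>+x. ?L \<delta> x \<partial>lebesgue) \<le> 4 * ?A" if \<delta>: "\<delta> > 0" for \<delta>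
  proof -
    let ?Y = "\<integral>\<^sup>+x. ?L \<delta> x \<partial>lebesgue"
    have "?Y \<le> (\<integral>\<^sup>+x. ennreal (1 / \<delta> * (norm (\<psi> x))\<^sup>2) \<partial>lebesgue)"
    proof (rule nn_integral_mono_AE, use AE_lebesgue_nonzero in eventually_elim)
      fix x :: "real^3" assume x: "x \<noteq> 0"
      have "sqrt (\<delta>\<^sup>2) \<le> sqrt ((norm x)\<^sup>2 + \<delta>\<^sup>2)" by (intro real_sqrt_le_mono) simp
      then have "1 / sqrt ((norm x)\<^sup>2 + \<delta>\<^sup>2) \<le> 1 / \<delta>" using \<delta> by (intro divide_left_mono) (auto simp: zero_less_mult_iff add_nonneg_pos)
      then show "?L \<delta> x \<le> ennreal (1 / \<delta> * (norm (\<psi> x))\<^sup>2)"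
        unfolding profile_square[OF \<delta> x] by (intro ennreal_leI mult_right_mono) auto
    qed
    also have "\<dots> < \<infinity>"
      using nn_integral_eq_integral[OF integrable_mult_right[OF \<psi>i], of "1 / \<delta>"] \<delta> by simp
    finally have Y: "?Y < \<infinity>" .
    have "(\<integral>\<^sup>+x. ?S \<delta> x \<partial>lebesgue) \<le> (\<integral>\<^sup>+x. ennreal (1/4) * ?L \<delta> x \<partial>lebesgue)"
      by (rule nn_integral_mono[OF SL])
    also have "\<dots> = ennreal (1/4) * ?Y" by (rule nn_integral_cmult[OF Lm])
    finally have S4: "(\<integral>\<^sup>+x. ?S \<delta> x \<partial>lebesgue) \<le> ennreal (1/4) * ?Y" .
    \<comment> \<open>Young with parameter one: the commutator contributes twice a quarter of the left-hand side.\<close>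
    have "?Y \<le> ennreal (1 + 1) * ?A + ennreal (1 + 1 / 1) * (\<integral>\<^sup>+x. ?S \<delta> x \<partial>lebesgue)"
      by (rule profile_energy_bound[OF \<psi> w c _ \<delta>]) simp
    also have "\<dots> \<le> ennreal 2 * ?A + ennreal 2 * (ennreal (1/4) * ?Y)"
      by (intro add_mono mult_mono S4) auto
    finally have le: "?Y \<le> ennreal 2 * ?A + ennreal 2 * (ennreal (1/4) * ?Y)" .
    obtain y where y: "?Y = ennreal y" "y \<ge> 0" using Y by (cases ?Y) auto
    obtain a where a: "?A = ennreal a" "a \<ge> 0" using A by (cases ?A) auto
    have e1: "ennreal 2 * ennreal a = ennreal (2 * a)" using a(2) by (intro ennreal_mult[symmetric]) auto
    have e2: "ennreal 2 * (ennreal (1/4) * ennreal y) = ennreal (2 * (1/4 * y))"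
      using y(2) by (simp only: ennreal_mult[symmetric] mult_nonneg_nonneg)
    have e3: "ennreal (2 * a) + ennreal (2 * (1/4 * y)) = ennreal (2 * a + 2 * (1/4 * y))"
      using y(2) a(2) by (intro ennreal_plus[symmetric]) auto
    have "ennreal y \<le> ennreal (2 * a + 2 * (1/4 * y))"
      using le unfolding y(1) a(1) e1 e2 e3 .
    moreover have "0 \<le> 2 * a + 2 * (1/4 * y)" using y(2) a(2) by simp
    ultimately have "y \<le> 2 * a + 2 * (1/4 * y)" by (simp only: ennreal_le_iff)
    then have "y \<le> 4 * a" by simp
    then have "ennreal y \<le> ennreal (4 * a)" by (rule ennreal_leI)
    then show ?thesis unfolding y(1) a(1) using a(2) by (simp add: ennreal_mult)
  qed
  define h where "h n = inverse (real (Suc n))" for n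
  have h: "h n > 0" "h \<longlonglongrightarrow> 0" for n
    using LIMSEQ_inverse_real_of_nat by (simp_all add: h_def[abs_def])
  have limL: "(\<lambda>n. ?L (h n) x) \<longlonglongrightarrow> ennreal ((norm (\<psi> x))\<^sup>2 / norm x)" if x: "x \<noteq> 0" for x
  proof -
    have "(\<lambda>n. 1 / sqrt ((norm x)\<^sup>2 + (h n)\<^sup>2) * (norm (\<psi> x))\<^sup>2) \<longlonglongrightarrow> 1 / sqrt ((norm x)\<^sup>2 + 0\<^sup>2) * (norm (\<psi> x))\<^sup>2"
      using x by (intro tendsto_mult tendsto_divide tendsto_const tendsto_real_sqrt tendsto_add tendsto_power h(2)) auto
    then have "(\<lambda>n. ennreal (1 / sqrt ((norm x)\<^sup>2 + (h n)\<^sup>2) * (norm (\<psi> x))\<^sup>2)) \<longlonglongrightarrow> ennreal ((norm (\<psi> x))\<^sup>2 / norm x)"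
      by (intro tendsto_ennrealI) simp
    then show ?thesis by (simp only: profile_square[OF h(1) x])
  qed
  have fatou: "?X \<le> liminf (\<lambda>n. \<integral>\<^sup>+x. ?L (h n) x \<partial>lebesgue)"
  proof -
    have "?X \<le> (\<integral>\<^sup>+x. liminf (\<lambda>n. ?L (h n) x) \<partial>lebesgue)"
    proof (rule nn_integral_mono_AE, use AE_lebesgue_nonzero in eventually_elim)
      fix x :: "real^3" assume "x \<noteq> 0"
      from lim_imp_Liminf[OF _ limL[OF this]]
      show "ennreal ((norm (\<psi> x))\<^sup>2 / norm x) \<le> liminf (\<lambda>n. ?L (h n) x)" by simp
    qed
    also have "\<dots> \<le> liminf (\<lambda>n. \<integral>\<^sup>+x. ?L (h n) x \<partial>lebesgue)"
      by (rule nn_integral_liminf[OF Lm])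
    finally show ?thesis .
  qed
  also have "\<dots> \<le> liminf (\<lambda>n :: nat. 4 * ?A)"
    by (intro Liminf_mono always_eventually allI Xd h)
  also have "\<dots> = 4 * ?A" by (simp add: Liminf_const)
  also have "\<dots> < \<infinity>" using A by (simp add: ennreal_mult_less_top)
  finally have X: "?X < \<infinity>" .
  have Slim: "(\<lambda>n. \<integral>\<^sup>+x. ?S (h n) x \<partial>lebesgue) \<longlonglongrightarrow> (\<integral>\<^sup>+x. 0 \<partial>(lebesgue :: (real^3) measure))"
  proof (rule nn_integral_dominated_convergence[where w = "\<lambda>x. ennreal ((norm (\<psi> x))\<^sup>2 / norm x)"])
    show "AE x in lebesgue. ?S (h n) x \<le> ennreal ((norm (\<psi> x))\<^sup>2 / norm x)" for n
      using AE_lebesgue_nonzero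
    proof eventually_elim
      fix x :: "real^3" assume x: "x \<noteq> 0"
      have "(\<kappa> (h n) x)\<^sup>2 \<le> 1\<^sup>2" using \<kappa>[of "h n" x] by (intro power_mono) auto
      moreover have "1 / sqrt ((norm x)\<^sup>2 + (h n)\<^sup>2) \<le> 1 / norm x"
      proof -
        have "sqrt ((norm x)\<^sup>2) \<le> sqrt ((norm x)\<^sup>2 + (h n)\<^sup>2)" by (intro real_sqrt_le_mono) simp
        then show ?thesis using x by (intro divide_left_mono) (auto simp: zero_less_mult_iff add_pos_nonneg)
      qed
      ultimately have "1 / sqrt ((norm x)\<^sup>2 + (h n)\<^sup>2) * (\<kappa> (h n) x)\<^sup>2 \<le> 1 / norm x * 1"
        by (intro mult_mono) auto
      then have "1 / sqrt ((norm x)\<^sup>2 + (h n)\<^sup>2) * (\<kappa> (h n) x)\<^sup>2 * (norm (\<psi> x))\<^sup>2 \<le> 1 / norm x * 1 * (norm (\<psi> x))\<^sup>2"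
        by (rule mult_right_mono) simp
      moreover have "(slope (h n) ((norm x)\<^sup>2))\<^sup>2 / norm x = 1 / sqrt ((norm x)\<^sup>2 + (h n)\<^sup>2) * (\<kappa> (h n) x)\<^sup>2"
        unfolding slope profile_square[OF h(1) x, symmetric] by simp
      ultimately show "?S (h n) x \<le> ennreal ((norm (\<psi> x))\<^sup>2 / norm x)"
        by (intro ennreal_leI) simp
    qed
    show "AE x in lebesgue. (\<lambda>n. ?S (h n) x) \<longlonglongrightarrow> 0"
      using AE_lebesgue_nonzero
    proof eventually_elim
      fix x :: "real^3" assume x: "x \<noteq> 0"
      have "(\<lambda>n. \<kappa> (h n) x) \<longlonglongrightarrow> (1 - (norm x)\<^sup>2 / ((norm x)\<^sup>2 + 0\<^sup>2)) / 2"
        unfolding \<kappa>_def using x by (intro tendsto_divide tendsto_diff tendsto_add tendsto_power tendsto_const h(2)) auto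
      then have k0: "(\<lambda>n. \<kappa> (h n) x) \<longlonglongrightarrow> 0" using x by simp
      have "(\<lambda>n. 1 / sqrt ((norm x)\<^sup>2 + (h n)\<^sup>2) * (\<kappa> (h n) x)\<^sup>2 * (norm (\<psi> x))\<^sup>2)
         \<longlonglongrightarrow> 1 / sqrt ((norm x)\<^sup>2 + 0\<^sup>2) * 0\<^sup>2 * (norm (\<psi> x))\<^sup>2"
        using x by (intro tendsto_mult tendsto_divide tendsto_const tendsto_real_sqrt tendsto_add tendsto_power h(2) k0) auto
      moreover have "(slope (h n) ((norm x)\<^sup>2))\<^sup>2 / norm x = 1 / sqrt ((norm x)\<^sup>2 + (h n)\<^sup>2) * (\<kappa> (h n) x)\<^sup>2" for n
        unfolding slope profile_square[OF h(1) x, symmetric] by simp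
      ultimately have "(\<lambda>n. (slope (h n) ((norm x)\<^sup>2))\<^sup>2 / norm x * (norm (\<psi> x))\<^sup>2) \<longlonglongrightarrow> 0" by simp
      from tendsto_ennrealI[OF this] show "(\<lambda>n. ?S (h n) x) \<longlonglongrightarrow> 0" by simp
    qed
    show "?S (h n) \<in> borel_measurable lebesgue" for n by (rule Sm)
    show "(\<lambda>x. ennreal ((norm (\<psi> x))\<^sup>2 / norm x)) \<in> borel_measurable lebesgue" by (rule Xm)
  qed (use X in simp_all)
  have main: "?X \<le> ennreal (1 + s) * ?A" if s: "s > 0" for s
  proof -
    have nz: "ennreal (1 + s) \<noteq> 0" "ennreal (1 + 1 / s) \<noteq> 0"
      using s by (simp_all add: ennreal_eq_0_iff add_pos_pos not_le)
    have "?X \<le> liminf (\<lambda>n. ennreal (1 + s) * ?A + ennreal (1 + 1 / s) * (\<integral>\<^sup>+x. ?S (h n) x \<partial>lebesgue))"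
      by (rule order_trans[OF fatou])
         (intro Liminf_mono always_eventually allI profile_energy_bound[OF \<psi> w c s h(1)])
    also have "\<dots> = ennreal (1 + s) * ?A + ennreal (1 + 1 / s) * (\<integral>\<^sup>+x. 0 \<partial>(lebesgue :: (real^3) measure))"
      using nz by (intro lim_imp_Liminf tendsto_add tendsto_mult_ennreal tendsto_const Slim) auto
    finally show ?thesis by simp
  qed
  obtain a where a: "?A = ennreal a" "a \<ge> 0" using A by (cases ?A) auto
  have "(\<lambda>n. ennreal ((1 + h n) * a)) \<longlonglongrightarrow> ennreal ((1 + 0) * a)"
    by (intro tendsto_ennrealI tendsto_mult tendsto_add tendsto_const h(2))
  moreover have "?X \<le> ennreal ((1 + h n) * a)" for n
    using main[OF h(1)[of n]] h(1)[of n] a by (simp add: ennreal_mult less_imp_le)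
  ultimately have "?X \<le> ennreal ((1 + 0) * a)" by (intro LIMSEQ_le_const) auto
  then show ?thesis using a by simp
qed simp

section \<open>Sharpness of the constant\<close>

text \<open>
  Smooth truncations of \<open>1 / r\<close>, the homogeneous function for which the radial square
  in the massless inequality vanishes.
\<close>

locale extremizer =
  fixes \<rho> :: real
  assumes \<rho>: "\<rho> > 0"
begin

definition "\<nu> t = (t + \<rho>\<^sup>2) powr (- 1/2) * flat_exp (1 - t)"
definition "u x = \<nu> ((norm x)\<^sup>2)" for x :: "real^3"
definition "\<psi> x = u x *\<^sub>R (axis 1 1 :: complex^4)"

lemma smooth_u: "smooth u"
proof -
  note q = smooth_affine_norm_square
  have 1: "smooth (\<lambda>x :: real^3. (\<rho>\<^sup>2 + 1 * (norm (x - 0))\<^sup>2) powr (- 1/2))"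
    by (rule smooth_compose[OF smooth_real_on_powr q]) (use \<rho> in \<open>simp add: add_pos_nonneg\<close>)
  have 2: "smooth (\<lambda>x :: real^3. flat_exp (1 + (- 1) * (norm (x - 0))\<^sup>2))"
    by (rule smooth_compose[OF smooth_real_on_flat_exp q]) simp
  have "smooth (\<lambda>x :: real^3. (\<rho>\<^sup>2 + 1 * (norm (x - 0))\<^sup>2) powr (- 1/2) * flat_exp (1 + (- 1) * (norm (x - 0))\<^sup>2))"
    by (rule smooth_mult[OF 1 2])
  then show ?thesis
    unfolding u_def[abs_def] \<nu>_def by (simp add: add.commute[of "(norm _)\<^sup>2"])
qed

lemma u_outside: "1 \<le> norm x \<Longrightarrow> u x = 0"
  using power_mono[of 1 "norm x" 2] by (simp add: u_def \<nu>_def flat_exp_0)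

lemma test_\<psi>: "test_function \<psi>"
proof -
  have "smooth \<psi>" unfolding \<psi>_def[abs_def] by (rule smooth_scaleR[OF smooth_u smooth_const])
  moreover have "bounded {x. \<psi> x \<noteq> 0}"
  proof (rule bounded_subset[OF bounded_cball[of 0 1]], safe)
    fix x assume "\<psi> x \<noteq> 0"
    then have "\<not> 1 \<le> norm x" using u_outside[of x] by (auto simp: \<psi>_def)
    then show "x \<in> cball 0 1" by simp
  qed
  ultimately show ?thesis by (simp add: test_function_iff)
qed

lemma norm_\<psi>: "norm (\<psi> x) = \<bar>u x\<bar>"
  by (simp add: \<psi>_def)

lemma u_nonneg: "0 \<le> u x" by (simp add: u_def \<nu>_def)

lemma u_eq: "u x = flat_exp (1 - (norm x)\<^sup>2) / sqrt ((norm x)\<^sup>2 + \<rho>\<^sup>2)"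
  using \<rho> by (simp add: u_def \<nu>_def powr_minus_divide powr_half_sqrt add_nonneg_pos)

lemma u_le: "norm x * u x \<le> 1"
proof -
  have "sqrt ((norm x)\<^sup>2) \<le> sqrt ((norm x)\<^sup>2 + \<rho>\<^sup>2)" by (intro real_sqrt_le_mono) simp
  then have "norm x / sqrt ((norm x)\<^sup>2 + \<rho>\<^sup>2) \<le> 1" using \<rho> by (simp add: divide_le_eq_1 add_nonneg_pos)
  then have "norm x / sqrt ((norm x)\<^sup>2 + \<rho>\<^sup>2) * flat_exp (1 - (norm x)\<^sup>2) \<le> 1 * 1"
    by (intro mult_mono flat_exp_le_1) auto
  then show ?thesis by (simp add: u_eq)
qed

text \<open>
  Without the bump the factor \<open>(r\<^sup>2 + \<rho>\<^sup>2)\<^sup>-\<^sup>1\<^sup>/\<^sup>2\<close> satisfies \<open>r |\<nabla>u| \<le> u\<close>; the gradient of the bump adds the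
  second term.
\<close>

lemma gradient_u: "norm x * norm (\<chi> k. partial k u x) \<le> u x + 4 * norm x"
proof -
  let ?t = "(norm x)\<^sup>2" and ?S = "(norm x)\<^sup>2 + \<rho>\<^sup>2"
  have S: "?S > 0" using \<rho> by (simp add: add_nonneg_pos)
  have l: "((\<lambda>t. 1 - t) has_real_derivative - 1) (at ?t)"
    by (auto intro!: derivative_eq_intros)
  have dp: "((\<lambda>t. (t + \<rho>\<^sup>2) powr (- 1/2)) has_real_derivative ?S powr (- 1/2) * ((- 1/2) / ?S)) (at ?t)"
    by (rule powr_shift_derivative[OF S])
  define g' where "g' = ?S powr (- 1/2) * ((- 1/2) / ?S) * flat_exp (1 - ?t) + flat_exp_deriv (1 - ?t) * - 1 * ?S powr (- 1/2)"
  have "(\<nu> has_real_derivative g') (at ?t)"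
    unfolding \<nu>_def[abs_def] g'_def by (rule DERIV_mult[OF dp DERIV_chain2[OF flat_exp_has_derivative l]])
  then have "(u has_derivative (\<lambda>v. g' * (2 *\<^sub>R (x \<bullet> v)))) (at x)"
    unfolding u_def[abs_def]
    by (intro has_derivative_compose[OF has_derivative_sqnorm_at]) (simp add: has_field_derivative_def)
  from partial_eq[OF this] have "(\<chi> k. partial k u x) = (2 * g') *\<^sub>R x"
    by (simp add: vec_eq_iff inner_axis_unit)
  then have n: "norm x * norm (\<chi> k. partial k u x) = 2 * ?t * \<bar>g'\<bar>"
    by (simp add: abs_mult power2_eq_square)
  have P: "?S powr (- 1/2) = 1 / sqrt ?S" using S by (simp add: powr_minus_divide powr_half_sqrt)
  have "\<bar>g'\<bar> \<le> \<bar>?S powr (- 1/2) * ((- 1/2) / ?S) * flat_exp (1 - ?t)\<bar> + \<bar>flat_exp_deriv (1 - ?t) * - 1 * ?S powr (- 1/2)\<bar>"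
    unfolding g'_def by (rule abs_triangle_ineq)
  also have "\<dots> = u x * (1 / (2 * ?S)) + flat_exp_deriv (1 - ?t) / sqrt ?S"
    unfolding P u_eq using S by (simp add: abs_mult flat_exp_deriv_nonneg)
  finally have "2 * ?t * \<bar>g'\<bar> \<le> 2 * ?t * (u x * (1 / (2 * ?S)) + flat_exp_deriv (1 - ?t) / sqrt ?S)"
    by (intro mult_left_mono) auto
  also have "\<dots> = u x * (?t / ?S) + 2 * norm x * (norm x / sqrt ?S) * flat_exp_deriv (1 - ?t)"
  proof -
    have "2 * (a * a) * (b * (1 / (2 * S)) + e / q) = b * ((a * a) / S) + 2 * a * (a / q) * e" for a b e S q :: real
      by (simp add: distrib_left mult_ac)
    from this[of "norm x" "u x" ?S "flat_exp_deriv (1 - ?t)" "sqrt ?S"] show ?thesis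
      by (simp only: power2_eq_square[of "norm x"])
  qed
  also have "\<dots> \<le> u x * 1 + 2 * norm x * 1 * 2"
  proof (intro add_mono mult_mono)
    have "sqrt ?t \<le> sqrt ?S" by (intro real_sqrt_le_mono) simp
    then show "norm x / sqrt ?S \<le> 1" using S by (simp add: divide_le_eq_1)
    show "?t / ?S \<le> 1" using S by (simp add: divide_le_eq_1)
    show "flat_exp_deriv (1 - ?t) \<le> 2" by (rule flat_exp_deriv_bounds)
  qed (use u_nonneg[of x] in \<open>auto simp: flat_exp_deriv_nonneg\<close>)
  finally show ?thesis unfolding n by simp
qed

lemma shifted_dirac_\<psi>:
  assumes "Re c = 0"
  shows "norm (shifted_dirac m c \<psi> (\<lambda>k. partial k \<psi>) x)
     \<le> norm (\<chi> k. partial k u x) + sqrt (m\<^sup>2 + (norm c)\<^sup>2) * u x"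
proof -
  have L: "bounded_linear (\<lambda>r. r *\<^sub>R (axis 1 1 :: complex^4))" by (rule bounded_linear_scaleR_left)
  have p: "partial k \<psi> x = partial k u x *\<^sub>R axis 1 1" for k
    unfolding \<psi>_def[abs_def] by (rule partial_bounded_linear[OF L smooth_differentiable[OF smooth_u]])
  have "shifted_dirac m c \<psi> (\<lambda>k. partial k \<psi>) x = (\<Sum>k\<in>UNIV. partial k u x *\<^sub>R i_alpha k (axis 1 1)) + lower_order m c (\<psi> x)"
    by (simp add: shifted_dirac_i_alpha p linear_scale[OF bounded_linear.linear[OF bounded_linear_i_alpha]])
  then show ?thesis
    using norm_triangle_ineq[of "\<Sum>k\<in>UNIV. partial k u x *\<^sub>R i_alpha k (axis 1 1)" "lower_order m c (\<psi> x)"]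
    by (simp add: norm_sum_i_alpha norm_lower_order[OF assms] norm_\<psi> u_nonneg)
qed

text \<open>
  Young's inequality leaves the terms \<open>r\<close> and \<open>C r u\<^sup>2\<close>.  The latter is unbounded as \<open>\<rho>\<close> tends to \<open>0\<close>, but since \<open>r u \<le> 1\<close> it
  is at most \<open>s u\<^sup>2 / r\<close> plus a constant independent of \<open>\<rho>\<close>.
\<close>

lemma energy_pointwise:
  fixes m :: real and c :: complex
  assumes c: "Re c = 0" and s: "s > 0"
  defines "C \<equiv> (1 + 1 / s) * (2 * (m\<^sup>2 + (norm c)\<^sup>2))"
  shows "norm x * (norm (shifted_dirac m c \<psi> (\<lambda>k. partial k \<psi>) x))\<^sup>2
     \<le> (1 + 2 * s) * ((norm (\<psi> x))\<^sup>2 / norm x) + ((1 + 1 / s) * 32 + C\<^sup>2 / (4 * s)) * indicator (cball 0 1) x"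
    (is "_ * (norm ?F)\<^sup>2 \<le> _ + ?K * _")
proof -
  have C: "C \<ge> 0" using s by (simp add: C_def)
  have K: "?K \<ge> 0" using s by simp
  consider "x = 0" | "norm x > 1" | "x \<noteq> 0" "norm x \<le> 1" by linarith
  then show ?thesis
  proof cases
    case 1
    then show ?thesis using s K by simp
  next
    case 2
    have "partial k \<psi> x = partial k (\<lambda>_. 0) x" for k
      by (rule partial_cong_open[of "- cball 0 1"]) (use 2 in \<open>auto simp: \<psi>_def u_outside open_Compl\<close>)
    moreover have "\<psi> x = 0" using 2 by (simp add: \<psi>_def u_outside)
    ultimately have "?F = 0"
      by (simp add: shifted_dirac_i_alpha i_alpha_def linear_0[OF linear_lower_order])
    then show ?thesis using s 2 by simp
  next
    case 3
    let ?r = "norm x" and ?u = "u x" and ?\<mu> = "sqrt (m\<^sup>2 + (norm c)\<^sup>2)"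
    have r: "?r > 0" using 3 by simp
    have "?r * norm ?F \<le> ?r * (norm (\<chi> k. partial k u x) + ?\<mu> * ?u)"
      by (intro mult_left_mono shifted_dirac_\<psi>[OF c]) simp
    also have "\<dots> \<le> ?u + (4 * ?r + ?r * (?\<mu> * ?u))"
      using gradient_u[of x] by (simp add: distrib_left)
    finally have "(?r * norm ?F)\<^sup>2 \<le> (?u + (4 * ?r + ?r * (?\<mu> * ?u)))\<^sup>2"
      by (rule power_mono) simp
    also have "\<dots> \<le> (1 + s) * ?u\<^sup>2 + (1 + 1 / s) * (4 * ?r + ?r * (?\<mu> * ?u))\<^sup>2"
      using norm_add_square_le[OF s, of ?u "4 * ?r + ?r * (?\<mu> * ?u)"] by simp
    also have "\<dots> \<le> (1 + s) * ?u\<^sup>2 + (1 + 1 / s) * (2 * (4 * ?r)\<^sup>2 + 2 * (?r * (?\<mu> * ?u))\<^sup>2)"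
      using s norm_add_square_le[of 1 "4 * ?r" "?r * (?\<mu> * ?u)"] by (intro add_left_mono mult_left_mono) auto
    also have "\<dots> = (1 + s) * ?u\<^sup>2 + ((1 + 1 / s) * 32 * ?r\<^sup>2 + C * ?r\<^sup>2 * ?u\<^sup>2)"
    proof -
      have H: "(1 + s) * v + P * (2 * (4 * a)\<^sup>2 + 2 * (a * (q * w))\<^sup>2) = (1 + s) * v + (P * 32 * a\<^sup>2 + P * (2 * q\<^sup>2) * a\<^sup>2 * w\<^sup>2)" for v P a q w :: real
        by (simp add: power_mult_distrib algebra_simps)
      have mu: "?\<mu>\<^sup>2 = m\<^sup>2 + (norm c)\<^sup>2" by simp
      show ?thesis
        unfolding C_def using H[of "?u\<^sup>2" "1 + 1 / s" ?r ?\<mu> ?u] by (simp only: mu)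
    qed
    finally have main: "(?r * norm ?F)\<^sup>2 \<le> \<dots>" .
    have ag: "C * ?r\<^sup>2 * ?u\<^sup>2 \<le> s * ?u\<^sup>2 + C\<^sup>2 / (4 * s) * ?r\<^sup>2"
    proof -
      have "0 \<le> (2 * s * ?u - C * (?r\<^sup>2 * ?u))\<^sup>2 / (4 * s)" using s by simp
      also have "\<dots> = s * ?u\<^sup>2 - C * ?r\<^sup>2 * ?u\<^sup>2 + C\<^sup>2 / (4 * s) * (?r * ?u)\<^sup>2 * ?r\<^sup>2"
        using s by (simp add: power2_eq_square field_simps)
      also have "C\<^sup>2 / (4 * s) * (?r * ?u)\<^sup>2 * ?r\<^sup>2 \<le> C\<^sup>2 / (4 * s) * 1 * ?r\<^sup>2"
        using s u_le[of x] u_nonneg[of x] power_le_one[of "?r * ?u" 2] by (intro mult_right_mono mult_left_mono) auto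
      finally show ?thesis by simp
    qed
    have "(?r * norm ?F)\<^sup>2 \<le> (1 + 2 * s) * ?u\<^sup>2 + ?K * ?r\<^sup>2"
      using main ag by (simp add: algebra_simps)
    then have "(?r * norm ?F)\<^sup>2 / ?r \<le> ((1 + 2 * s) * ?u\<^sup>2 + ?K * ?r\<^sup>2) / ?r"
      by (rule divide_right_mono) simp
    moreover have "(?r * norm ?F)\<^sup>2 / ?r = ?r * (norm ?F)\<^sup>2" using r by (simp add: power2_eq_square)
    moreover have "((1 + 2 * s) * ?u\<^sup>2 + ?K * ?r\<^sup>2) / ?r = (1 + 2 * s) * (?u\<^sup>2 / ?r) + ?K * ?r"
      using r by (simp add: add_divide_distrib power2_eq_square)
    moreover have "?K * ?r \<le> ?K * 1" using 3 K by (intro mult_left_mono) auto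
    ultimately show ?thesis using 3 by (simp add: norm_\<psi>)
  qed
qed

end

text \<open>
  The largest \<open>k\<close> that contributes dominates the geometric sum.
\<close>

lemma dyadic_sum_le:
  fixes r :: real
  assumes "r > 0"
  shows "(\<Sum>k<n. 8 ^ k * (if r \<le> (1/2) ^ Suc k then 1 else 0)) \<le> 1 / (7 * r ^ 3)"
proof (induction n)
  case (Suc n)
  show ?case
  proof (cases "r \<le> (1/2) ^ Suc n")
    case True
    have "(\<Sum>k<Suc n. 8 ^ k * (if r \<le> (1/2) ^ Suc k then 1 else 0 :: real)) \<le> (\<Sum>k<Suc n. 8 ^ k)"
      by (intro sum_mono) auto
    also have "\<dots> = (8 ^ Suc n - 1) / 7" by (subst geometric_sum) simp_all
    also have "\<dots> \<le> 8 ^ Suc n / 7" by simp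
    also have "\<dots> \<le> 1 / r ^ 3 / 7"
    proof -
      have "r ^ 3 \<le> ((1/2) ^ Suc n) ^ 3" using True assms by (intro power_mono) auto
      also have "\<dots> = (1/8) ^ Suc n" by (simp add: power3_eq_cube flip: power_mult_distrib)
      finally have "8 ^ Suc n * r ^ 3 \<le> 1" by (simp add: power_one_over field_simps)
      then show ?thesis using assms by (simp add: field_simps)
    qed
    finally show ?thesis by (simp add: field_simps)
  qed (use Suc in simp)
qed (use assms in simp)

lemma flat_exp_mono: "s \<le> t \<Longrightarrow> flat_exp s \<le> flat_exp t"
  by (auto simp: flat_exp_def frac_le)

text \<open>
  The integrand is bounded below by a multiple of \<open>min (r\<^sup>-\<^sup>3, \<rho>\<^sup>-\<^sup>3)\<close> on the ball of radius one half, hence by a sum of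
  \<open>n\<close> weighted indicators of dyadic balls, each of which has the same integral.
\<close>

lemma extremizer_unbounded:
  assumes B: "B \<ge> 0"
  obtains \<rho> where "\<rho> > 0"
    "ennreal B < coulomb_energy (extremizer.\<psi> \<rho>)"
proof -
  define v where "v = unit_ball_vol (real DIM(real^3))"
  have v: "v > 0" by (simp add: v_def)
  define a where "a = flat_exp (3/4)"
  have a: "a > 0" by (simp add: a_def flat_exp_pos)
  define \<gamma> where "\<gamma> = a\<^sup>2 * 7 / 2"
  have \<gamma>: "\<gamma> > 0" using a by (simp add: \<gamma>_def)
  obtain n :: nat where n: "B < real n * (\<gamma> * v / 8)"
    using reals_Archimedean3[of "\<gamma> * v / 8"] \<gamma> v by auto
  \<comment> \<open>At this scale the dyadic sum is also bounded by a multiple of \<open>\<rho>\<^sup>-\<^sup>3\<close>.\<close>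
  define \<rho> where "\<rho> = (1/2 :: real) ^ n"
  have \<rho>: "\<rho> > 0" by (simp add: \<rho>_def)
  interpret extremizer \<rho> by unfold_locales (rule \<rho>)
  define S where "S x = (\<Sum>k<n. 8 ^ k * indicat_real (cball 0 ((1/2) ^ Suc k)) x)" for x :: "real^3"
  have Sn: "S x \<le> 1 / (7 * \<rho> ^ 3)" for x
  proof -
    have "S x \<le> (\<Sum>k<n. 8 ^ k)" unfolding S_def by (intro sum_mono) (simp add: indicator_def)
    also have "\<dots> = (8 ^ n - 1) / 7" by (subst geometric_sum) simp_all
    also have "\<dots> \<le> 8 ^ n / 7" by simp
    also have "8 ^ n = 1 / \<rho> ^ 3"
    proof -
      have "\<rho> ^ 3 = (1/8) ^ n" by (simp add: \<rho>_def power_commutes power3_eq_cube flip: power_mult_distrib)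
      then show ?thesis by (simp add: power_one_over)
    qed
    finally show ?thesis by simp
  qed
  have Sr: "S x \<le> 1 / (7 * norm x ^ 3)" if "x \<noteq> 0" for x
  proof -
    have "indicat_real (cball 0 R) x = (if norm x \<le> R then 1 else 0)" for R
      by (simp add: indicator_def)
    then show ?thesis unfolding S_def using dyadic_sum_le[of "norm x" n] that by (simp only:) simp
  qed
  have S0: "S x = 0" if "norm x > 1/2" for x
  proof -
    have "x \<notin> cball 0 ((1/2) ^ Suc k)" for k
    proof -
      have "(1/2 :: real) ^ Suc k \<le> (1/2) ^ 1" by (intro power_decreasing) auto
      then show ?thesis using that by simp
    qed
    then show ?thesis by (simp add: S_def)
  qed
  have le: "\<gamma> * S x \<le> (norm (\<psi> x))\<^sup>2 / norm x" if x: "x \<noteq> 0" for x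
  proof (cases "norm x > 1/2")
    case False
    define M where "M = max (norm x) \<rho>"
    have M: "M > 0" "norm x \<le> M" "\<rho> \<le> M" using \<rho> by (auto simp: M_def)
    have "S x \<le> 1 / (7 * M ^ 3)" using Sn[of x] Sr[OF x] by (auto simp: M_def max_def)
    then have "\<gamma> * S x \<le> \<gamma> * (1 / (7 * M ^ 3))" using \<gamma> by (intro mult_left_mono) auto
    also have "\<dots> = a\<^sup>2 / (M * (M\<^sup>2 + M\<^sup>2))" using M by (simp add: \<gamma>_def power2_eq_square power3_eq_cube field_simps)
    also have "\<dots> \<le> (flat_exp (1 - (norm x)\<^sup>2))\<^sup>2 / (norm x * ((norm x)\<^sup>2 + \<rho>\<^sup>2))"
    proof (intro frac_le)
      have "(norm x)\<^sup>2 \<le> (1/2)\<^sup>2" using False by (intro power_mono) auto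
      then have "a \<le> flat_exp (1 - (norm x)\<^sup>2)" unfolding a_def by (intro flat_exp_mono) (simp add: power_divide)
      then show "a\<^sup>2 \<le> (flat_exp (1 - (norm x)\<^sup>2))\<^sup>2" using a by (intro power_mono) auto
      show "norm x * ((norm x)\<^sup>2 + \<rho>\<^sup>2) \<le> M * (M\<^sup>2 + M\<^sup>2)"
        using M \<rho> by (intro mult_mono add_mono power_mono) auto
      show "0 < norm x * ((norm x)\<^sup>2 + \<rho>\<^sup>2)" using x \<rho> by (simp add: add_pos_pos)
    qed simp
    also have "\<dots> = (norm (\<psi> x))\<^sup>2 / norm x"
    proof -
      have "(norm (\<psi> x))\<^sup>2 = (flat_exp (1 - (norm x)\<^sup>2))\<^sup>2 / ((norm x)\<^sup>2 + \<rho>\<^sup>2)"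
        by (simp add: norm_\<psi> u_eq power_divide)
      then show ?thesis by (simp add: mult.commute)
    qed
    finally show ?thesis .
  qed (simp add: S0)
  have "(\<integral>\<^sup>+x. ennreal (\<gamma> * S x) \<partial>lebesgue) = (\<integral>\<^sup>+x. (\<Sum>k<n. ennreal (\<gamma> * 8 ^ k) * indicator (cball (0 :: real^3) ((1/2) ^ Suc k)) x) \<partial>lebesgue)"
  proof (rule nn_integral_cong)
    fix x :: "real^3"
    have "\<gamma> * S x = (\<Sum>k<n. \<gamma> * 8 ^ k * indicator (cball (0 :: real^3) ((1/2) ^ Suc k)) x)"
      unfolding S_def sum_distrib_left by (simp only: mult.assoc)
    then have "ennreal (\<gamma> * S x) = (\<Sum>k<n. ennreal (\<gamma> * 8 ^ k * indicator (cball (0 :: real^3) ((1/2) ^ Suc k)) x))"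
      using \<gamma> by (simp only:) (subst sum_ennreal, auto)
    also have "\<dots> = (\<Sum>k<n. ennreal (\<gamma> * 8 ^ k) * indicator (cball (0 :: real^3) ((1/2) ^ Suc k)) x)"
      by (intro sum.cong refl) (simp add: indicator_def)
    finally show "ennreal (\<gamma> * S x) = (\<Sum>k<n. ennreal (\<gamma> * 8 ^ k) * indicator (cball (0 :: real^3) ((1/2) ^ Suc k)) x)" .
  qed
  also have "\<dots> = (\<Sum>k<n. ennreal (\<gamma> * 8 ^ k) * emeasure lebesgue (cball (0 :: real^3) ((1/2) ^ Suc k)))"
  proof -
    have m: "cball (0 :: real^3) R \<in> sets lebesgue" for R by simp
    have "(\<lambda>x. ennreal (\<gamma> * 8 ^ k) * indicator (cball (0 :: real^3) ((1/2) ^ Suc k)) x) \<in> borel_measurable lebesgue" for k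
      by (intro borel_measurable_times_ennreal borel_measurable_const borel_measurable_indicator m)
    then show ?thesis by (simp only: nn_integral_sum nn_integral_cmult_indicator[OF m])
  qed
  also have "\<dots> = (\<Sum>k<n. ennreal (\<gamma> * v / 8))"
  proof (intro sum.cong refl)
    fix k
    have "emeasure lebesgue (cball (0 :: real^3) ((1/2) ^ Suc k)) = ennreal (v * ((1/2) ^ Suc k) ^ 3)"
      using emeasure_cball[of "(1/2) ^ Suc k" "0 :: real^3"] by (simp add: v_def)
    then have "ennreal (\<gamma> * 8 ^ k) * emeasure lebesgue (cball (0 :: real^3) ((1/2) ^ Suc k)) = ennreal (\<gamma> * 8 ^ k * (v * ((1/2) ^ Suc k) ^ 3))"
      using \<gamma> v by (simp only:) (intro ennreal_mult[symmetric], auto)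
    also have "\<gamma> * 8 ^ k * (v * ((1/2) ^ Suc k) ^ 3) = \<gamma> * v / 8"
    proof -
      have "((1/2 :: real) ^ Suc k) ^ 3 = (1/8) ^ Suc k" by (simp add: power3_eq_cube flip: power_mult_distrib)
      then show ?thesis by (simp add: power_one_over)
    qed
    finally show "ennreal (\<gamma> * 8 ^ k) * emeasure lebesgue (cball (0 :: real^3) ((1/2) ^ Suc k)) = ennreal (\<gamma> * v / 8)" .
  qed
  also have "\<dots> = ennreal (real n * (\<gamma> * v / 8))"
    using \<gamma> v by (subst sum_ennreal) simp_all
  finally have "ennreal (real n * (\<gamma> * v / 8)) = (\<integral>\<^sup>+x. ennreal (\<gamma> * S x) \<partial>lebesgue)" by simp
  also have "\<dots> \<le> coulomb_energy \<psi>"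
    by (rule nn_integral_mono_AE, use AE_lebesgue_nonzero in eventually_elim) (intro ennreal_leI le)
  finally have "ennreal (real n * (\<gamma> * v / 8)) \<le> coulomb_energy \<psi>" .
  moreover have "ennreal B < ennreal (real n * (\<gamma> * v / 8))"
    using n B by (intro ennreal_lessI) linarith+
  ultimately have "ennreal B < coulomb_energy \<psi>"
    by (rule order.strict_trans2[rotated])
  then show thesis by (rule that[OF \<rho>])
qed

text \<open>
  If the constant \<open>C < 1\<close> sufficed, the comparison of the energies would bound the left-hand side by a number
  independent of \<open>\<rho>\<close>.
\<close>

lemma hardy_constant_sharp:
  assumes c: "Re c = 0" and C: "0 \<le> C" "C < 1"
  shows "\<exists>\<psi>. test_function \<psi> \<and>
    \<not> coulomb_energy \<psi>
      \<le> ennreal C * weighted_energy (shifted_dirac m c \<psi> (\<lambda>k. partial k \<psi>))"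
proof -
  \<comment> \<open>This choice makes \<open>C (1 + 2 s) \<le> (1 + C) / 2 < 1\<close>.\<close>
  define s where "s = (1 - C) / 4"
  have s: "s > 0" using C by (simp add: s_def)
  define K where "K = (1 + 1 / s) * 32 + ((1 + 1 / s) * (2 * (m\<^sup>2 + (norm c)\<^sup>2)))\<^sup>2 / (4 * s)"
  have K: "K \<ge> 0" using s by (simp add: K_def)
  define V where "V = measure lebesgue (cball (0 :: real^3) 1)"
  have V: "emeasure lebesgue (cball (0 :: real^3) 1) = ennreal V" "V \<ge> 0"
    using emeasure_bounded_finite[OF bounded_cball, of "0 :: real^3" 1]
    by (simp_all add: V_def emeasure_eq_ennreal_measure infinity_ennreal_def less_top)
  obtain \<rho> where \<rho>: "\<rho> > 0"
    and big: "ennreal (K * V / ((1 - C) / 2)) < coulomb_energy (extremizer.\<psi> \<rho>)"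
    by (rule extremizer_unbounded[of "K * V / ((1 - C) / 2)"]) (use K V(2) C in auto)
  interpret extremizer \<rho> by unfold_locales (rule \<rho>)
  let ?L = "coulomb_energy \<psi>"
  let ?E = "weighted_energy (shifted_dirac m c \<psi> (\<lambda>k. partial k \<psi>))"
  have "?E < \<infinity>"
    using nn_integral_eq_integral[OF integrable_dirac_energy[OF test_\<psi>, of m c]] by simp
  have Lm: "(\<lambda>x. ennreal ((norm (\<psi> x))\<^sup>2 / norm x)) \<in> borel_measurable lebesgue"
  proof -
    have "smooth \<psi>" using test_\<psi> by (simp add: test_function_iff)
    then have m: "\<psi> \<in> borel_measurable lebesgue" by (intro measurable_continuous_lebesgue smooth_continuous)
    note nm = norm_measurable_lebesgue
    show ?thesis
      by (intro measurable_compose[OF _ measurable_ennreal] borel_measurable_divide borel_measurable_power nm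
          measurable_compose[OF m borel_measurable_norm])
  qed
  have bm: "cball (0 :: real^3) 1 \<in> sets lebesgue" by simp
  have EL: "?E \<le> ennreal (1 + 2 * s) * ?L + ennreal (K * V)"
  proof -
    have "?E \<le> (\<integral>\<^sup>+x. ennreal (1 + 2 * s) * ennreal ((norm (\<psi> x))\<^sup>2 / norm x) + ennreal K * indicator (cball 0 1) x \<partial>lebesgue)"
    proof (rule nn_integral_mono)
      fix x :: "real^3"
      have "norm x * (norm (shifted_dirac m c \<psi> (\<lambda>k. partial k \<psi>) x))\<^sup>2
         \<le> (1 + 2 * s) * ((norm (\<psi> x))\<^sup>2 / norm x) + K * indicator (cball 0 1) x"
        unfolding K_def by (rule energy_pointwise[OF c s])
      then have "ennreal (norm x * (norm (shifted_dirac m c \<psi> (\<lambda>k. partial k \<psi>) x))\<^sup>2)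
         \<le> ennreal ((1 + 2 * s) * ((norm (\<psi> x))\<^sup>2 / norm x) + K * indicator (cball 0 1) x)"
        by (rule ennreal_leI)
      also have "\<dots> = ennreal (1 + 2 * s) * ennreal ((norm (\<psi> x))\<^sup>2 / norm x) + ennreal K * indicator (cball 0 1) x"
      proof -
        let ?w = "(norm (\<psi> x))\<^sup>2 / norm x"
        have "ennreal ((1 + 2 * s) * ?w + K * indicator (cball 0 1) x) = ennreal ((1 + 2 * s) * ?w) + ennreal (K * indicator (cball 0 1) x)"
          using s K by (intro ennreal_plus) auto
        moreover have "ennreal ((1 + 2 * s) * ?w) = ennreal (1 + 2 * s) * ennreal ?w"
          using s by (intro ennreal_mult) auto
        moreover have "ennreal (K * indicator (cball 0 1) x) = ennreal K * indicator (cball 0 1) x"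
          by (simp split: split_indicator)
        ultimately show ?thesis by (simp only:)
      qed
      finally show "ennreal (norm x * (norm (shifted_dirac m c \<psi> (\<lambda>k. partial k \<psi>) x))\<^sup>2)
         \<le> ennreal (1 + 2 * s) * ennreal ((norm (\<psi> x))\<^sup>2 / norm x) + ennreal K * indicator (cball 0 1) x" .
    qed
    also have "\<dots> = ennreal (1 + 2 * s) * ?L + ennreal K * emeasure lebesgue (cball (0 :: real^3) 1)"
      by (simp only: nn_integral_add[OF borel_measurable_times_ennreal[OF borel_measurable_const Lm]
            borel_measurable_times_ennreal[OF borel_measurable_const borel_measurable_indicator[OF bm]]]
          nn_integral_cmult[OF Lm] nn_integral_cmult_indicator[OF bm])
    also have "\<dots> = ennreal (1 + 2 * s) * ?L + ennreal (K * V)"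
      unfolding V(1) using K V(2) by (simp add: ennreal_mult)
    finally show ?thesis .
  qed
  have "\<not> ?L \<le> ennreal C * ?E"
  proof
    assume le: "?L \<le> ennreal C * ?E"
    also have "\<dots> < \<infinity>" using \<open>?E < \<infinity>\<close> by (simp add: ennreal_mult_less_top)
    finally have "?L < \<infinity>" .
    then obtain l where l: "?L = ennreal l" "l \<ge> 0" by (cases ?L) auto
    have "ennreal l \<le> ennreal C * (ennreal (1 + 2 * s) * ennreal l + ennreal (K * V))"
      using order_trans[OF le mult_left_mono[OF EL]] unfolding l(1) by simp
    also have "\<dots> = ennreal (C * ((1 + 2 * s) * l + K * V))"
    proof -
      have "ennreal (1 + 2 * s) * ennreal l = ennreal ((1 + 2 * s) * l)" using s l(2) by (intro ennreal_mult[symmetric]) auto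
      moreover have "ennreal ((1 + 2 * s) * l) + ennreal (K * V) = ennreal ((1 + 2 * s) * l + K * V)"
        using s l(2) K V(2) by (intro ennreal_plus[symmetric]) auto
      moreover have "ennreal C * ennreal ((1 + 2 * s) * l + K * V) = ennreal (C * ((1 + 2 * s) * l + K * V))"
        using C s l(2) K V(2) by (intro ennreal_mult[symmetric]) auto
      ultimately show ?thesis by simp
    qed
    finally have "ennreal l \<le> ennreal (C * ((1 + 2 * s) * l + K * V))" .
    moreover have "0 \<le> C * ((1 + 2 * s) * l + K * V)" using C s l(2) K V(2) by simp
    ultimately have l2: "l \<le> C * ((1 + 2 * s) * l + K * V)" by (simp only: ennreal_le_iff)
    have "C * (1 + 2 * s) \<le> (1 + C) / 2"
    proof -
      have "C * (1 - C) \<le> 1 * (1 - C)" using C by (intro mult_right_mono) auto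
      then have "C + C * (1 - C) / 2 \<le> C + 1 * (1 - C) / 2" by (intro add_left_mono divide_right_mono) auto
      moreover have "C * (1 + 2 * s) = C + C * (1 - C) / 2" by (simp add: s_def field_simps)
      moreover have "C + 1 * (1 - C) / 2 = (1 + C) / 2" by (simp add: field_simps)
      ultimately show ?thesis by (simp only:)
    qed
    then have "C * (1 + 2 * s) * l \<le> (1 + C) / 2 * l" using l(2) by (rule mult_right_mono)
    moreover have "C * (K * V) \<le> 1 * (K * V)" using C K V(2) by (intro mult_right_mono) auto
    moreover have "C * ((1 + 2 * s) * l + K * V) = C * (1 + 2 * s) * l + C * (K * V)" by (simp add: algebra_simps)
    ultimately have "l \<le> (1 + C) / 2 * l + K * V" using l2 by linarith
    then have "(1 - C) / 2 * l \<le> K * V" by (simp add: field_simps)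
    then have "l \<le> K * V / ((1 - C) / 2)" using C by (simp add: pos_le_divide_eq mult.commute)
    then have "ennreal l \<le> ennreal (K * V / ((1 - C) / 2))" by (rule ennreal_leI)
    then show False using big unfolding l(1) by (simp add: not_less[symmetric])
  qed
  then show ?thesis using test_\<psi> by blast
qed

theorem theorem1p3:
  fixes m \<epsilon> :: real and c :: complex
  assumes "0 \<le> m" and "0 < \<epsilon>"
    and "c = \<i> * complex_of_real \<epsilon> \<or> c = - (\<i> * complex_of_real \<epsilon>)"
  shows
    "(\<forall>\<psi> D. spinor_field \<psi> D \<longrightarrow>
        (\<integral>\<^sup>+ x. ennreal ((norm (\<psi> x))\<^sup>2 / norm x) \<partial>lebesgue)
          \<le> (\<integral>\<^sup>+ x. ennreal (norm x * (norm (shifted_dirac m c \<psi> D x))\<^sup>2) \<partial>lebesgue))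
     \<and>
     (\<forall>C::real. 0 \<le> C \<and> C < 1 \<longrightarrow>
        (\<exists>\<psi>. test_function \<psi> \<and> spinor_field \<psi> (\<lambda>k. partial k \<psi>) \<and>
          \<not> (\<integral>\<^sup>+ x. ennreal ((norm (\<psi> x))\<^sup>2 / norm x) \<partial>lebesgue)
            \<le> ennreal C *
               (\<integral>\<^sup>+ x. ennreal (norm x * (norm (shifted_dirac m c \<psi> (\<lambda>k. partial k \<psi>) x))\<^sup>2)
                  \<partial>lebesgue)))"
proof -
  have c: "Re c = 0" using assms(3) by auto
  show ?thesis
  proof (intro conjI allI impI)
    fix \<psi> D assume "spinor_field \<psi> D"
    then have sq: "square_integrable \<psi>" and w: "\<And>k. has_weak_partial k \<psi> (D k)" by (auto simp: spinor_field_def)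
    show "(\<integral>\<^sup>+ x. ennreal ((norm (\<psi> x))\<^sup>2 / norm x) \<partial>lebesgue)
          \<le> (\<integral>\<^sup>+ x. ennreal (norm x * (norm (shifted_dirac m c \<psi> D x))\<^sup>2) \<partial>lebesgue)"
      by (rule dirac_hardy_inequality[OF sq w c])
  next
    fix C :: real assume "0 \<le> C \<and> C < 1"
    then show "\<exists>\<psi>. test_function \<psi> \<and> spinor_field \<psi> (\<lambda>k. partial k \<psi>) \<and>
          \<not> (\<integral>\<^sup>+ x. ennreal ((norm (\<psi> x))\<^sup>2 / norm x) \<partial>lebesgue)
            \<le> ennreal C *
               (\<integral>\<^sup>+ x. ennreal (norm x * (norm (shifted_dirac m c \<psi> (\<lambda>k. partial k \<psi>) x))\<^sup>2)
                  \<partial>lebesgue)"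
      using hardy_constant_sharp[OF c, of C m] test_function_spinor_field by blast
  qed
qed

end
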